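(* Let $M$ be a compact $C^1$-Riemannian manifold of dimension $d$ and let $f : M \to M$ be a $C^1$-map. For every integer $k$ with $1 \leq k \leq d$ there exists an ergodic $f$-invariant Borel probability measure $\nu(k)$ on $M$ whose Lyapunov exponents $\chi_1 \geq \chi_2 \geq \dots \geq \chi_d$ satisfy $$\sum_{i=1}^{k} \chi_i \geq d_k,$$ where $d_k$ is the $k$-dilation of $f$.
   Context: For $1 \leq k \leq d$, let $\mathcal{S}_k$ be the set of $C^1$-maps $\sigma : D^k = [0,1]^k \to M$. The $k$-volume of $\sigma \in \mathcal{S}_k$ is $$V(\sigma) = \int_{D^k} |\Lambda^k T_x \sigma| \, d\lambda(x),$$ where $\lambda$ is Lebesgue measure on $D^k$ and $|\Lambda^k T_x\sigma|$ is the norm of the linear map $\Lambda^k T_x \sigma : \Lambda^k T_x D^k \to \Lambda^k T_{\sigma(x)} M$ induced by the differential $T_x\sigma$, with respect to the norms induced by the Riemannian metric on $M$ (and the Euclidean metric on $D^k$). The $k$-dilation of $f$ is $$d_k := \limsup_{n \to \infty} \frac{1}{n} \log \sup_{\sigma \in \mathcal{S}_k} \frac{V(f^n \circ \sigma)}{V(\sigma)},$$ where $f^n$ is the $n$-th iterate of $f$ and the supremum is over those $\sigma$ with $V(\sigma) > 0$. The convention $\log 0 = -\infty$ is used, so $d_k \in [-\infty, \infty)$. The map $f$ is not assumed invertible. The Lyapunov exponents of an ergodic $f$-invariant probability measure $\mu$, listed with multiplicity in decreasing order, are the constants $\chi_1 \geq \dots \geq \chi_d$ in $[-\infty, \infty)$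 such that, for $\mu$-a.e. $x$, $\chi_i = \lim_{n\to\infty} \frac{1}{n} \log s_i(T_x f^n)$, where $s_1 \geq \dots \geq s_d \geq 0$ denote the singular values. Their partial sums satisfy $\sum_{i=1}^k \chi_i = \lim_{m \to \infty} \frac{1}{m} \int \log |\Lambda^k T_y f^m| \, d\mu(y)$. *)

theory Defs
  imports "HOL-Probability.Probability"
begin

section \<open>Manifolds of class C1 and continuous Riemannian metrics\<close>

definition C1_on :: "('a::euclidean_space \<Rightarrow> 'b::euclidean_space) \<Rightarrow> 'a set \<Rightarrow> bool" where
  "C1_on h S \<longleftrightarrow> (\<exists>h' :: 'a \<Rightarrow> 'a \<Rightarrow>\<^sub>L 'b.
     (\<forall>x\<in>S. (h has_derivative blinfun_apply (h' x)) (at x within S)) \<and> continuous_on S h')"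

text \<open>A chart consists of its domain and its coordinate map; the values of the
  coordinate map outside the domain are irrelevant.\<close>

type_synonym ('m, 'e) chart = "'m set \<times> ('m \<Rightarrow> 'e)"

abbreviation chart_dom :: "('m, 'e) chart \<Rightarrow> 'm set" where
  "chart_dom \<equiv> fst"

abbreviation coord :: "('m, 'e) chart \<Rightarrow> 'm \<Rightarrow> 'e" where
  "coord \<equiv> snd"

definition chart_inv :: "('m, 'e) chart \<Rightarrow> 'e \<Rightarrow> 'm" where
  "chart_inv c = inv_into (chart_dom c) (coord c)"

definition topological_chart ::
    "('m::topological_space, 'e::euclidean_space) chart \<Rightarrow> bool" where
  "topological_chart c \<longleftrightarrow>
     open (chart_dom c) \<and> open (coord c ` chart_dom c) \<and>
     homeomorphism (chart_dom c) (coord c ` chart_dom c) (coord c) (chart_inv c)"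

definition C1_atlas :: "('m::topological_space, 'e::euclidean_space) chart set \<Rightarrow> bool" where
  "C1_atlas \<A> \<longleftrightarrow>
     (\<Union>c\<in>\<A>. chart_dom c) = UNIV \<and>
     (\<forall>c\<in>\<A>. topological_chart c) \<and>
     (\<forall>c\<in>\<A>. \<forall>c'\<in>\<A>.
        C1_on (coord c' \<circ> chart_inv c) (coord c ` (chart_dom c \<inter> chart_dom c')))"

definition C1_map :: "('m::topological_space, 'e::euclidean_space) chart set \<Rightarrow> ('m \<Rightarrow> 'm) \<Rightarrow> bool" where
  "C1_map \<A> f \<longleftrightarrow>
     continuous_on UNIV f \<and>
     (\<forall>c\<in>\<A>. \<forall>c'\<in>\<A>.
        C1_on (coord c' \<circ> f \<circ> chart_inv c) (coord c ` (chart_dom c \<inter> f -` chart_dom c')))"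

text \<open>The value \<open>g c x\<close> is the inner product of \<open>T\<^sub>x M\<close> in the coordinates of the chart \<open>c\<close>.
  On a manifold that is only C1 the tangent bundle is only a topological bundle, so
  continuity is the strongest regularity of a metric that is independent of the charts.\<close>

type_synonym ('m, 'e) metric = "('m, 'e) chart \<Rightarrow> 'm \<Rightarrow> 'e \<Rightarrow> 'e \<Rightarrow> real"

definition riemannian_metric ::
    "('m::topological_space, 'e::euclidean_space) chart set \<Rightarrow> ('m, 'e) metric \<Rightarrow> bool" where
  "riemannian_metric \<A> g \<longleftrightarrow>
     (\<forall>c\<in>\<A>. \<forall>x\<in>chart_dom c.
        bilinear (g c x) \<and> (\<forall>u v. g c x u v = g c x v u) \<and> (\<forall>u. u \<noteq> 0 \<longrightarrow> g c x u u > 0)) \<and>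
     (\<forall>c\<in>\<A>. \<forall>u v. continuous_on (chart_dom c) (\<lambda>x. g c x u v)) \<and>
     (\<forall>c\<in>\<A>. \<forall>c'\<in>\<A>. \<forall>x\<in>chart_dom c \<inter> chart_dom c'.
        let D = frechet_derivative (coord c' \<circ> chart_inv c) (at (coord c x))
        in \<forall>u v. g c x u v = g c' x (D u) (D v))"

text \<open>The tangent space at \<open>x\<close> is represented by the model space via a chosen chart at \<open>x\<close>.
  By the transformation rule of the metric, the norms and singular values defined
  below do not depend on this choice.\<close>

definition chart_at :: "('m, 'e) chart set \<Rightarrow> 'm \<Rightarrow> ('m, 'e) chart" where
  "chart_at \<A> x = (SOME c. c \<in> \<A> \<and> x \<in> chart_dom c)"

definition metric_at :: "('m, 'e) chart set \<Rightarrow> ('m, 'e) metric \<Rightarrow> 'm \<Rightarrow> 'e \<Rightarrow> 'e \<Rightarrow> real" where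
  "metric_at \<A> g x = g (chart_at \<A> x) x"

definition tangent_map ::
    "('m, 'e::euclidean_space) chart set \<Rightarrow> ('m \<Rightarrow> 'm) \<Rightarrow> 'm \<Rightarrow> 'e \<Rightarrow> 'e" where
  "tangent_map \<A> f x =
     frechet_derivative (coord (chart_at \<A> (f x)) \<circ> f \<circ> chart_inv (chart_at \<A> x))
       (at (coord (chart_at \<A> x) x))"


section \<open>Norm of the map induced on the exterior power\<close>

text \<open>An element of the exterior power of degree \<open>k = CARD('k)\<close> of \<open>'v\<close> is represented by a formal
  linear combination of \<open>k\<close>-tuples, \<open>(a, u)\<close> standing for \<open>a u\<^sub>1 \<and> \<dots> \<and> u\<^sub>k\<close>. An inner product
  \<open>B\<close> on \<open>'v\<close> induces the bilinear extension of
  \<open>\<langle>u\<^sub>1 \<and> \<dots> \<and> u\<^sub>k, v\<^sub>1 \<and> \<dots> \<and> v\<^sub>k\<rangle> = det (B u\<^sub>i v\<^sub>j)\<close>.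
  Two formal combinations represent the same element of the exterior power iff their difference
  has norm zero, so operator norms can be computed on representatives.\<close>

type_synonym ('v, 'k) multivec = "(real \<times> ('v, 'k) vec) list"

definition ext_inner ::
    "('v \<Rightarrow> 'v \<Rightarrow> real) \<Rightarrow> ('v, 'k::finite) multivec \<Rightarrow> ('v, 'k) multivec \<Rightarrow> real" where
  "ext_inner B \<xi> \<eta> =
     (\<Sum>(a, u)\<leftarrow>\<xi>. \<Sum>(b, v)\<leftarrow>\<eta>. a * b * det (\<chi> i j. B (u $ i) (v $ j)))"

definition ext_norm :: "('v \<Rightarrow> 'v \<Rightarrow> real) \<Rightarrow> ('v, 'k::finite) multivec \<Rightarrow> real" where
  "ext_norm B \<xi> = sqrt (ext_inner B \<xi> \<xi>)"

definition ext_map :: "('v \<Rightarrow> 'w) \<Rightarrow> ('v, 'k::finite) multivec \<Rightarrow> ('w, 'k) multivec" where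
  "ext_map L \<xi> = map (\<lambda>(a, u). (a, \<chi> i. L (u $ i))) \<xi>"

definition ext_opnorm ::
    "'k::finite itself \<Rightarrow> ('v \<Rightarrow> 'v \<Rightarrow> real) \<Rightarrow> ('w \<Rightarrow> 'w \<Rightarrow> real) \<Rightarrow> ('v \<Rightarrow> 'w) \<Rightarrow> real" where
  "ext_opnorm _ BV BW L =
     (SUP \<xi>\<in>{\<xi> :: ('v, 'k) multivec. ext_norm BV \<xi> \<le> 1}. ext_norm BW (ext_map L \<xi>))"


section \<open>Volumes and dilation\<close>

abbreviation unit_cube :: "(real^'k::finite) set" where
  "unit_cube \<equiv> cbox 0 1"

text \<open>Derivatives on the closed cube are taken within the cube, hence one-sided at its boundary.\<close>

definition C1_cubes :: "('m::topological_space, 'e::euclidean_space) chart set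
    \<Rightarrow> (real^'k::finite \<Rightarrow> 'm) set" where
  "C1_cubes \<A> = {\<sigma>. continuous_on unit_cube \<sigma> \<and>
     (\<forall>c\<in>\<A>. C1_on (coord c \<circ> \<sigma>) (unit_cube \<inter> \<sigma> -` chart_dom c))}"

definition cube_tangent_map :: "('m, 'e::euclidean_space) chart set
    \<Rightarrow> (real^'k::finite \<Rightarrow> 'm) \<Rightarrow> real^'k \<Rightarrow> real^'k \<Rightarrow> 'e" where
  "cube_tangent_map \<A> \<sigma> x =
     frechet_derivative (coord (chart_at \<A> (\<sigma> x)) \<circ> \<sigma>) (at x within unit_cube)"

definition volume :: "('m, 'e::euclidean_space) chart set \<Rightarrow> ('m, 'e) metric
    \<Rightarrow> (real^'k::finite \<Rightarrow> 'm) \<Rightarrow> real" where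
  "volume \<A> g \<sigma> =
     (LINT x:unit_cube|lborel.
        ext_opnorm TYPE('k) inner (metric_at \<A> g (\<sigma> x)) (cube_tangent_map \<A> \<sigma> x))"

definition ln_ereal :: "ereal \<Rightarrow> ereal" where
  "ln_ereal x = (if x \<le> 0 then -\<infinity> else if x = \<infinity> then \<infinity> else ereal (ln (real_of_ereal x)))"

definition dilation :: "'k::finite itself \<Rightarrow> ('m::topological_space, 'e::euclidean_space) chart set
    \<Rightarrow> ('m, 'e) metric \<Rightarrow> ('m \<Rightarrow> 'm) \<Rightarrow> ereal" where
  "dilation _ \<A> g f =
     limsup (\<lambda>n. ereal (1 / real n) *
       ln_ereal (SUP \<sigma>\<in>{\<sigma> \<in> C1_cubes \<A> :: (real^'k \<Rightarrow> 'm) set. volume \<A> g \<sigma> > 0}.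
         ereal (volume \<A> g ((f ^^ n) \<circ> \<sigma>) / volume \<A> g \<sigma>)))"


section \<open>Singular values and Lyapunov exponents\<close>

definition metric_adjoint ::
    "('v \<Rightarrow> 'v \<Rightarrow> real) \<Rightarrow> ('w \<Rightarrow> 'w \<Rightarrow> real) \<Rightarrow> ('v \<Rightarrow> 'w) \<Rightarrow> 'w \<Rightarrow> 'v" where
  "metric_adjoint BV BW L = (SOME L'. \<forall>u w. BW (L u) w = BV u (L' w))"

text \<open>The square roots of the eigenvalues of \<open>L\<^sup>* L\<close>, in decreasing order and listed according to
  the dimensions of the eigenspaces; the length of the list is \<open>DIM('v)\<close>.\<close>

definition singular_values :: "('v::euclidean_space \<Rightarrow> 'v \<Rightarrow> real) \<Rightarrow> ('w \<Rightarrow> 'w \<Rightarrow> real)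
    \<Rightarrow> ('v \<Rightarrow> 'w) \<Rightarrow> real list" where
  "singular_values BV BW L =
     (THE s. sorted_wrt (\<ge>) s \<and> (\<forall>t\<in>set s. t \<ge> 0) \<and>
        (\<forall>t\<ge>0. count_list s t = dim {u. metric_adjoint BV BW L (L u) = t\<^sup>2 *\<^sub>R u}))"

definition tangent_singular_value :: "('m, 'e::euclidean_space) chart set \<Rightarrow> ('m, 'e) metric
    \<Rightarrow> ('m \<Rightarrow> 'm) \<Rightarrow> 'm \<Rightarrow> nat \<Rightarrow> real" where
  "tangent_singular_value \<A> g f x i =
     singular_values (metric_at \<A> g x) (metric_at \<A> g (f x)) (tangent_map \<A> f x) ! (i - 1)"

definition ergodic_invariant :: "('m::topological_space \<Rightarrow> 'm) \<Rightarrow> 'm measure \<Rightarrow> bool" where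
  "ergodic_invariant f \<mu> \<longleftrightarrow>
     prob_space \<mu> \<and> sets \<mu> = sets borel \<and>
     f \<in> measurable \<mu> \<mu> \<and> distr \<mu> \<mu> f = \<mu> \<and>
     (\<forall>B\<in>sets \<mu>. f -` B = B \<longrightarrow> measure \<mu> B = 0 \<or> measure \<mu> B = 1)"

definition lyapunov_exponents :: "('m, 'e::euclidean_space) chart set \<Rightarrow> ('m, 'e) metric
    \<Rightarrow> ('m \<Rightarrow> 'm) \<Rightarrow> 'm measure \<Rightarrow> (nat \<Rightarrow> ereal) \<Rightarrow> bool" where
  "lyapunov_exponents \<A> g f \<mu> \<kappa> \<longleftrightarrow>
     (\<forall>i\<in>{1..DIM('e)}. \<kappa> i < \<infinity>) \<and>
     (\<forall>i\<in>{1..DIM('e)}. \<forall>j\<in>{i..DIM('e)}. \<kappa> j \<le> \<kappa> i) \<and>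
     (AE x in \<mu>. \<forall>i\<in>{1..DIM('e)}.
        (\<lambda>n. ereal (1 / real n) * ln_ereal (ereal (tangent_singular_value \<A> g (f ^^ n) x i)))
          \<longlonglongrightarrow> \<kappa> i)"

end

theory Submission
  imports Defs
begin

text \<open>
  Write \<open>p\<^sub>n(x)\<close> for the norm of the map induced by \<open>T\<^sub>x f\<^sup>n\<close> on the exterior power of degree \<open>k\<close>,
  that is, the product of the \<open>k\<close> largest singular values. The integrand in the volume of \<open>f\<^sup>n \<circ> \<sigma>\<close> is
  at most \<open>p\<^sub>n(\<sigma>(x))\<close> times the integrand in the volume of \<open>\<sigma>\<close>, so the dilation is at most
  \<open>\<beta> = lim (1/n) log sup p\<^sub>n\<close>. The continuous functions \<open>p\<^sub>n\<close> are submultiplicative along orbits.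
  A limit of empirical measures along orbits that realize the suprema is an invariant state
  with \<open>\<integral> log p\<^sub>n \<ge> n \<beta>\<close> for all \<open>n\<close>. No invariant state has a larger rate, so such states form a
  closed face of the compact convex set of invariant states. An extreme point of this face is an
  ergodic measure. Kingman's theorem, applied to the exterior powers of all degrees, yields the
  exponents, whose first \<open>k\<close> sum to the growth rate of \<open>p\<^sub>n\<close>.
\<close>

section \<open>Minors and the Cauchy-Binet formula\<close>

text \<open>Where the differential of \<open>f\<close> is singular, \<open>p\<^sub>n\<close> may
  vanish, so log \<open>p\<^sub>n\<close> is neither continuous nor bounded below and cannot be
  passed to weak limits. Integral bounds are therefore stated for the truncations
  \<open>ln (max (p n x) (exp T))\<close> at all levels \<open>T\<close>: these are continuous, the
  bounds are closed conditions on a state, and \<open>kingman\<close> accepts them in this form. The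
  supremum of \<open>p\<^sub>n\<close> grows at a real rate \<beta> or at rate -\<infinity>; in the
  latter case the dilation is -\<infinity> as well and any ergodic measure will do. A point with
  \<open>p\<^sub>N \<ge> exp (N \<beta>)\<close> carries information about the single time N.
  Cutting its orbit into blocks of length m in all m phases transfers the bound to averages of log
  \<open>p\<^sub>m\<close> along the orbit, which survive in the limit. Compactness is Tychonoff's
  theorem: states are points of a product of real lines indexed by functions, and the Riesz theorem
  turns an extreme state back into a measure. The face property makes an extreme point of the
  maximizing set extreme among all invariant states.\<close>

definition gdet :: "'i set \<Rightarrow> ('i \<Rightarrow> 'i \<Rightarrow> real) \<Rightarrow> real" where
  "gdet K A = (\<Sum>p | p permutes K. of_int (sign p) * (\<Prod>i\<in>K. A i (p i)))"

text \<open>Determinants are indexed by sets because the same Gram matrices occur over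
  \<open>{..<k}\<close>, where the degree varies, and over the type \<open>'k\<close> that encodes
  the degree in the dilation.\<close>

lemma det_eq_gdet: "det A = gdet UNIV (\<lambda>i j. A $ i $ j)"
  by (simp add: det_def gdet_def)

lemma gdet_cong:
  assumes "\<And>i j. i \<in> K \<Longrightarrow> j \<in> K \<Longrightarrow> A i j = B i j"
  shows "gdet K A = gdet K B"
  unfolding gdet_def
  by (intro sum.cong refl arg_cong2[where f = "(*)"] prod.cong) (use assms permutes_in_image in fastforce)+

lemma gdet_transpose:
  assumes "finite K"
  shows "gdet K (\<lambda>i j. A j i) = gdet K A"
proof -
  have "gdet K (\<lambda>i j. A j i) = (\<Sum>p | p permutes K. of_int (sign (inv p)) * (\<Prod>i\<in>K. A (inv p i) i))"
    unfolding gdet_def by (rule sum_permutations_inverse)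
  also have "\<dots> = gdet K A"
    unfolding gdet_def
  proof (intro sum.cong refl)
    fix p assume "p \<in> {p. p permutes K}"
    then have p: "p permutes K" by simp
    have "(\<Prod>i\<in>K. A (inv p i) i) = (\<Prod>i\<in>K. ((\<lambda>i. A (inv p i) i) \<circ> p) i)"
      using prod.permute[OF p, of "\<lambda>i. A (inv p i) i"] by (simp add: o_def)
    also have "\<dots> = (\<Prod>i\<in>K. A i (p i))"
      using permutes_inverses[OF p] by simp
    finally show "of_int (sign (inv p)) * (\<Prod>i\<in>K. A (inv p i) i) = of_int (sign p) * (\<Prod>i\<in>K. A i (p i))"
      using sign_inverse[OF permutes_imp_permutation[OF assms p]] by simp
  qed
  finally show ?thesis .
qed

lemma gdet_permute_rows:
  assumes K: "finite K" and q: "q permutes K"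
  shows "gdet K (\<lambda>i j. A (q i) j) = of_int (sign q) * gdet K A"
proof -
  have "gdet K (\<lambda>i j. A (q i) j) = (\<Sum>p | p permutes K. of_int (sign (p \<circ> q)) * (\<Prod>i\<in>K. A (q i) ((p \<circ> q) i)))"
    unfolding gdet_def by (rule sum_permutations_compose_right[OF q])
  also have "\<dots> = (\<Sum>p | p permutes K. of_int (sign q) * (of_int (sign p) * (\<Prod>i\<in>K. A i (p i))))"
  proof (intro sum.cong refl)
    fix p assume "p \<in> {p. p permutes K}"
    then have p: "p permutes K" by simp
    have "(\<Prod>i\<in>K. A (q i) ((p \<circ> q) i)) = (\<Prod>i\<in>K. A i (p i))"
      using prod.permute[OF q, of "\<lambda>i. A i (p i)"] by (simp add: o_def)
    moreover have "sign (p \<circ> q) = sign p * sign q"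
      by (intro sign_compose permutes_imp_permutation[OF K] p q)
    ultimately show "of_int (sign (p \<circ> q)) * (\<Prod>i\<in>K. A (q i) ((p \<circ> q) i)) =
        of_int (sign q) * (of_int (sign p) * (\<Prod>i\<in>K. A i (p i)))" by simp
  qed
  finally show ?thesis by (simp add: gdet_def sum_distrib_left)
qed

lemma gdet_permute_columns:
  assumes "finite K" "q permutes K"
  shows "gdet K (\<lambda>i j. A i (q j)) = of_int (sign q) * gdet K A"
  using gdet_permute_rows[OF assms, of "\<lambda>i j. A j i"] gdet_transpose[OF assms(1), of A]
    gdet_transpose[OF assms(1), of "\<lambda>i j. A i (q j)"] by simp

lemma gdet_scale_rows: "finite K \<Longrightarrow> gdet K (\<lambda>i j. c i * A i j) = (\<Prod>i\<in>K. c i) * gdet K A"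
  by (simp add: gdet_def prod.distrib sum_distrib_left mult_ac)

lemma gdet_scale_columns: "finite K \<Longrightarrow> gdet K (\<lambda>i j. c j * A i j) = (\<Prod>i\<in>K. c i) * gdet K A"
  using gdet_scale_rows[of K c "\<lambda>i j. A j i"] gdet_transpose[of K "\<lambda>i j. c j * A i j"]
    gdet_transpose[of K A] by simp

text \<open>Swapping the two columns fixes the matrix on \<open>K\<close> but reverses the
  sign.\<close>

lemma gdet_equal_columns:
  assumes K: "finite K" and ab: "a \<in> K" "b \<in> K" "a \<noteq> b" and eq: "\<And>i. i \<in> K \<Longrightarrow> A i a = A i b"
  shows "gdet K A = 0"
proof -
  have t: "Transposition.transpose a b permutes K" by (rule permutes_swap_id[OF ab(1,2)])
  have "gdet K (\<lambda>i j. A i (Transposition.transpose a b j)) = gdet K A"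
    by (rule gdet_cong) (use eq in \<open>auto simp: Transposition.transpose_def\<close>)
  moreover have "gdet K (\<lambda>i j. A i (Transposition.transpose a b j)) = - gdet K A"
    using gdet_permute_columns[OF K t, of A] ab by (simp add: sign_swap_id)
  ultimately show ?thesis by simp
qed

text \<open>Summing over all maps \<open>\<phi>\<close> instead of increasing ones counts every minor \<open>k!\<close> times,
  but avoids choosing an order on the index set.\<close>

lemma cauchy_binet:
  assumes K: "finite K" and I: "finite I"
  shows "gdet K (\<lambda>i j. \<Sum>m\<in>I. a i m * b m j) =
    (\<Sum>\<phi>\<in>PiE K (\<lambda>_. I). gdet K (\<lambda>i j. a i (\<phi> j)) * gdet K (\<lambda>i j. b (\<phi> i) j)) / fact (card K)"
proof -
  let ?P = "PiE K (\<lambda>_. I)"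
  define T where "T \<phi> = (\<Prod>i\<in>K. a i (\<phi> i)) * gdet K (\<lambda>i j. b (\<phi> i) j)" for \<phi>
  have "gdet K (\<lambda>i j. \<Sum>m\<in>I. a i m * b m j) =
      (\<Sum>p | p permutes K. of_int (sign p) * (\<Sum>\<phi>\<in>?P. \<Prod>i\<in>K. a i (\<phi> i) * b (\<phi> i) (p i)))"
    unfolding gdet_def by (subst prod_sum_PiE) (use K I in auto)
  also have "\<dots> = (\<Sum>\<phi>\<in>?P. T \<phi>)"
    unfolding T_def gdet_def sum_distrib_left
    by (subst sum.swap) (simp add: prod.distrib mult_ac)
  finally have 1: "gdet K (\<lambda>i j. \<Sum>m\<in>I. a i m * b m j) = (\<Sum>\<phi>\<in>?P. T \<phi>)" .
  \<comment> \<open>Precomposition with \<open>q\<close> permutes the maps \<phi>, so the sum may be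
    averaged over all \<open>q\<close>. The average turns the product in \<open>T\<close> into the
    missing minor of \<open>a\<close>.\<close>
  have 2: "(\<Sum>\<phi>\<in>?P. T \<phi>) = (\<Sum>\<phi>\<in>?P. T (\<phi> \<circ> q))" if q: "q permutes K" for q
  proof (rule sum.reindex_bij_witness[of _ "\<lambda>\<phi>. \<phi> \<circ> q" "\<lambda>\<phi>. \<phi> \<circ> inv q"])
    have in_P: "\<phi> \<circ> r \<in> ?P" if "\<phi> \<in> ?P" and r: "r permutes K" for \<phi> r
      using that permutes_in_image[OF r] by (auto simp: PiE_def extensional_def Pi_def)
    show "\<And>\<phi>. \<phi> \<in> ?P \<Longrightarrow> \<phi> \<circ> inv q \<in> ?P" using in_P permutes_inv[OF q] by blast
    show "\<And>\<phi>. \<phi> \<in> ?P \<Longrightarrow> \<phi> \<circ> q \<in> ?P" using in_P q by blast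
  qed (use permutes_inv_o[OF q] in \<open>auto simp: comp_assoc\<close>)
  have "real (fact (card K)) * (\<Sum>\<phi>\<in>?P. T \<phi>) = (\<Sum>q | q permutes K. \<Sum>\<phi>\<in>?P. T (\<phi> \<circ> q))"
    using card_permutations[OF refl K] by (simp add: 2[symmetric])
  also have "\<dots> = (\<Sum>\<phi>\<in>?P. \<Sum>q | q permutes K. T (\<phi> \<circ> q))" by (rule sum.swap)
  also have "\<dots> = (\<Sum>\<phi>\<in>?P. gdet K (\<lambda>i j. a i (\<phi> j)) * gdet K (\<lambda>i j. b (\<phi> i) j))"
  proof (intro sum.cong refl)
    fix \<phi>
    have "T (\<phi> \<circ> q) = of_int (sign q) * (\<Prod>i\<in>K. a i (\<phi> (q i))) * gdet K (\<lambda>i j. b (\<phi> i) j)"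
      if "q permutes K" for q
      using gdet_permute_rows[OF K that, of "\<lambda>i j. b (\<phi> i) j"] by (simp add: T_def)
    then show "(\<Sum>q | q permutes K. T (\<phi> \<circ> q)) = gdet K (\<lambda>i j. a i (\<phi> j)) * gdet K (\<lambda>i j. b (\<phi> i) j)"
      by (simp add: gdet_def[of K "\<lambda>i j. a i (\<phi> j)"] sum_distrib_right)
  qed
  finally show ?thesis unfolding 1 by (simp add: field_simps)
qed

text \<open>Induction that removes the maximum: among \<open>k + 1\<close> natural numbers the
  largest is at least \<open>k\<close>, so its factor is at most \<open>l k\<close>.\<close>

lemma prod_le_prod_initial:
  fixes l :: "nat \<Rightarrow> real"
  assumes "finite S" "\<And>m. m \<in> S \<Longrightarrow> m < d" and "\<And>i j. i \<le> j \<Longrightarrow> j < d \<Longrightarrow> l j \<le> l i"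
    and "\<And>i. i < d \<Longrightarrow> 0 \<le> l i"
  shows "(\<Prod>m\<in>S. l m) \<le> (\<Prod>i<card S. l i)"
  using assms(1,2)
proof (induction "card S" arbitrary: S)
  case 0
  then show ?case by simp
next
  case (Suc k)
  have ne: "S \<noteq> {}" using Suc(2) by auto
  let ?m = "Max S"
  have m: "?m \<in> S" using Suc.prems ne by simp
  have "S \<subseteq> {..?m}" using Suc.prems(1) Max_ge by auto
  then have "Suc k \<le> Suc ?m" using card_mono[of "{..?m}" S] Suc(2) by simp
  then have km: "k \<le> ?m" by simp
  have md: "?m < d" using m Suc.prems by simp
  have c: "card (S - {?m}) = k" using Suc(2) m Suc.prems(1) by simp
  have IH: "(\<Prod>m\<in>S - {?m}. l m) \<le> (\<Prod>i<k. l i)"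
    using Suc(1)[of "S - {?m}"] c Suc.prems by simp
  have "(\<Prod>m\<in>S. l m) = l ?m * (\<Prod>m\<in>S - {?m}. l m)"
    using prod.remove[OF Suc.prems(1) m] .
  also have "\<dots> \<le> l k * (\<Prod>i<k. l i)"
    by (intro mult_mono IH assms(3)[OF km md] assms(4) prod_nonneg) (use km md Suc.prems in auto)
  also have "\<dots> = (\<Prod>i<card S. l i)" by (simp flip: Suc(2))
  finally show ?case .
qed

section \<open>Simultaneous diagonalization\<close>

definition sym_form :: "('v::real_vector \<Rightarrow> 'v \<Rightarrow> real) \<Rightarrow> bool" where
  "sym_form B \<longleftrightarrow> bilinear B \<and> (\<forall>u v. B u v = B v u)"

definition pos_def :: "('v::real_vector \<Rightarrow> 'v \<Rightarrow> real) \<Rightarrow> bool" where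
  "pos_def B \<longleftrightarrow> sym_form B \<and> (\<forall>u. u \<noteq> 0 \<longrightarrow> B u u > 0)"

definition pos_semidef :: "('v::real_vector \<Rightarrow> 'v \<Rightarrow> real) \<Rightarrow> bool" where
  "pos_semidef C \<longleftrightarrow> sym_form C \<and> (\<forall>u. C u u \<ge> 0)"

lemma sym_formD:
  assumes "sym_form B"
  shows "B (u + v) w = B u w + B v w" "B w (u + v) = B w u + B w v"
    "B (u - v) w = B u w - B v w" "B w (u - v) = B w u - B w v"
    "B (c *\<^sub>R u) w = c * B u w" "B w (c *\<^sub>R u) = c * B w u"
    "B 0 w = 0" "B w 0 = 0" "B (sum f I) w = (\<Sum>i\<in>I. B (f i) w)" "B w (sum f I) = (\<Sum>i\<in>I. B w (f i))"
    "bilinear B"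
  using assms unfolding sym_form_def
  by (auto simp: bilinear_ladd bilinear_radd bilinear_lsub bilinear_rsub bilinear_lmul bilinear_rmul
      bilinear_lzero bilinear_rzero bilinear_def linear_sum)

lemma sym_form_commute: "sym_form B \<Longrightarrow> B u v = B v u"
  by (simp add: sym_form_def)

lemma pos_def_imp_pos_semidef: "pos_def B \<Longrightarrow> pos_semidef B"
  by (metis less_eq_real_def pos_def_def pos_semidef_def sym_formD(7))

lemma pos_semidef_imp_sym_form: "pos_semidef B \<Longrightarrow> sym_form B"
  by (simp add: pos_semidef_def)

lemma pos_def_imp_sym_form: "pos_def B \<Longrightarrow> sym_form B"
  by (simp add: pos_def_def)

lemma pos_def_inner: "pos_def (inner :: 'v::euclidean_space \<Rightarrow> _)"
  by (auto simp: pos_def_def sym_form_def bilinear_def inner_commute intro!: linearI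
      simp: inner_add_left inner_add_right)

lemma pos_semidef_pullback:
  assumes "pos_semidef B" "linear L"
  shows "pos_semidef (\<lambda>u v. B (L u) (L v))"
proof -
  have "bilinear (\<lambda>u v. B (L u) (L v))"
    using assms(1)
    by (auto simp: bilinear_def pos_semidef_def sym_formD linear_add[OF assms(2)] linear_scale[OF assms(2)]
        intro!: linearI)
  then show ?thesis using assms(1) by (auto simp: pos_semidef_def sym_form_def)
qed

lemma sym_form_quadratic:
  assumes "sym_form C"
  shows "C (u + t *\<^sub>R v) (u + t *\<^sub>R v) = C u u + 2 * t * C u v + t\<^sup>2 * C v v"
  using sym_form_commute[OF assms, of v u]
  by (simp add: sym_formD[OF assms] algebra_simps power2_eq_square)

text \<open>The first-order condition at an interior maximum, applied to a quadratic polynomial in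
  \<open>t\<close> that is largest at \<open>t = 0\<close>.\<close>

lemma linear_coefficient_zero:
  fixes c q :: real
  assumes "\<And>t. 2 * t * c + t\<^sup>2 * q \<le> 0"
  shows "c = 0"
proof (rule ccontr)
  assume "c \<noteq> 0"
  \<comment> \<open>For this \<open>t\<close> the quadratic term is at most \<open>t * c\<close> in
    absolute value, half of the linear term.\<close>
  define t where "t = c / (\<bar>q\<bar> + 1)"
  have "2 * t * c + t\<^sup>2 * q \<ge> 2 * t * c - t\<^sup>2 * (\<bar>q\<bar> + 1)"
  proof -
    have "t\<^sup>2 * (- (\<bar>q\<bar> + 1)) \<le> t\<^sup>2 * q" by (intro mult_left_mono) auto
    then show ?thesis by (simp add: ring_distribs)
  qed
  moreover have "t\<^sup>2 * (\<bar>q\<bar> + 1) = t * c"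
    by (simp add: t_def power2_eq_square)
  moreover have "t * c > 0"
    using \<open>c \<noteq> 0\<close> by (auto simp: t_def zero_less_mult_iff zero_less_divide_iff divide_less_0_iff)
  ultimately show False using assms[of t] by linarith
qed

text \<open>A maximizer of the Rayleigh quotient of \<open>C\<close> by \<open>B\<close> on
  \<open>U\<close> is also \<open>C\<close>-orthogonal to its \<open>B\<close>-orthogonal complement
  in \<open>U\<close>, and the induction continues there. Splitting off maxima yields the
  eigenvalues in decreasing order.\<close>

lemma exists_diagonalization_on_subspace:
  fixes B C :: "'v::euclidean_space \<Rightarrow> 'v \<Rightarrow> real"
  assumes B: "pos_def B" and C: "sym_form C" and "subspace U" "dim U = n"
  shows "\<exists>e l. (\<forall>i<n. e i \<in> U) \<and> (\<forall>i<n. \<forall>j<n. B (e i) (e j) = (if i = j then 1 else 0)) \<and>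
    (\<forall>i<n. \<forall>j<n. C (e i) (e j) = (if i = j then l i else 0)) \<and>
    (\<forall>u\<in>U. u = (\<Sum>i<n. B u (e i) *\<^sub>R e i)) \<and> (\<forall>i j. i \<le> j \<longrightarrow> j < n \<longrightarrow> l j \<le> l i)"
  using assms(3,4)
proof (induction n arbitrary: U)
  case 0
  then have "U \<subseteq> {0}" by simp
  then show ?case by auto
next
  case (Suc n)
  note B' = pos_def_imp_sym_form[OF B]
  have [simp]: "bounded_bilinear B" "bounded_bilinear C"
    using B' C by (auto simp: sym_form_def bilinear_conv_bounded_bilinear)
  define S where "S = U \<inter> sphere 0 1"
  have "compact S"
    unfolding S_def using closed_subspace[OF Suc.prems(1)] by (intro closed_Int_compact) auto
  moreover have "S \<noteq> {}"
  proof -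
    obtain v where v: "v \<in> U" "v \<noteq> 0"
      using Suc.prems by (metis dim_eq_0 insertCI nat.distinct(1) subsetI)
    then have "v /\<^sub>R norm v \<in> S" using Suc.prems(1) by (simp add: S_def subspace_scale)
    then show ?thesis by auto
  qed
  moreover have "continuous_on S (\<lambda>u. C u u / B u u)"
  proof (intro continuous_on_divide)
    show "continuous_on S (\<lambda>u. C u u)" "continuous_on S (\<lambda>u. B u u)"
      by (auto intro!: bounded_bilinear.continuous_on[of C] bounded_bilinear.continuous_on[of B] continuous_intros)
    show "\<forall>u\<in>S. B u u \<noteq> 0"
    proof
      fix u assume "u \<in> S"
      then have "u \<noteq> 0" by (auto simp: S_def)
      then show "B u u \<noteq> 0" using B by (metis less_irrefl pos_def_def)
    qed
  qed
  ultimately obtain w where w: "w \<in> S" "\<And>u. u \<in> S \<Longrightarrow> C u u / B u u \<le> C w w / B w w"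
    using continuous_attains_sup[of S "\<lambda>u. C u u / B u u"] by blast
  define m where "m = C w w / B w w"
  have Bpos: "u \<noteq> 0 \<Longrightarrow> B u u > 0" for u using B by (simp add: pos_def_def)
  have w0: "w \<noteq> 0" "w \<in> U" using w(1) by (auto simp: S_def)
  have le: "C u u \<le> m * B u u" if "u \<in> U" for u
  proof (cases "u = 0")
    case True
    then show ?thesis by (simp add: sym_formD[OF B'] sym_formD[OF C])
  next
    case False
    then have "u /\<^sub>R norm u \<in> S" using Suc.prems(1) that by (simp add: S_def subspace_scale)
    from w(2)[OF this] have "C u u / B u u \<le> m"
      using False by (simp add: sym_formD[OF B'] sym_formD[OF C] m_def)
    then show ?thesis using Bpos[OF False] by (simp add: divide_le_eq)
  qed
  define f where "f = w /\<^sub>R sqrt (B w w)"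
  have f: "f \<in> U" "B f f = 1" "C f f = m"
    using w0 Suc.prems(1) Bpos[OF w0(1)]
    by (auto simp: f_def subspace_scale sym_formD[OF B'] sym_formD[OF C] m_def field_simps)
  \<comment> \<open>On \<open>U\<close> the form \<open>C - m B\<close> is at most zero, and it
    vanishes at \<open>f\<close>; hence its first variation at \<open>f\<close> in the direction
    \<open>u\<close> vanishes.\<close>
  have orth: "C f u = 0" if "u \<in> U" "B f u = 0" for u
  proof (rule linear_coefficient_zero)
    fix t
    have "f + t *\<^sub>R u \<in> U" using Suc.prems(1) f that by (simp add: subspace_add subspace_scale)
    from le[OF this] show "2 * t * C f u + t\<^sup>2 * (C u u - m * B u u) \<le> 0"
      unfolding sym_form_quadratic[OF B'] sym_form_quadratic[OF C] using f that(2)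
      by (simp add: algebra_simps)
  qed
  define U' where "U' = {u \<in> U. B f u = 0}"
  have U': "subspace U'"
    using Suc.prems(1) by (auto simp: U'_def subspace_def sym_formD[OF B'])
  have dec: "u - B u f *\<^sub>R f \<in> U'" if "u \<in> U" for u
    using that f Suc.prems(1) sym_form_commute[OF B', of u f]
    by (auto simp: U'_def sym_formD[OF B'] subspace_diff subspace_scale)
  have sp: "span (insert f U') = U"
  proof
    show "span (insert f U') \<subseteq> U"
      by (rule span_minimal) (use f Suc.prems(1) in \<open>auto simp: U'_def\<close>)
    show "U \<subseteq> span (insert f U')"
    proof
      fix u assume "u \<in> U"
      from dec[OF this] show "u \<in> span (insert f U')"
        unfolding span_insert using span_base by blast
    qed
  qed
  have "f \<notin> span U'"
    using U' f by (auto simp: U'_def span_eq_iff[THEN iffD2])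
  then have "dim U' = n"
    using Suc.prems(2) dim_insert[of f U'] dim_span[of "insert f U'"] by (simp add: sp)
  from Suc.IH[OF U' this] obtain e l where e':
    "\<forall>i<n. e i \<in> U'" "\<forall>i<n. \<forall>j<n. B (e i) (e j) = (if i = j then 1 else 0)"
    "\<forall>i<n. \<forall>j<n. C (e i) (e j) = (if i = j then l i else 0)"
    "\<forall>u\<in>U'. u = (\<Sum>i<n. B u (e i) *\<^sub>R e i)" "\<forall>i j. i \<le> j \<longrightarrow> j < n \<longrightarrow> l j \<le> l i"
    by (elim exE conjE) (rule that)
  note e = e'[rule_format]
  have fe: "B f (e i) = 0" "B (e i) f = 0" "C f (e i) = 0" "C (e i) f = 0" if "i < n" for i
    using e(1)[OF that] orth sym_form_commute[OF B', of f] sym_form_commute[OF C, of f]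
    by (auto simp: U'_def)
  have lm: "l i \<le> m" if "i < n" for i
    using le[of "e i"] e(1-3)[OF that] that by (auto simp: U'_def)
  let ?e = "case_nat f e" and ?l = "case_nat m l"
  have rep: "u = (\<Sum>i<Suc n. B u (?e i) *\<^sub>R ?e i)" if "u \<in> U" for u
  proof -
    have "u - B u f *\<^sub>R f = (\<Sum>i<n. B (u - B u f *\<^sub>R f) (e i) *\<^sub>R e i)"
      by (rule e(4)[OF dec[OF that]])
    also have "\<dots> = (\<Sum>i<n. B u (e i) *\<^sub>R e i)"
      by (intro sum.cong refl) (simp add: fe sym_formD[OF B'])
    finally have "u = B u f *\<^sub>R f + (\<Sum>i<n. B u (e i) *\<^sub>R e i)" by (simp only: diff_eq_eq add.commute)
    then show ?thesis by (simp only: sum.lessThan_Suc_shift nat.case)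
  qed
  have "\<forall>i<Suc n. ?e i \<in> U"
    using e(1) f by (auto simp: U'_def split: nat.split)
  moreover have "\<forall>i<Suc n. \<forall>j<Suc n. B (?e i) (?e j) = (if i = j then 1 else 0)"
    using e(2) f fe by (auto split: nat.split)
  moreover have "\<forall>i<Suc n. \<forall>j<Suc n. C (?e i) (?e j) = (if i = j then ?l i else 0)"
    using e(3) f fe by (auto split: nat.split)
  moreover have "\<forall>i j. i \<le> j \<longrightarrow> j < Suc n \<longrightarrow> ?l j \<le> ?l i"
    using e(5) lm by (auto split: nat.split)
  ultimately show ?case
    by (intro exI[of _ ?e] exI[of _ ?l] conjI ballI rep)
qed

definition diagonalizes ::
    "('v::euclidean_space \<Rightarrow> 'v \<Rightarrow> real) \<Rightarrow> ('v \<Rightarrow> 'v \<Rightarrow> real) \<Rightarrow> (nat \<Rightarrow> 'v) \<Rightarrow> (nat \<Rightarrow> real) \<Rightarrow> bool" where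
  "diagonalizes B C e l \<longleftrightarrow>
    (\<forall>i<DIM('v). \<forall>j<DIM('v). B (e i) (e j) = (if i = j then 1 else 0)) \<and>
    (\<forall>i<DIM('v). \<forall>j<DIM('v). C (e i) (e j) = (if i = j then l i else 0)) \<and>
    (\<forall>u. u = (\<Sum>i<DIM('v). B u (e i) *\<^sub>R e i)) \<and>
    (\<forall>i j. i \<le> j \<longrightarrow> j < DIM('v) \<longrightarrow> l j \<le> l i)"

lemma exists_diagonalization:
  fixes B C :: "'v::euclidean_space \<Rightarrow> 'v \<Rightarrow> real"
  assumes "pos_def B" "sym_form C"
  shows "\<exists>e l. diagonalizes B C e l"
  using exists_diagonalization_on_subspace[OF assms subspace_UNIV dim_UNIV]
  unfolding diagonalizes_def by (elim exE conjE, intro exI conjI) auto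

lemma diagonalizesD:
  fixes B C :: "'v::euclidean_space \<Rightarrow> 'v \<Rightarrow> real"
  assumes "diagonalizes B C e l"
  shows "i < DIM('v) \<Longrightarrow> j < DIM('v) \<Longrightarrow> B (e i) (e j) = (if i = j then 1 else 0)"
    "i < DIM('v) \<Longrightarrow> j < DIM('v) \<Longrightarrow> C (e i) (e j) = (if i = j then l i else 0)"
    "u = (\<Sum>i<DIM('v). B u (e i) *\<^sub>R e i)"
    "i \<le> j \<Longrightarrow> j < DIM('v) \<Longrightarrow> l j \<le> l i"
  using assms unfolding diagonalizes_def by blast+

lemma diagonalizes_form:
  fixes B C :: "'v::euclidean_space \<Rightarrow> 'v \<Rightarrow> real"
  assumes "diagonalizes B C e l" "sym_form C"
  shows "C u v = (\<Sum>i<DIM('v). l i * B u (e i) * B v (e i))"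
proof -
  have "C u v = C (\<Sum>i<DIM('v). B u (e i) *\<^sub>R e i) (\<Sum>j<DIM('v). B v (e j) *\<^sub>R e j)"
    using diagonalizesD(3)[OF assms(1)] by metis
  also have "\<dots> = (\<Sum>i<DIM('v). \<Sum>j<DIM('v). B u (e i) * B v (e j) * C (e i) (e j))"
    by (simp add: sym_formD[OF assms(2)] sum_distrib_left mult_ac) (rule sum.swap)
  also have "\<dots> = (\<Sum>i<DIM('v). \<Sum>j<DIM('v). if i = j then l i * B u (e i) * B v (e i) else 0)"
    by (intro sum.cong refl) (auto simp: diagonalizesD(2)[OF assms(1)])
  finally show ?thesis by simp
qed

lemma diagonalizes_form_self:
  fixes B C :: "'v::euclidean_space \<Rightarrow> 'v \<Rightarrow> real"
  assumes "diagonalizes B C e l" "sym_form B"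
  shows "B u v = (\<Sum>i<DIM('v). 1 * B u (e i) * B v (e i))"
proof -
  have "diagonalizes B B e (\<lambda>_. 1)"
    using assms(1) by (simp add: diagonalizes_def)
  from diagonalizes_form[OF this assms(2)] show ?thesis .
qed

lemma diagonalizes_nonneg:
  fixes B C :: "'v::euclidean_space \<Rightarrow> 'v \<Rightarrow> real"
  assumes "diagonalizes B C e l" "pos_semidef C" "i < DIM('v)"
  shows "0 \<le> l i"
  using diagonalizesD(2)[OF assms(1,3,3)] assms(2) by (metis pos_semidef_def)

section \<open>Volume ratios, exterior powers and singular values\<close>

lemma gdet_diagonal:
  assumes K: "finite K"
  shows "gdet K (\<lambda>i j. if i = j then l i else 0) = (\<Prod>i\<in>K. l i)"
proof -
  have "gdet K (\<lambda>i j. if i = j then l i else 0) =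
      (\<Sum>p | p permutes K. if p = id then (\<Prod>i\<in>K. l i) else 0)"
    unfolding gdet_def
  proof (intro sum.cong refl)
    fix p assume "p \<in> {p. p permutes K}"
    then have p: "p permutes K" by simp
    show "of_int (sign p) * (\<Prod>i\<in>K. if i = p i then l i else 0) = (if p = id then (\<Prod>i\<in>K. l i) else 0)"
    proof (cases "p = id")
      case False
      then obtain i where "p i \<noteq> i" by (auto simp: fun_eq_iff)
      moreover have "i \<in> K" using p \<open>p i \<noteq> i\<close> by (auto simp: permutes_def)
      ultimately have "(\<Prod>i\<in>K. if i = p i then l i else 0) = 0"
        using K by (intro prod_zero) force+
      then show ?thesis using False by simp
    qed (simp add: sign_id)
  qed
  also have "\<dots> = (\<Prod>i\<in>K. l i)"
    using K by (simp add: sum.delta finite_permutations permutes_id)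
  finally show ?thesis .
qed

text \<open>In coordinates with respect to \<open>e\<close> the form \<open>C\<close> is diagonal,
  and Cauchy-Binet with the weights attached to one factor does the rest. The minors are the
  Pluecker coordinates of the two tuples.\<close>

lemma gram_expansion:
  fixes B C :: "'v::euclidean_space \<Rightarrow> 'v \<Rightarrow> real"
  assumes d: "diagonalizes B C e l" and C: "sym_form C" and K: "finite K"
  shows "gdet K (\<lambda>i j. C (u i) (v j)) =
    (\<Sum>\<phi>\<in>PiE K (\<lambda>_. {..<DIM('v)}). (\<Prod>i\<in>K. l (\<phi> i)) *
      (gdet K (\<lambda>i j. B (u i) (e (\<phi> j))) * gdet K (\<lambda>i j. B (v i) (e (\<phi> j))))) / fact (card K)"
proof -
  have "gdet K (\<lambda>i j. C (u i) (v j)) =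
      gdet K (\<lambda>i j. \<Sum>m<DIM('v). (l m * B (u i) (e m)) * B (v j) (e m))"
    by (subst diagonalizes_form[OF d C]) (simp add: mult_ac)
  also have "\<dots> = (\<Sum>\<phi>\<in>PiE K (\<lambda>_. {..<DIM('v)}). gdet K (\<lambda>i j. l (\<phi> j) * B (u i) (e (\<phi> j))) *
      gdet K (\<lambda>i j. B (v j) (e (\<phi> i)))) / fact (card K)"
    by (rule cauchy_binet[OF K, where b = "\<lambda>m j. B (v j) (e m)"]) simp
  finally show ?thesis
    using K by (simp add: gdet_scale_columns gdet_transpose[OF K, of "\<lambda>i j. B (v i) (e (_ j))"] mult_ac)
qed

text \<open>Only injective \<phi> contribute, and for these the weight is a product of
  \<open>l\<close> over \<open>card K\<close> distinct indices.\<close>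

lemma weighted_minor_sum_le:
  fixes l :: "nat \<Rightarrow> real"
  assumes K: "finite K" and l: "\<And>i j. i \<le> j \<Longrightarrow> j < d \<Longrightarrow> l j \<le> l i" "\<And>i. i < d \<Longrightarrow> 0 \<le> l i"
    and c: "\<And>\<phi>. \<not> inj_on \<phi> K \<Longrightarrow> c \<phi> = 0"
  shows "(\<Sum>\<phi>\<in>PiE K (\<lambda>_. {..<d}). (\<Prod>i\<in>K. l (\<phi> i)) * (c \<phi>)\<^sup>2) \<le>
    (\<Prod>i<card K. l i) * (\<Sum>\<phi>\<in>PiE K (\<lambda>_. {..<d}). (c \<phi>)\<^sup>2)"
  unfolding sum_distrib_left
proof (rule sum_mono)
  fix \<phi> assume \<phi>: "\<phi> \<in> PiE K (\<lambda>_. {..<d})"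
  show "(\<Prod>i\<in>K. l (\<phi> i)) * (c \<phi>)\<^sup>2 \<le> (\<Prod>i<card K. l i) * (c \<phi>)\<^sup>2"
  proof (cases "inj_on \<phi> K")
    case True
    have "(\<Prod>i\<in>K. l (\<phi> i)) = (\<Prod>m\<in>\<phi> ` K. l m)"
      by (simp add: prod.reindex[OF True])
    also have "\<dots> \<le> (\<Prod>i<card (\<phi> ` K). l i)"
      by (rule prod_le_prod_initial[of _ d]) (use K \<phi> l in auto)
    finally show ?thesis by (simp add: card_image[OF True] mult_right_mono)
  qed (simp add: c)
qed

lemma gdet_minor_not_inj:
  assumes "finite K" "\<not> inj_on \<phi> K"
  shows "gdet K (\<lambda>i j. B (u i) (e (\<phi> j))) = 0"
proof -
  obtain a b where "a \<in> K" "b \<in> K" "a \<noteq> b" "\<phi> a = \<phi> b"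
    using assms(2) by (auto simp: inj_on_def)
  then show ?thesis by (intro gdet_equal_columns[OF assms(1), of a b]) auto
qed

section \<open>Extremal volume ratios of two forms\<close>

definition eigs :: "('v::euclidean_space \<Rightarrow> 'v \<Rightarrow> real) \<Rightarrow> ('v \<Rightarrow> 'v \<Rightarrow> real) \<Rightarrow> nat \<Rightarrow> real" where
  "eigs B C = (SOME l. \<exists>e. diagonalizes B C e l)"

text \<open>For \<open>k \<le> DIM('v)\<close> this is the largest ratio of
  \<open>k\<close>-dimensional Gram determinants of \<open>C\<close> and \<open>B\<close>
  (\<open>gram_le\<close>, \<open>evprod_attained\<close>). If \<open>C\<close> is an inner product
  pulled back along a linear map, it is the squared norm of the map induced on the exterior
  power.\<close>

definition evprod :: "nat \<Rightarrow> ('v::euclidean_space \<Rightarrow> 'v \<Rightarrow> real) \<Rightarrow> ('v \<Rightarrow> 'v \<Rightarrow> real) \<Rightarrow> real" where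
  "evprod k B C = (\<Prod>i<k. eigs B C i)"

lemma eigs_diagonalizes:
  assumes "pos_def B" "pos_semidef C"
  obtains e where "diagonalizes B C e (eigs B C)"
proof -
  have "\<exists>l. \<exists>e. diagonalizes B C e l"
    using exists_diagonalization[OF assms(1) pos_semidef_imp_sym_form[OF assms(2)]] by blast
  from someI_ex[OF this] that show thesis unfolding eigs_def by blast
qed

lemma eigs_nonneg:
  fixes B C :: "'v::euclidean_space \<Rightarrow> 'v \<Rightarrow> real"
  assumes "pos_def B" "pos_semidef C" "i < DIM('v)"
  shows "0 \<le> eigs B C i"
  by (rule eigs_diagonalizes[OF assms(1,2)]) (rule diagonalizes_nonneg[OF _ assms(2,3)])

lemma eigs_antimono:
  fixes B C :: "'v::euclidean_space \<Rightarrow> 'v \<Rightarrow> real"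
  assumes "pos_def B" "pos_semidef C" "i \<le> j" "j < DIM('v)"
  shows "eigs B C j \<le> eigs B C i"
  by (rule eigs_diagonalizes[OF assms(1,2)]) (rule diagonalizesD(4)[OF _ assms(3,4)])

lemma evprod_nonneg:
  fixes B C :: "'v::euclidean_space \<Rightarrow> 'v \<Rightarrow> real"
  assumes "pos_def B" "pos_semidef C" "k \<le> DIM('v)"
  shows "0 \<le> evprod k B C"
  unfolding evprod_def using assms by (auto intro!: prod_nonneg eigs_nonneg)

lemma gram_nonneg:
  fixes C :: "'v::euclidean_space \<Rightarrow> 'v \<Rightarrow> real"
  assumes "pos_semidef C" "finite K"
  shows "0 \<le> gdet K (\<lambda>i j. C (u i) (u j))"
proof -
  obtain e where e: "diagonalizes inner C e (eigs inner C)"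
    using eigs_diagonalizes[OF pos_def_inner assms(1)] .
  show ?thesis
    unfolding gram_expansion[OF e pos_semidef_imp_sym_form[OF assms(1)] assms(2), of u u]
    using assms by (intro divide_nonneg_pos sum_nonneg mult_nonneg_nonneg[OF prod_nonneg zero_le_square])
      (auto intro!: eigs_nonneg pos_def_inner)
qed

text \<open>Both Gram determinants are sums of the same squared minors, since \<open>e\<close>
  diagonalizes \<open>B\<close> as well; the weights are products of \<open>l\<close> for
  \<open>C\<close> and \<open>1\<close> for \<open>B\<close>.\<close>

lemma gram_le_diagonalizes:
  fixes B C :: "'v::euclidean_space \<Rightarrow> 'v \<Rightarrow> real"
  assumes d: "diagonalizes B C e l" and B: "pos_def B" and C: "pos_semidef C" and K: "finite K"
  shows "gdet K (\<lambda>i j. C (u i) (u j)) \<le> (\<Prod>i<card K. l i) * gdet K (\<lambda>i j. B (u i) (u j))"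
proof -
  have BB: "diagonalizes B B e (\<lambda>_. 1)" using d by (simp add: diagonalizes_def)
  have "(\<Sum>\<phi>\<in>PiE K (\<lambda>_. {..<DIM('v)}). (\<Prod>i\<in>K. l (\<phi> i)) * (gdet K (\<lambda>i j. B (u i) (e (\<phi> j))))\<^sup>2) \<le>
      (\<Prod>i<card K. l i) * (\<Sum>\<phi>\<in>PiE K (\<lambda>_. {..<DIM('v)}). (gdet K (\<lambda>i j. B (u i) (e (\<phi> j))))\<^sup>2)"
    by (rule weighted_minor_sum_le[OF K])
      (use diagonalizesD(4)[OF d] diagonalizes_nonneg[OF d C] gdet_minor_not_inj[OF K] in auto)
  then show ?thesis
    unfolding gram_expansion[OF d pos_semidef_imp_sym_form[OF C] K, of u u]
      gram_expansion[OF BB pos_def_imp_sym_form[OF B] K, of u u]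
    by (simp add: power2_eq_square divide_right_mono)
qed

lemma gram_le:
  fixes B C :: "'v::euclidean_space \<Rightarrow> 'v \<Rightarrow> real"
  assumes "pos_def B" "pos_semidef C" "finite K"
  shows "gdet K (\<lambda>i j. C (u i) (u j)) \<le> evprod (card K) B C * gdet K (\<lambda>i j. B (u i) (u j))"
  unfolding evprod_def
  by (rule eigs_diagonalizes[OF assms(1,2)], rule gram_le_diagonalizes[OF _ assms])

lemma gram_diagonal:
  fixes B C :: "'v::euclidean_space \<Rightarrow> 'v \<Rightarrow> real"
  assumes d: "diagonalizes B C e l" and K: "finite K" and f: "inj_on f K" "f ` K \<subseteq> {..<DIM('v)}"
  shows "gdet K (\<lambda>i j. B (e (f i)) (e (f j))) = 1"
    "gdet K (\<lambda>i j. C (e (f i)) (e (f j))) = (\<Prod>i\<in>K. l (f i))"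
proof -
  have bd: "f i < DIM('v)" if "i \<in> K" for i using f(2) that by auto
  have "gdet K (\<lambda>i j. B (e (f i)) (e (f j))) = gdet K (\<lambda>i j. if i = j then 1 else 0)"
    by (rule gdet_cong) (simp add: diagonalizesD(1)[OF d] bd inj_on_eq_iff[OF f(1)])
  then show "gdet K (\<lambda>i j. B (e (f i)) (e (f j))) = 1" using gdet_diagonal[OF K, of "\<lambda>_. 1"] by simp
  have "gdet K (\<lambda>i j. C (e (f i)) (e (f j))) = gdet K (\<lambda>i j. if i = j then l (f i) else 0)"
    by (rule gdet_cong) (simp add: diagonalizesD(2)[OF d] bd inj_on_eq_iff[OF f(1)])
  then show "gdet K (\<lambda>i j. C (e (f i)) (e (f j))) = (\<Prod>i\<in>K. l (f i))" using gdet_diagonal[OF K, of "\<lambda>i. l (f i)"] by simp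
qed

lemma evprod_attained:
  fixes B C :: "'v::euclidean_space \<Rightarrow> 'v \<Rightarrow> real"
  assumes "pos_def B" "pos_semidef C" "k \<le> DIM('v)"
  obtains u :: "nat \<Rightarrow> 'v" where "gdet {..<k} (\<lambda>i j. B (u i) (u j)) = 1"
    "gdet {..<k} (\<lambda>i j. C (u i) (u j)) = evprod k B C"
proof -
  obtain e where e: "diagonalizes B C e (eigs B C)"
    using eigs_diagonalizes[OF assms(1,2)] .
  show thesis
    using that[of e] gram_diagonal[OF e, of "{..<k}" id] assms(3) unfolding evprod_def by auto
qed

text \<open>A tuple that attains the left side is measured in two stages with
  \<open>gram_le\<close>: \<open>C\<close> against \<open>BW\<close> on its image under
  \<open>A\<close>, then the pullback of \<open>BW\<close> against \<open>BV\<close> on the tuple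
  itself.\<close>

lemma evprod_compose_le:
  fixes BV :: "'v::euclidean_space \<Rightarrow> 'v \<Rightarrow> real" and BW C :: "'w::euclidean_space \<Rightarrow> 'w \<Rightarrow> real"
  assumes V: "pos_def BV" and W: "pos_def BW" and C: "pos_semidef C" and A: "linear A"
    and k: "k \<le> DIM('v)" "k \<le> DIM('w)"
  shows "evprod k BV (\<lambda>u v. C (A u) (A v)) \<le> evprod k BW C * evprod k BV (\<lambda>u v. BW (A u) (A v))"
proof -
  obtain u where u: "gdet {..<k} (\<lambda>i j. BV (u i) (u j)) = 1"
    "gdet {..<k} (\<lambda>i j. C (A (u i)) (A (u j))) = evprod k BV (\<lambda>u v. C (A u) (A v))"
    using evprod_attained[OF V pos_semidef_pullback[OF C A] k(1)] by blast
  have "evprod k BV (\<lambda>u v. C (A u) (A v)) \<le> evprod k BW C * gdet {..<k} (\<lambda>i j. BW (A (u i)) (A (u j)))"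
    using gram_le[OF W C, of "{..<k}" "\<lambda>i. A (u i)"] u(2) by simp
  also have "\<dots> \<le> evprod k BW C * (evprod k BV (\<lambda>u v. BW (A u) (A v)) * 1)"
    using gram_le[OF V pos_semidef_pullback[OF pos_def_imp_pos_semidef[OF W] A], of "{..<k}" u] u(1)
    by (intro mult_left_mono evprod_nonneg W C k) auto
  finally show ?thesis by simp
qed

text \<open>Both sides are the extremal ratio of Gram determinants. Thus the product does not depend
  on the spectrum picked by \<open>SOME\<close> in \<open>eigs\<close>.\<close>

lemma evprod_eq_prod:
  fixes B C :: "'v::euclidean_space \<Rightarrow> 'v \<Rightarrow> real"
  assumes d: "diagonalizes B C e l" and B: "pos_def B" and C: "pos_semidef C" and k: "k \<le> DIM('v)"
  shows "evprod k B C = (\<Prod>i<k. l i)"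
proof (rule antisym)
  obtain u where u: "gdet {..<k} (\<lambda>i j. B (u i) (u j)) = 1" "gdet {..<k} (\<lambda>i j. C (u i) (u j)) = evprod k B C"
    using evprod_attained[OF B C k] .
  show "evprod k B C \<le> (\<Prod>i<k. l i)"
    using gram_le_diagonalizes[OF d B C, of "{..<k}" u] u by simp
  show "(\<Prod>i<k. l i) \<le> evprod k B C"
    using gram_le[OF B C, of "{..<k}" e] gram_diagonal[OF d, of "{..<k}" id] k by auto
qed

lemma evprod_self: "pos_def (B :: 'v::euclidean_space \<Rightarrow> _) \<Longrightarrow> k \<le> DIM('v) \<Longrightarrow> evprod k B B = 1"
proof -
  assume B: "pos_def B" "k \<le> DIM('v)"
  obtain e l where "diagonalizes B B e l"
    using exists_diagonalization[OF B(1) pos_def_imp_sym_form[OF B(1)]] by blast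
  then have "diagonalizes B B e (\<lambda>_. 1)" by (simp add: diagonalizes_def)
  from evprod_eq_prod[OF this B(1) pos_def_imp_pos_semidef[OF B(1)] B(2)] show ?thesis by simp
qed

text \<open>The bilinear extension of \<open>gram_expansion\<close> to sums of decomposable
  elements: \<open>c \<xi>\<close> lists Pluecker coordinates of \<xi>, and the induced form is
  diagonal in them. The factorial appears because each coordinate is counted once per ordering of
  its index set.\<close>

lemma ext_inner_diagonalizes:
  fixes B C :: "'v::euclidean_space \<Rightarrow> 'v \<Rightarrow> real" and \<xi> \<eta> :: "('v, 'k::finite) multivec"
  assumes d: "diagonalizes B C e l" and C: "sym_form C"
  defines "c \<equiv> \<lambda>\<xi> \<phi>. \<Sum>(a, u)\<leftarrow>\<xi>. a * gdet (UNIV :: 'k set) (\<lambda>i j. B (u $ i) (e (\<phi> j)))"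
  shows "ext_inner C \<xi> \<eta> =
    (\<Sum>\<phi>\<in>PiE UNIV (\<lambda>_. {..<DIM('v)}). (\<Prod>i\<in>UNIV. l (\<phi> i)) * (c \<xi> \<phi> * c \<eta> \<phi>)) / fact CARD('k)"
proof -
  let ?P = "PiE (UNIV :: 'k set) (\<lambda>_. {..<DIM('v)})"
  let ?m = "\<lambda>u \<phi>. gdet (UNIV :: 'k set) (\<lambda>i j. B (u $ i) (e (\<phi> j)))"
  let ?w = "\<lambda>\<phi>::'k \<Rightarrow> nat. (\<Prod>i\<in>UNIV. l (\<phi> i)) / fact CARD('k)"
  have swap: "(\<Sum>x\<leftarrow>xs. \<Sum>\<phi>\<in>?P. F x \<phi>) = (\<Sum>\<phi>\<in>?P. \<Sum>x\<leftarrow>xs. F x \<phi>)" for xs :: "(real \<times> ('v, 'k) vec) list" and F :: "_ \<Rightarrow> _ \<Rightarrow> real"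
    by (induction xs) (auto simp: sum.distrib)
  have "det (\<chi> i j. C (u $ i) (v $ j)) = (\<Sum>\<phi>\<in>?P. ?w \<phi> * (?m u \<phi> * ?m v \<phi>))" for u v :: "'v^'k"
    using gram_expansion[OF d C, of "UNIV :: 'k set" "\<lambda>i. u $ i" "\<lambda>i. v $ i"]
    by (simp add: det_eq_gdet sum_divide_distrib)
  then have "ext_inner C \<xi> \<eta> = (\<Sum>x\<leftarrow>\<xi>. \<Sum>y\<leftarrow>\<eta>. \<Sum>\<phi>\<in>?P. ?w \<phi> * ((fst x * ?m (snd x) \<phi>) * (fst y * ?m (snd y) \<phi>)))"
    unfolding ext_inner_def by (simp add: case_prod_unfold sum_distrib_left mult_ac)
  also have "\<dots> = (\<Sum>\<phi>\<in>?P. \<Sum>x\<leftarrow>\<xi>. \<Sum>y\<leftarrow>\<eta>. ?w \<phi> * ((fst x * ?m (snd x) \<phi>) * (fst y * ?m (snd y) \<phi>)))"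
    by (simp only: swap)
  also have "\<dots> = (\<Sum>\<phi>\<in>?P. ?w \<phi> * (c \<xi> \<phi> * c \<eta> \<phi>))"
    by (simp only: c_def case_prod_unfold sum_list_const_mult sum_list_mult_const)
  finally show ?thesis by (simp add: sum_divide_distrib)
qed

lemma ext_inner_map: "ext_inner B (ext_map L \<xi>) (ext_map L \<eta>) = ext_inner (\<lambda>u v. B (L u) (L v)) \<xi> \<eta>"
  unfolding ext_inner_def ext_map_def by (simp add: case_prod_unfold o_def)

text \<open>A multivector need not be decomposable, so \<open>gram_le\<close> does not apply
  directly; the same comparison of weights is made for its Pluecker coordinates.\<close>

lemma ext_inner_le:
  fixes B C :: "'v::euclidean_space \<Rightarrow> 'v \<Rightarrow> real" and \<xi> :: "('v, 'k::finite) multivec"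
  assumes B: "pos_def B" and C: "pos_semidef C"
  shows "ext_inner C \<xi> \<xi> \<le> evprod CARD('k) B C * ext_inner B \<xi> \<xi>"
proof -
  note C' = pos_semidef_imp_sym_form[OF C]
  obtain e where d: "diagonalizes B C e (eigs B C)" using eigs_diagonalizes[OF B C] .
  have BB: "diagonalizes B B e (\<lambda>_. 1)" using d by (simp add: diagonalizes_def)
  define c where "c \<phi> = (\<Sum>(a, u)\<leftarrow>\<xi>. a * gdet (UNIV :: 'k set) (\<lambda>i j. B (u $ i) (e (\<phi> j))))" for \<phi>
  have c0: "c \<phi> = 0" if "\<not> inj_on \<phi> UNIV" for \<phi>
    unfolding c_def by (simp add: gdet_minor_not_inj[OF _ that] case_prod_unfold)
  have "(\<Sum>\<phi>\<in>PiE UNIV (\<lambda>_. {..<DIM('v)}). (\<Prod>i\<in>UNIV. eigs B C (\<phi> i)) * (c \<phi>)\<^sup>2) \<le>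
      (\<Prod>i<CARD('k). eigs B C i) * (\<Sum>\<phi>\<in>PiE UNIV (\<lambda>_. {..<DIM('v)}). (c \<phi>)\<^sup>2)"
    by (rule weighted_minor_sum_le) (use eigs_antimono[OF B C] eigs_nonneg[OF B C] c0 in auto)
  then show ?thesis
    unfolding ext_inner_diagonalizes[OF d C'] ext_inner_diagonalizes[OF BB pos_def_imp_sym_form[OF B]]
      evprod_def c_def[symmetric]
    by (simp add: power2_eq_square divide_right_mono)
qed

text \<open>The root turns Gram determinants, which are squared volumes, into volumes. This is the
  norm of the induced map on the exterior power, by \<open>ext_opnorm_eq_pvol\<close>.\<close>

definition pvol :: "nat \<Rightarrow> ('v::euclidean_space \<Rightarrow> 'v \<Rightarrow> real) \<Rightarrow> ('w \<Rightarrow> 'w \<Rightarrow> real) \<Rightarrow> ('v \<Rightarrow> 'w) \<Rightarrow> real" where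
  "pvol k BV BW L = sqrt (evprod k BV (\<lambda>u v. BW (L u) (L v)))"

lemma pvol_nonneg:
  assumes "pos_def (BV :: 'v::euclidean_space \<Rightarrow> _)" "pos_def BW" "linear L" "k \<le> DIM('v)"
  shows "0 \<le> pvol k BV BW L"
  unfolding pvol_def using evprod_nonneg[OF assms(1) pos_semidef_pullback[OF pos_def_imp_pos_semidef[OF assms(2)] assms(3)] assms(4)] by simp

lemma ext_norm_map_le:
  fixes BV :: "'v::euclidean_space \<Rightarrow> 'v \<Rightarrow> real" and \<xi> :: "('v, 'k::finite) multivec"
  assumes V: "pos_def BV" and W: "pos_def BW" and L: "linear L"
  shows "ext_norm BW (ext_map L \<xi>) \<le> pvol CARD('k) BV BW L * ext_norm BV \<xi>"
  unfolding ext_norm_def pvol_def ext_inner_map real_sqrt_mult[symmetric]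
  by (intro real_sqrt_le_mono ext_inner_le V pos_semidef_pullback[OF pos_def_imp_pos_semidef[OF W] L])

text \<open>The supremum is attained at a decomposable element, the wedge product of the first
  \<open>k\<close> eigenvectors of the pulled back form.\<close>

lemma ext_opnorm_eq_pvol:
  fixes BV :: "'v::euclidean_space \<Rightarrow> 'v \<Rightarrow> real" and BW :: "'w::euclidean_space \<Rightarrow> 'w \<Rightarrow> real"
  assumes V: "pos_def BV" and W: "pos_def BW" and L: "linear L" and k: "CARD('k::finite) \<le> DIM('v)"
  shows "ext_opnorm TYPE('k) BV BW L = pvol CARD('k) BV BW L"
proof -
  let ?C = "\<lambda>u v. BW (L u) (L v)"
  have C: "pos_semidef ?C" by (rule pos_semidef_pullback[OF pos_def_imp_pos_semidef[OF W] L])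
  obtain e where d: "diagonalizes BV ?C e (eigs BV ?C)"
    using eigs_diagonalizes[OF V C] .
  \<comment> \<open>The degree is given as the cardinality of the type \<open>'k\<close>;
    \<open>f\<close> numbers its elements, so that the eigenvectors can be used as entries.\<close>
  obtain f where f: "bij_betw f (UNIV :: 'k set) {..<CARD('k)}"
    using finite_same_card_bij[of "UNIV :: 'k set" "{..<CARD('k)}"] by auto
  define \<xi> :: "('v, 'k) multivec" where "\<xi> = [(1, \<chi> i. e (f i))]"
  have inj: "inj_on f UNIV" "f ` UNIV \<subseteq> {..<DIM('v)}"
    using f k by (auto simp: bij_betw_def)
  have "ext_norm BV \<xi> = 1"
    using gram_diagonal(1)[OF d _ inj] by (simp add: ext_norm_def ext_inner_def \<xi>_def det_eq_gdet)
  moreover have "(\<Prod>i\<in>UNIV. eigs BV ?C (f i)) = evprod CARD('k) BV ?C"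
    unfolding evprod_def using f by (rule prod.reindex_bij_betw)
  then have "ext_norm BW (ext_map L \<xi>) = pvol CARD('k) BV BW L"
    using gram_diagonal(2)[OF d _ inj]
    by (simp add: ext_norm_def ext_inner_map) (simp add: ext_inner_def \<xi>_def det_eq_gdet pvol_def)
  moreover have "ext_norm BW (ext_map L \<eta>) \<le> pvol CARD('k) BV BW L" if "ext_norm BV \<eta> \<le> 1"
    for \<eta> :: "('v, 'k) multivec"
    using ext_norm_map_le[OF V W L, of \<eta>] mult_left_mono[OF that pvol_nonneg[OF V W L k]] by simp
  ultimately show ?thesis
    unfolding ext_opnorm_def by (intro cSup_eq_maximum) (auto intro!: image_eqI[of _ _ \<xi>])
qed

lemma pvol_compose_le:
  fixes BU :: "'u::euclidean_space \<Rightarrow> 'u \<Rightarrow> real" and BV :: "'v::euclidean_space \<Rightarrow> 'v \<Rightarrow> real"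
    and BW :: "'w::euclidean_space \<Rightarrow> 'w \<Rightarrow> real"
  assumes "pos_def BU" "pos_def BV" "pos_def BW" "linear A" "linear L" "k \<le> DIM('u)" "k \<le> DIM('v)"
  shows "pvol k BU BW (L \<circ> A) \<le> pvol k BV BW L * pvol k BU BV A"
  unfolding pvol_def real_sqrt_mult[symmetric] o_def
  using evprod_compose_le[OF assms(1,2) pos_semidef_pullback[OF pos_def_imp_pos_semidef[OF assms(3)] assms(5)] assms(4,6,7)]
  by (intro real_sqrt_le_mono) simp

section \<open>Adjoints, eigenspaces and singular values\<close>

lemma metric_adjoint_works:
  fixes BV :: "'v::euclidean_space \<Rightarrow> 'v \<Rightarrow> real" and BW :: "'w::euclidean_space \<Rightarrow> 'w \<Rightarrow> real"
  assumes V: "pos_def BV" and W: "pos_def BW" and L: "linear L"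
  shows "BW (L u) w = BV u (metric_adjoint BV BW L w)"
proof -
  note V' = pos_def_imp_sym_form[OF V] and W' = pos_def_imp_sym_form[OF W]
  \<comment> \<open>Diagonalizing \<open>BV\<close> against itself supplies an orthonormal basis, in
    which the Riesz vector of a linear form can be written down.\<close>
  obtain e l where e: "diagonalizes BV BV e l"
    using exists_diagonalization[OF V V'] by blast
  have *: "BW (L u) w = BV u (\<Sum>i<DIM('v). BW (L (e i)) w *\<^sub>R e i)" for u w
  proof -
    have "BW (L u) w = BW (L (\<Sum>i<DIM('v). BV u (e i) *\<^sub>R e i)) w"
      by (rule arg_cong[where f = "\<lambda>u. BW (L u) w"]) (rule diagonalizesD(3)[OF e])
    then show ?thesis
      by (simp add: linear_sum[OF L] linear_scale[OF L] sym_formD[OF W'] sym_formD[OF V'] mult_ac)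
  qed
  have "\<exists>L'. \<forall>u w. BW (L u) w = BV u (L' w)"
    by (intro exI[of _ "\<lambda>w. \<Sum>i<DIM('v). BW (L (e i)) w *\<^sub>R e i"] allI) (rule *)
  from someI_ex[OF this, rule_format] show ?thesis unfolding metric_adjoint_def .
qed

lemma dim_coordinate_subspace:
  fixes B C :: "'v::euclidean_space \<Rightarrow> 'v \<Rightarrow> real"
  assumes d: "diagonalizes B C e l" and B: "sym_form B" and I: "I \<subseteq> {..<DIM('v)}"
  shows "dim {u. \<forall>i<DIM('v). i \<notin> I \<longrightarrow> B u (e i) = 0} = card I"
proof -
  let ?U = "{u. \<forall>i<DIM('v). i \<notin> I \<longrightarrow> B u (e i) = 0}"
  have fin: "finite I" using I finite_subset by blast
  have orth: "B (e i) (e j) = (if i = j then 1 else 0)" if "i \<in> I" "j \<in> I" for i j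
    using that by (intro diagonalizesD(1)[OF d]) (use I in auto)
  have inj: "inj_on e I"
    using orth by (metis (full_types) inj_onI zero_neq_one)
  have sub: "subspace ?U"
    by (auto simp: subspace_def sym_formD[OF B])
  have sp: "span (e ` I) = ?U"
  proof
    show "span (e ` I) \<subseteq> ?U"
    proof (rule span_minimal[OF _ sub], clarify)
      fix i j assume "i \<in> I" "j < DIM('v)" "j \<notin> I"
      moreover have "i < DIM('v)" using \<open>i \<in> I\<close> I by auto
      ultimately show "B (e i) (e j) = 0" by (auto simp: diagonalizesD(1)[OF d])
    qed
    show "?U \<subseteq> span (e ` I)"
    proof
      fix u assume u: "u \<in> ?U"
      have "u = (\<Sum>i<DIM('v). B u (e i) *\<^sub>R e i)" by (rule diagonalizesD(3)[OF d])
      also have "\<dots> = (\<Sum>i\<in>I. B u (e i) *\<^sub>R e i)"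
        by (rule sum.mono_neutral_right) (use I u in auto)
      also have "\<dots> \<in> span (e ` I)"
        by (intro span_sum span_scale span_base) auto
      finally show "u \<in> span (e ` I)" .
    qed
  qed
  have ind: "independent (e ` I)"
  proof (rule independent_if_scalars_zero)
    show "finite (e ` I)" using fin by simp
    fix f x assume 0: "(\<Sum>x\<in>e ` I. f x *\<^sub>R x) = 0" and "x \<in> e ` I"
    then obtain j where j: "j \<in> I" "x = e j" by auto
    have "0 = B (\<Sum>i\<in>I. f (e i) *\<^sub>R e i) (e j)"
      using 0 by (simp add: sum.reindex[OF inj] sym_formD[OF B])
    also have "\<dots> = (\<Sum>i\<in>I. if i = j then f (e j) else 0)"
      unfolding sym_formD[OF B] by (intro sum.cong refl) (use orth j in auto)
    finally show "f x = 0" using j fin by simp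
  qed
  have "dim ?U = dim (e ` I)" by (simp only: sp[symmetric] dim_span)
  also have "\<dots> = card I" by (simp only: dim_eq_card_independent[OF ind] card_image[OF inj])
  finally show ?thesis .
qed

text \<open>In the basis \<open>e\<close> the operator \<open>L\<^sup>* L\<close> multiplies the
  \<open>i\<close>-th coordinate by \<open>l i\<close>, so an eigenvector for \<open>c\<close> has
  no component along \<open>e i\<close> with \<open>l i \<noteq> c\<close>.\<close>

lemma eigenspace_eq:
  fixes BV :: "'v::euclidean_space \<Rightarrow> 'v \<Rightarrow> real" and BW :: "'w::euclidean_space \<Rightarrow> 'w \<Rightarrow> real"
  assumes V: "pos_def BV" and W: "pos_def BW" and L: "linear L"
    and d: "diagonalizes BV (\<lambda>u v. BW (L u) (L v)) e l"
  shows "{u. metric_adjoint BV BW L (L u) = c *\<^sub>R u} =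
    {u. \<forall>i<DIM('v). i \<notin> {i. i < DIM('v) \<and> l i = c} \<longrightarrow> BV u (e i) = 0}"
proof -
  note V' = pos_def_imp_sym_form[OF V]
  have C: "sym_form (\<lambda>u v. BW (L u) (L v))"
    by (rule pos_semidef_imp_sym_form[OF pos_semidef_pullback[OF pos_def_imp_pos_semidef[OF W] L]])
  have eq: "x = y \<longleftrightarrow> (\<forall>i<DIM('v). BV x (e i) = BV y (e i))" for x y
  proof
    assume *: "\<forall>i<DIM('v). BV x (e i) = BV y (e i)"
    have "x = (\<Sum>i<DIM('v). BV x (e i) *\<^sub>R e i)" by (rule diagonalizesD(3)[OF d])
    also have "\<dots> = (\<Sum>i<DIM('v). BV y (e i) *\<^sub>R e i)" using * by (intro sum.cong) auto
    also have "\<dots> = y" by (rule diagonalizesD(3)[OF d, symmetric])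
    finally show "x = y" .
  qed auto
  have "BV (metric_adjoint BV BW L (L u)) (e i) = l i * BV u (e i)" if "i < DIM('v)" for u i
  proof -
    have "BV (metric_adjoint BV BW L (L u)) (e i) = BV (e i) (metric_adjoint BV BW L (L u))"
      by (rule sym_form_commute[OF V'])
    also have "\<dots> = BW (L (e i)) (L u)" by (rule metric_adjoint_works[OF V W L, symmetric])
    also have "\<dots> = (\<Sum>j<DIM('v). l j * BV (e i) (e j) * BV u (e j))"
      by (rule diagonalizes_form[OF d C])
    also have "\<dots> = (\<Sum>j<DIM('v). if j = i then l i * BV u (e i) else 0)"
      by (intro sum.cong refl) (use that in \<open>auto simp: diagonalizesD(1)[OF d]\<close>)
    finally show ?thesis using that by simp
  qed
  then show ?thesis
    by (intro Collect_cong, subst eq) (auto simp: sym_formD[OF V'])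
qed

text \<open>The dimension of an eigenspace is the number of indices carrying its eigenvalue, and a
  decreasing list is determined by its multiplicities, so the description by \<open>THE\<close> has
  exactly one solution.\<close>

lemma singular_values_eq:
  fixes BV :: "'v::euclidean_space \<Rightarrow> 'v \<Rightarrow> real" and BW :: "'w::euclidean_space \<Rightarrow> 'w \<Rightarrow> real"
  assumes V: "pos_def BV" and W: "pos_def BW" and L: "linear L"
  shows "singular_values BV BW L = map (\<lambda>i. sqrt (eigs BV (\<lambda>u v. BW (L u) (L v)) i)) [0..<DIM('v)]"
proof -
  let ?C = "\<lambda>u v. BW (L u) (L v)"
  let ?l = "eigs BV ?C"
  let ?s = "map (\<lambda>i. sqrt (?l i)) [0..<DIM('v)]"
  have C: "pos_semidef ?C" by (rule pos_semidef_pullback[OF pos_def_imp_pos_semidef[OF W] L])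
  obtain e where d: "diagonalizes BV ?C e ?l" using eigs_diagonalizes[OF V C] .
  have cnt: "count_list ?s t = dim {u. metric_adjoint BV BW L (L u) = t\<^sup>2 *\<^sub>R u}" if "t \<ge> 0" for t
  proof -
    have eq: "(t = sqrt (?l i)) = (?l i = t\<^sup>2)" if "i < DIM('v)" for i
      using eigs_nonneg[OF V C that] \<open>t \<ge> 0\<close> by auto
    have "count_list ?s t = card {i. i < DIM('v) \<and> t = sqrt (?l i)}"
      by (simp add: count_list_eq_length_filter length_filter_conv_card cong: conj_cong)
    also have "\<dots> = card {i. i < DIM('v) \<and> ?l i = t\<^sup>2}"
      by (intro arg_cong[where f = card] Collect_cong conj_cong refl eq)
    also have "\<dots> = dim {u. metric_adjoint BV BW L (L u) = t\<^sup>2 *\<^sub>R u}"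
      unfolding eigenspace_eq[OF V W L d]
      by (rule dim_coordinate_subspace[OF d pos_def_imp_sym_form[OF V], symmetric]) auto
    finally show ?thesis .
  qed
  have sorted: "sorted_wrt (\<ge>) ?s"
    by (auto simp: sorted_wrt_iff_nth_less intro!: eigs_antimono[OF V C])
  have nonneg: "\<forall>t\<in>set ?s. t \<ge> 0"
    using eigs_nonneg[OF V C] by auto
  show ?thesis
    unfolding singular_values_def
  proof (rule the_equality)
    fix s :: "real list"
    assume s: "sorted_wrt (\<ge>) s \<and> (\<forall>t\<in>set s. t \<ge> 0) \<and>
        (\<forall>t\<ge>0. count_list s t = dim {u. metric_adjoint BV BW L (L u) = t\<^sup>2 *\<^sub>R u})"
    \<comment> \<open>The dimensions prescribe the multiplicities of nonnegative \<open>t\<close>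
      only; a negative number occurs in neither list.\<close>
    have "count_list s t = count_list ?s t" for t
    proof (cases "t \<ge> 0")
      case False
      then have "t \<notin> set s" "t \<notin> set ?s" using s nonneg by auto
      then show ?thesis using count_notin by metis
    qed (use s cnt in auto)
    \<comment> \<open>Reversal makes the lists increasing, where both agree with the sorted list of
      their common multiset.\<close>
    then have "mset (rev s) = mset (rev ?s)"
      by (intro multiset_eqI) (simp only: mset_rev count_mset)
    then have "sort (rev ?s) = rev s" "sort (rev ?s) = rev ?s"
      using s sorted by (auto intro!: properties_for_sort simp: sorted_wrt_rev simp del: rev_map)
    then show "s = ?s" by (metis rev_rev_ident)
  qed (use sorted nonneg cnt in blast)
qed

lemma prod_singular_values:
  fixes BV :: "'v::euclidean_space \<Rightarrow> 'v \<Rightarrow> real" and BW :: "'w::euclidean_space \<Rightarrow> 'w \<Rightarrow> real"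
  assumes "pos_def BV" "pos_def BW" "linear L" "k \<le> DIM('v)"
  shows "(\<Prod>i<k. singular_values BV BW L ! i) = pvol k BV BW L"
  using assms(4)
proof (induction k)
  case 0
  then show ?case by (simp add: pvol_def evprod_def)
next
  case (Suc k)
  then show ?case
    by (simp add: singular_values_eq[OF assms(1-3)] pvol_def evprod_def real_sqrt_mult)
qed

lemma singular_values_antimono:
  fixes BV :: "'v::euclidean_space \<Rightarrow> 'v \<Rightarrow> real" and BW :: "'w::euclidean_space \<Rightarrow> 'w \<Rightarrow> real"
  assumes "pos_def BV" "pos_def BW" "linear L" "i \<le> j" "j < DIM('v)"
  shows "singular_values BV BW L ! j \<le> singular_values BV BW L ! i"
    and "0 \<le> singular_values BV BW L ! j"
proof -
  have C: "pos_semidef (\<lambda>u v. BW (L u) (L v))"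
    by (rule pos_semidef_pullback[OF pos_def_imp_pos_semidef[OF assms(2)] assms(3)])
  show "singular_values BV BW L ! j \<le> singular_values BV BW L ! i" "0 \<le> singular_values BV BW L ! j"
    using assms(4,5) eigs_antimono[OF assms(1) C assms(4,5)] eigs_nonneg[OF assms(1) C assms(5)]
    by (auto simp: singular_values_eq[OF assms(1-3)])
qed

section \<open>Continuity of extremal volume ratios\<close>

lemma gdet_tendsto:
  assumes "finite K" "\<And>i j. i \<in> K \<Longrightarrow> j \<in> K \<Longrightarrow> ((\<lambda>x. A x i j) \<longlongrightarrow> A0 i j) F"
  shows "((\<lambda>x. gdet K (A x)) \<longlongrightarrow> gdet K A0) F"
  unfolding gdet_def by (intro tendsto_intros assms(2)) (auto simp: permutes_in_image)

text \<open>All eigenvalues of \<open>C\<close> relative to \<open>C'\<close> are at most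
  \<open>1\<close>. When there are more vectors than dimensions, no \<phi> in the expansion is
  injective and both determinants vanish.\<close>

lemma gram_mono:
  fixes C C' :: "'v::euclidean_space \<Rightarrow> 'v \<Rightarrow> real"
  assumes C: "pos_semidef C" and C': "pos_def C'" and le: "\<And>u. C u u \<le> C' u u" and K: "finite K"
  shows "gdet K (\<lambda>i j. C (u i) (u j)) \<le> gdet K (\<lambda>i j. C' (u i) (u j))"
proof (cases "card K \<le> DIM('v)")
  case True
  obtain e where d: "diagonalizes C' C e (eigs C' C)" using eigs_diagonalizes[OF C' C] .
  have "eigs C' C i \<le> 1" if "i < DIM('v)" for i
    using le[of "e i"] diagonalizesD(1,2)[OF d that that] by simp
  then have "evprod (card K) C' C \<le> 1"
    unfolding evprod_def using True eigs_nonneg[OF C' C] by (intro prod_le_1) auto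
  from mult_right_mono[OF this gram_nonneg[OF pos_def_imp_pos_semidef[OF C'] K, of u]]
  show ?thesis using gram_le[OF C' C K, of u] by simp
next
  case False
  have "gdet K (\<lambda>i j. C (u i) (u j)) = 0" if C: "pos_semidef C" for C :: "'v \<Rightarrow> 'v \<Rightarrow> real"
  proof -
    obtain e where d: "diagonalizes inner C e (eigs inner C)" using eigs_diagonalizes[OF pos_def_inner C] .
    have "\<not> inj_on \<phi> K" if "\<phi> \<in> PiE K (\<lambda>_. {..<DIM('v)})" for \<phi>
      using that False card_inj_on_le[of \<phi> K "{..<DIM('v)}"] by auto
    then show ?thesis
      unfolding gram_expansion[OF d pos_semidef_imp_sym_form[OF C] K, of u u]
      by (simp add: gdet_minor_not_inj[OF K] cong: sum.cong)
  qed
  then show ?thesis using C pos_def_imp_pos_semidef[OF C'] by simp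
qed

text \<open>A form has finitely many matrix entries in an orthonormal basis of \<open>B\<close>, so
  pointwise convergence is uniform on the unit ball; \<open>r\<close>, the sum of the errors of all
  entries, bounds the error relative to \<open>B\<close>.\<close>

lemma sym_forms_eventually_close:
  fixes A :: "'x \<Rightarrow> 'v::euclidean_space \<Rightarrow> 'v \<Rightarrow> real"
  assumes B: "pos_def B" and A0: "sym_form A0" and ev: "eventually (\<lambda>x. sym_form (A x)) F"
    and lim: "\<And>u v. ((\<lambda>x. A x u v) \<longlongrightarrow> A0 u v) F" and \<epsilon>: "\<epsilon> > 0"
  shows "eventually (\<lambda>x. \<forall>u. \<bar>A x u u - A0 u u\<bar> \<le> \<epsilon> * B u u) F"
proof -
  note B' = pos_def_imp_sym_form[OF B]
  obtain e l where d: "diagonalizes B B e l" using exists_diagonalization[OF B B'] by blast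
  let ?d = "DIM('v)"
  define r where "r x = (\<Sum>i<?d. \<Sum>j<?d. \<bar>A x (e i) (e j) - A0 (e i) (e j)\<bar>)" for x
  have "((\<lambda>x. r x) \<longlongrightarrow> (\<Sum>i<?d. \<Sum>j<?d. \<bar>A0 (e i) (e j) - A0 (e i) (e j)\<bar>)) F"
    unfolding r_def by (intro tendsto_intros lim)
  then have "eventually (\<lambda>x. r x < \<epsilon>) F"
    using \<epsilon> by (intro order_tendstoD(2)[of r 0]) auto
  with ev show ?thesis
  proof eventually_elim
    fix x assume sx: "sym_form (A x)" and rx: "r x < \<epsilon>"
    show "\<forall>u. \<bar>A x u u - A0 u u\<bar> \<le> \<epsilon> * B u u"
    proof
      fix u
      let ?u = "\<lambda>i. B u (e i)"
      have exp: "D u u = (\<Sum>i<?d. \<Sum>j<?d. ?u i * ?u j * D (e i) (e j))" if D: "sym_form D" for D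
      proof -
        have "D u u = D (\<Sum>i<?d. ?u i *\<^sub>R e i) (\<Sum>j<?d. ?u j *\<^sub>R e j)"
          by (rule arg_cong2[where f = D]; rule diagonalizesD(3)[OF d])
        also have "\<dots> = (\<Sum>i<?d. \<Sum>j<?d. ?u i * ?u j * D (e i) (e j))"
          by (simp add: sym_formD[OF D] sum_distrib_left mult_ac)
            (intro sum.cong refl arg_cong2[where f = "(*)"] sym_form_commute[OF D])
        finally show ?thesis .
      qed
      have Bu: "B u u = (\<Sum>i<?d. (?u i)\<^sup>2)"
        using diagonalizes_form_self[OF d B', of u u] by (simp add: power2_eq_square)
      have sq: "(?u i)\<^sup>2 \<le> B u u" if "i < ?d" for i
        unfolding Bu using that by (intro member_le_sum) auto
      have prod: "\<bar>?u i * ?u j\<bar> \<le> B u u" if "i < ?d" "j < ?d" for i j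
      proof -
        have "0 \<le> (\<bar>?u i\<bar> - \<bar>?u j\<bar>)\<^sup>2" by simp
        then have "2 * \<bar>?u i * ?u j\<bar> \<le> (?u i)\<^sup>2 + (?u j)\<^sup>2" by (simp add: power2_diff abs_mult)
        then show ?thesis using sq[OF that(1)] sq[OF that(2)] by simp
      qed
      have "A x u u - A0 u u = (\<Sum>i<?d. \<Sum>j<?d. ?u i * ?u j * (A x (e i) (e j) - A0 (e i) (e j)))"
        unfolding exp[OF sx] exp[OF A0] by (simp add: sum_subtractf right_diff_distrib)
      also have "\<bar>\<dots>\<bar> \<le> (\<Sum>i<?d. \<Sum>j<?d. \<bar>?u i * ?u j * (A x (e i) (e j) - A0 (e i) (e j))\<bar>)"
        by (rule order_trans[OF sum_abs]) (intro sum_mono sum_abs)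
      also have "\<dots> \<le> (\<Sum>i<?d. \<Sum>j<?d. B u u * \<bar>A x (e i) (e j) - A0 (e i) (e j)\<bar>)"
        by (intro sum_mono) (auto simp: abs_mult[of "_ * _"] intro!: mult_right_mono prod)
      also have "\<dots> = r x * B u u" by (simp add: r_def sum_distrib_left mult.commute)
      also have "\<dots> \<le> \<epsilon> * B u u"
        using rx pos_def_imp_pos_semidef[OF B] by (intro mult_right_mono) (auto simp: pos_semidef_def)
      finally show "\<bar>A x u u - A0 u u\<bar> \<le> \<epsilon> * B u u" .
    qed
  qed
qed

lemma sym_form_lincomb:
  assumes "sym_form A" "sym_form B"
  shows "sym_form (\<lambda>u v. a * A u v + b * B u v)"
  using assms sym_form_commute[OF assms(1)] sym_form_commute[OF assms(2)]
  by (auto simp: sym_form_def[of "\<lambda>u v. a * A u v + b * B u v"] bilinear_def sym_formD algebra_simps intro!: linearI)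

text \<open>The hypotheses give \<open>C \<le> C0 + \<epsilon> B0\<close> and
  \<open>(1 - \<epsilon>) B0 \<le> B\<close> as quadratic forms. The first bound shifts the
  eigenvalues by \<epsilon> in an unchanged eigenbasis; the second costs a factor
  \<open>1 - \<epsilon>\<close> per dimension.\<close>

lemma evprod_le_perturbed:
  fixes B B0 C C0 :: "'v::euclidean_space \<Rightarrow> 'v \<Rightarrow> real"
  assumes B0: "pos_def B0" and C0: "pos_semidef C0" and B: "pos_def B" and C: "pos_semidef C"
    and k: "k \<le> DIM('v)" and \<epsilon>: "0 < \<epsilon>" "\<epsilon> < 1"
    and cB: "\<And>u. \<bar>B u u - B0 u u\<bar> \<le> \<epsilon> * B0 u u" and cC: "\<And>u. \<bar>C u u - C0 u u\<bar> \<le> \<epsilon> * B0 u u"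
  shows "evprod k B C \<le> (\<Prod>i<k. eigs B0 C0 i + \<epsilon>) / (1 - \<epsilon>) ^ k"
proof -
  note B0' = pos_def_imp_sym_form[OF B0] and C0' = pos_semidef_imp_sym_form[OF C0]
  obtain e where d: "diagonalizes B0 C0 e (eigs B0 C0)" using eigs_diagonalizes[OF B0 C0] .
  obtain u :: "nat \<Rightarrow> 'v" where u: "gdet {..<k} (\<lambda>i j. B (u i) (u j)) = 1"
    "gdet {..<k} (\<lambda>i j. C (u i) (u j)) = evprod k B C"
    using evprod_attained[OF B C k] .
  \<comment> \<open>The coefficients \<open>1\<close> and \<open>0\<close> bring both forms into the
    shape of \<open>sym_form_lincomb\<close>.\<close>
  let ?C = "\<lambda>u v. 1 * C0 u v + \<epsilon> * B0 u v" and ?B = "\<lambda>u v. (1 - \<epsilon>) * B0 u v + 0 * B0 u v"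
  have C': "pos_def ?C"
    using sym_form_lincomb[OF C0' B0', of 1 \<epsilon>] B0 C0 \<epsilon>
    by (auto simp: pos_def_def pos_semidef_def intro!: add_nonneg_pos mult_pos_pos)
  have B': "pos_def ?B"
    using sym_form_lincomb[OF B0' B0', of "1 - \<epsilon>" 0] B0 \<epsilon>
    by (auto simp: pos_def_def)
  have dC: "diagonalizes B0 ?C e (\<lambda>i. eigs B0 C0 i + \<epsilon>)"
    using d by (auto simp: diagonalizes_def)
  have nn: "0 \<le> (\<Prod>i<k. eigs B0 C0 i + \<epsilon>)"
    using k \<epsilon> eigs_nonneg[OF B0 C0] by (intro prod_nonneg) (auto intro!: add_nonneg_nonneg)
  have leC: "C w w \<le> ?C w w" for w using cC[of w] by simp
  have leB: "?B w w \<le> B w w" for w using cB[of w] by (simp add: algebra_simps)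
  have "evprod k B C \<le> gdet {..<k} (\<lambda>i j. ?C (u i) (u j))"
    using gram_mono[OF C C' leC, of "{..<k}" u] u(2) by simp
  also have "\<dots> \<le> (\<Prod>i<k. eigs B0 C0 i + \<epsilon>) * gdet {..<k} (\<lambda>i j. B0 (u i) (u j))"
    using gram_le_diagonalizes[OF dC B0 pos_def_imp_pos_semidef[OF C'], of "{..<k}" u] by simp
  finally have 1: "evprod k B C \<le> (\<Prod>i<k. eigs B0 C0 i + \<epsilon>) * gdet {..<k} (\<lambda>i j. B0 (u i) (u j))" .
  have "gdet {..<k} (\<lambda>i j. ?B (u i) (u j)) = (1 - \<epsilon>) ^ k * gdet {..<k} (\<lambda>i j. B0 (u i) (u j))"
    using gdet_scale_rows[of "{..<k}" "\<lambda>_. 1 - \<epsilon>"] by simp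
  then have "(1 - \<epsilon>) ^ k * gdet {..<k} (\<lambda>i j. B0 (u i) (u j)) \<le> 1"
    using gram_mono[OF pos_def_imp_pos_semidef[OF B'] B leB, of "{..<k}" u] u(1) by simp
  then have "gdet {..<k} (\<lambda>i j. B0 (u i) (u j)) \<le> 1 / (1 - \<epsilon>) ^ k"
    using \<epsilon> by (simp add: field_simps)
  from order_trans[OF 1 mult_left_mono[OF this nn]] show ?thesis by simp
qed

text \<open>Eigenvectors need not vary continuously, so the two semicontinuities are separate: a
  fixed tuple that attains the limit value bounds the nearby values from below, and
  \<open>evprod_le_perturbed\<close> bounds them from above.\<close>

lemma evprod_tendsto:
  fixes B C :: "'x \<Rightarrow> 'v::euclidean_space \<Rightarrow> 'v \<Rightarrow> real"
  assumes B0: "pos_def B0" and C0: "pos_semidef C0" and k: "k \<le> DIM('v)"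
    and evB: "eventually (\<lambda>x. pos_def (B x)) F" and evC: "eventually (\<lambda>x. pos_semidef (C x)) F"
    and limB: "\<And>u v. ((\<lambda>x. B x u v) \<longlongrightarrow> B0 u v) F" and limC: "\<And>u v. ((\<lambda>x. C x u v) \<longlongrightarrow> C0 u v) F"
  shows "((\<lambda>x. evprod k (B x) (C x)) \<longlongrightarrow> evprod k B0 C0) F"
proof (rule order_tendstoI)
  fix a assume a: "a < evprod k B0 C0"
  obtain u :: "nat \<Rightarrow> 'v" where u: "gdet {..<k} (\<lambda>i j. B0 (u i) (u j)) = 1"
    "gdet {..<k} (\<lambda>i j. C0 (u i) (u j)) = evprod k B0 C0"
    using evprod_attained[OF B0 C0 k] .
  let ?GB = "\<lambda>x. gdet {..<k} (\<lambda>i j. B x (u i) (u j))" and ?GC = "\<lambda>x. gdet {..<k} (\<lambda>i j. C x (u i) (u j))"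
  have GB: "(?GB \<longlongrightarrow> 1) F"
    using gdet_tendsto[of "{..<k}" "\<lambda>x i j. B x (u i) (u j)" "\<lambda>i j. B0 (u i) (u j)" F] limB u(1) by simp
  have "(?GC \<longlongrightarrow> evprod k B0 C0) F"
    using gdet_tendsto[of "{..<k}" "\<lambda>x i j. C x (u i) (u j)" "\<lambda>i j. C0 (u i) (u j)" F] limC u(2) by simp
  from tendsto_divide[OF this GB] have "eventually (\<lambda>x. a < ?GC x / ?GB x) F"
    using a by (intro order_tendstoD(1)) auto
  moreover have "eventually (\<lambda>x. 0 < ?GB x) F" using GB by (rule order_tendstoD(1)) simp
  ultimately show "eventually (\<lambda>x. a < evprod k (B x) (C x)) F"
    using evB evC
  proof eventually_elim
    case (elim x)
    have "?GC x \<le> evprod k (B x) (C x) * ?GB x"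
      using gram_le[OF elim(3,4), of "{..<k}" u] by simp
    then have "?GC x / ?GB x \<le> evprod k (B x) (C x)" using elim(2) by (simp add: divide_le_eq)
    with elim(1) show ?case by simp
  qed
next
  fix a assume a: "evprod k B0 C0 < a"
  let ?h = "\<lambda>\<epsilon>. (\<Prod>i<k. eigs B0 C0 i + \<epsilon>) / (1 - \<epsilon>) ^ k"
  have "(?h \<longlongrightarrow> (\<Prod>i<k. eigs B0 C0 i + 0) / (1 - 0) ^ k) (at_right 0)"
    by (intro tendsto_intros) auto
  then have "eventually (\<lambda>\<epsilon>. ?h \<epsilon> < a) (at_right 0)"
    using a by (intro order_tendstoD(2)) (auto simp: evprod_def)
  moreover have "eventually (\<lambda>\<epsilon>::real. \<epsilon> \<in> {0<..<1}) (at_right 0)"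
    by (rule eventually_at_right_real) simp
  ultimately have "eventually (\<lambda>\<epsilon>. ?h \<epsilon> < a \<and> \<epsilon> \<in> {0<..<1}) (at_right 0)"
    by eventually_elim simp
  then obtain \<epsilon> where \<epsilon>: "?h \<epsilon> < a" "0 < \<epsilon>" "\<epsilon> < 1"
    using eventually_happens by fastforce
  have "eventually (\<lambda>x. \<forall>u. \<bar>B x u u - B0 u u\<bar> \<le> \<epsilon> * B0 u u) F"
    by (rule sym_forms_eventually_close[OF B0 pos_def_imp_sym_form[OF B0] _ limB \<epsilon>(2)])
      (use evB in \<open>auto elim: eventually_mono simp: pos_def_def\<close>)
  moreover have "eventually (\<lambda>x. \<forall>u. \<bar>C x u u - C0 u u\<bar> \<le> \<epsilon> * B0 u u) F"
    by (rule sym_forms_eventually_close[OF B0 pos_semidef_imp_sym_form[OF C0] _ limC \<epsilon>(2)])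
      (use evC in \<open>auto elim: eventually_mono simp: pos_semidef_def\<close>)
  ultimately show "eventually (\<lambda>x. evprod k (B x) (C x) < a) F"
    using evB evC
  proof eventually_elim
    case (elim x)
    have "evprod k (B x) (C x) \<le> ?h \<epsilon>"
      by (rule evprod_le_perturbed[OF B0 C0 elim(3,4) k \<epsilon>(2,3)]) (use elim in auto)
    with \<epsilon>(1) show ?case by simp
  qed
qed

section \<open>Kingman's theorem for ergodic systems\<close>

definition rate :: "nat \<Rightarrow> real \<Rightarrow> ereal" where
  "rate n r = ereal (1 / real n) * ln_ereal (ereal r)"

lemma rate_pos: "n > 0 \<Longrightarrow> r > 0 \<Longrightarrow> rate n r = ereal (ln r / real n)"
  by (simp add: rate_def ln_ereal_def)

lemma rate_zero: "n > 0 \<Longrightarrow> rate n 0 = -\<infinity>"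
  by (simp add: rate_def ln_ereal_def)

text \<open>Comparison with an exponential covers \<open>r = 0\<close> too, where the rate is
  -\<infinity>; later estimates are carried out in this form.\<close>

lemma rate_le_iff:
  assumes "n > 0" "r \<ge> 0"
  shows "rate n r \<le> ereal \<gamma> \<longleftrightarrow> r \<le> exp (real n * \<gamma>)"
proof (cases "r = 0")
  case False
  then have r: "r > 0" using assms by simp
  have "rate n r \<le> ereal \<gamma> \<longleftrightarrow> ln r \<le> real n * \<gamma>"
    using assms(1) by (simp add: rate_pos[OF _ r] divide_le_eq mult.commute)
  also have "\<dots> \<longleftrightarrow> r \<le> exp (real n * \<gamma>)"
    using r by (metis exp_le_cancel_iff exp_ln)
  finally show ?thesis .
qed (use assms in \<open>simp add: rate_zero\<close>)

lemma less_rate_iff: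
  assumes "n > 0" "r \<ge> 0"
  shows "ereal \<gamma> < rate n r \<longleftrightarrow> exp (real n * \<gamma>) < r"
  using rate_le_iff[OF assms, of \<gamma>] by (simp add: not_le[symmetric])

lemma rate_mono: "r \<le> s \<Longrightarrow> rate n r \<le> rate n s"
  unfolding rate_def by (intro ereal_mult_left_mono) (auto simp: ln_ereal_def)

lemma borel_measurable_ln_ereal [measurable]: "ln_ereal \<in> borel_measurable borel"
  unfolding ln_ereal_def by measurable

lemma borel_measurable_rate [measurable (raw)]:
  "g \<in> borel_measurable M \<Longrightarrow> (\<lambda>x. rate n (g x)) \<in> borel_measurable M"
  unfolding rate_def by measurable

section \<open>Invariant sets and functions of an ergodic map\<close>

locale ergodic_system = prob_space M for M :: "'a measure" and f :: "'a \<Rightarrow> 'a" +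
  assumes space_UNIV: "space M = UNIV"
    and measurable_map [measurable]: "f \<in> measurable M M"
    and preserving: "distr M M f = M"
    and trivial_invariant: "\<And>B. B \<in> sets M \<Longrightarrow> f -` B = B \<Longrightarrow> prob B = 0 \<or> prob B = 1"
begin

lemma measurable_iterate [measurable]: "f ^^ n \<in> measurable M M"
  by (induction n) (auto intro: measurable_comp)

lemma distr_iterate: "distr M M (f ^^ n) = M"
proof (induction n)
  case 0
  show ?case by (simp add: distr_id2)
next
  case (Suc n)
  have "distr M M (f \<circ> f ^^ n) = distr (distr M M (f ^^ n)) M f"
    by (rule distr_distr[symmetric]) measurable
  then show ?case by (simp add: Suc preserving comp_def)
qed

lemma prob_vimage_iterate: "B \<in> sets M \<Longrightarrow> prob ((f ^^ n) -` B) = prob B"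
  using measure_distr[OF measurable_iterate, of B n] by (simp add: distr_iterate space_UNIV)

lemma sets_vimage_iterate: "B \<in> sets M \<Longrightarrow> (f ^^ n) -` B \<in> sets M"
  using measurable_sets[OF measurable_iterate, of B n] by (simp add: space_UNIV)

text \<open>The iterated preimages of \<open>U\<close> decrease and all have the measure of
  \<open>U\<close>. Their intersection has this measure as well, and it is exactly
  invariant.\<close>

lemma prob_01_of_vimage_subset:
  assumes U: "U \<in> sets M" and sub: "f -` U \<subseteq> U"
  shows "prob U = 0 \<or> prob U = 1"
proof -
  define V where "V n = (f ^^ n) -` U" for n
  have step: "f -` V n = V (Suc n)" for n
    unfolding V_def by (simp only: vimage_comp funpow_Suc_right)
  have "V (Suc n) \<subseteq> V n" for n
    using sub by (auto simp: V_def)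
  then have dec: "decseq V" by (rule decseq_SucI)
  have sets: "range V \<subseteq> sets M" using sets_vimage_iterate[OF U] by (auto simp: V_def)
  have "(\<lambda>n. prob (V n)) \<longlonglongrightarrow> prob (\<Inter>n. V n)"
    by (rule finite_Lim_measure_decseq[OF sets dec])
  then have eq: "prob (\<Inter>n. V n) = prob U"
    using prob_vimage_iterate[OF U] by (simp add: V_def LIMSEQ_const_iff)
  have "f -` (\<Inter>n. V n) = (\<Inter>n. V (Suc n))" by (simp add: vimage_INT step)
  also have "\<dots> = (\<Inter>n. V n)"
    using dec by (auto simp: decseq_Suc_iff)
  finally show ?thesis
    using trivial_invariant[of "\<Inter>n. V n"] sets eq by auto
qed

text \<open>Each sublevel set of \<open>F\<close> contains its preimage, hence has probability 0 or
  1, and \<open>c\<close> is the level where the probability jumps. Monotonicity along orbits,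
  instead of invariance, is what submultiplicativity provides.\<close>

lemma AE_constant_of_increasing:
  fixes F :: "'a \<Rightarrow> ereal"
  assumes F [measurable]: "F \<in> borel_measurable M" and le: "\<And>x. F x \<le> F (f x)"
  obtains c where "AE x in M. F x = c"
proof -
  define U where "U \<gamma> = {x. F x < \<gamma>}" for \<gamma>
  have U: "U \<gamma> \<in> sets M" for \<gamma>
    using measurable_sets[OF F, of "{..<\<gamma>}"] by (simp add: U_def space_UNIV vimage_def)
  have 01: "prob (U \<gamma>) = 0 \<or> prob (U \<gamma>) = 1" for \<gamma>
    by (rule prob_01_of_vimage_subset[OF U]) (use le in \<open>auto simp: U_def intro: le_less_trans\<close>)
  define c where "c = Sup {\<gamma>. prob (U \<gamma>) = 0}"
  have lo: "AE x in M. \<gamma> \<le> F x" if "\<gamma> < c" for \<gamma>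
  proof -
    obtain \<gamma>' where "prob (U \<gamma>') = 0" "\<gamma> < \<gamma>'"
      using \<open>\<gamma> < c\<close> by (auto simp: c_def less_Sup_iff)
    then have "AE x in M. x \<notin> U \<gamma>'"
      using prob_eq_0[OF U, of \<gamma>'] by simp
    with \<open>\<gamma> < \<gamma>'\<close> show ?thesis by (auto simp: U_def)
  qed
  have up: "AE x in M. F x \<le> \<gamma>" if "c < \<gamma>" for \<gamma>
  proof -
    have "prob (U \<gamma>) \<noteq> 0"
      using that Sup_upper[of \<gamma> "{\<gamma>. prob (U \<gamma>) = 0}"] by (auto simp: c_def)
    then have "AE x in M. x \<in> U \<gamma>" using 01[of \<gamma>] prob_eq_1[OF U, of \<gamma>] by auto
    then show ?thesis by (auto simp: U_def)
  qed
  \<comment> \<open>Rational levels keep the exceptional sets countable in number.\<close>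
  have "AE x in M. \<forall>q::rat. (ereal (of_rat q) < c \<longrightarrow> ereal (of_rat q) \<le> F x) \<and> (c < ereal (of_rat q) \<longrightarrow> F x \<le> ereal (of_rat q))"
    using lo up by (simp add: AE_all_countable)
  then have "AE x in M. F x = c"
  proof eventually_elim
    case (elim x)
    show ?case
    proof (rule antisym; rule ccontr; simp only: not_le)
      assume "c < F x"
      then obtain q where "c < ereal (real_of_rat q)" "ereal (real_of_rat q) < F x"
        using ereal_dense3 by blast
      then show False using elim by (meson not_le)
    next
      assume "F x < c"
      then obtain q where "F x < ereal (real_of_rat q)" "ereal (real_of_rat q) < c"
        using ereal_dense3 by blast
      then show False using elim by (meson not_le)
    qed
  qed
  then show thesis by (rule that)
qed

end

section \<open>Visits to a set and block decompositions of orbits\<close>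

definition visits :: "('a \<Rightarrow> 'a) \<Rightarrow> 'a set \<Rightarrow> nat \<Rightarrow> 'a \<Rightarrow> real" where
  "visits f B n x = (\<Sum>i<n. indicator B ((f ^^ i) x))"

lemma visits_nonneg: "0 \<le> visits f B n x"
  by (simp add: visits_def sum_nonneg)

lemma visits_Suc: "visits f B (Suc n) x = indicator B x + visits f B n (f x)"
  by (simp add: visits_def sum.lessThan_Suc_shift funpow_Suc_right del: sum.lessThan_Suc funpow.simps(2))

lemma visits_add: "visits f B (n + m) x = visits f B n x + visits f B m ((f ^^ n) x)"
  by (induction n arbitrary: x) (auto simp: visits_Suc visits_def[of _ _ 0] funpow_Suc_right simp del: funpow.simps(2))

text \<open>Off \<open>B\<close> the orbit is cut into blocks of length at most \<open>L\<close> on which \<open>p\<close> grows at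
  rate at most \<open>\<gamma>\<close>; every visit to \<open>B\<close>, and the incomplete last block, costs at most the
  trivial rate.\<close>

lemma submultiplicative_cover_bound:
  fixes p :: "nat \<Rightarrow> 'a \<Rightarrow> real"
  assumes nonneg: "\<And>n x. 0 \<le> p n x"
    and submult: "\<And>n m x. p (n + m) x \<le> p n x * p m ((f ^^ n) x)"
    and bound: "\<And>n x. p n x \<le> exp (real n * C)"
    and D: "0 \<le> D" "C - \<gamma> \<le> D"
    and cover: "\<And>x. x \<notin> B \<Longrightarrow> \<exists>N\<in>{1..L}. p N x \<le> exp (real N * \<gamma>)"
  shows "p n x \<le> exp (real n * \<gamma> + D * (visits f B n x + real L))"
proof (induction n arbitrary: x rule: less_induct)
  case (less n)
  have C: "C \<le> \<gamma> + D" using D by simp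
  consider "n \<le> L" | "L < n" "x \<in> B" | "L < n" "x \<notin> B" by linarith
  then show ?case
  proof cases
    case 1
    have "real n * C \<le> real n * (\<gamma> + D)" using C by (intro mult_left_mono) auto
    also have "\<dots> \<le> real n * \<gamma> + D * (visits f B n x + real L)"
    proof -
      have "D * real n \<le> D * (visits f B n x + real L)"
        using D 1 visits_nonneg[of f B n x] by (intro mult_left_mono) auto
      then show ?thesis by (simp add: algebra_simps)
    qed
    finally show ?thesis using bound[of n x] by (meson exp_le_cancel_iff order_trans)
  next
    case 2
    then obtain m where m: "n = Suc m" by (cases n) auto
    have "p n x \<le> p 1 x * p m (f x)" using submult[of 1 m x] m by simp
    also have "\<dots> \<le> exp C * exp (real m * \<gamma> + D * (visits f B m (f x) + real L))"
      using bound[of 1 x] less[of m "f x"] m nonneg by (intro mult_mono) auto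
    also have "\<dots> = exp (C + (real m * \<gamma> + D * (visits f B m (f x) + real L)))"
      by (simp add: exp_add)
    also have "\<dots> \<le> exp (real n * \<gamma> + D * (visits f B n x + real L))"
      using C 2 by (simp add: m visits_Suc algebra_simps)
    finally show ?thesis .
  next
    case 3
    then obtain N where N: "1 \<le> N" "N \<le> L" "p N x \<le> exp (real N * \<gamma>)" using cover[OF 3(2)] by auto
    let ?m = "n - N"
    have n: "n = N + ?m" using N 3 by simp
    have "p n x \<le> p N x * p ?m ((f ^^ N) x)" using submult[of N ?m x] n by simp
    also have "\<dots> \<le> exp (real N * \<gamma>) * exp (real ?m * \<gamma> + D * (visits f B ?m ((f ^^ N) x) + real L))"
      using N less[of ?m "(f ^^ N) x"] 3 nonneg by (intro mult_mono) auto
    also have "\<dots> = exp (real N * \<gamma> + (real ?m * \<gamma> + D * (visits f B ?m ((f ^^ N) x) + real L)))"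
      by (simp add: exp_add)
    also have "\<dots> \<le> exp (real n * \<gamma> + D * (visits f B n x + real L))"
    proof -
      have "real N * \<gamma> + real ?m * \<gamma> = real n * \<gamma>" using n by (metis of_nat_add ring_class.ring_distribs(2))
      moreover have "visits f B ?m ((f ^^ N) x) \<le> visits f B n x"
        using visits_add[of f B N ?m x] visits_nonneg[of f B N x] n by simp
      then have "D * (visits f B ?m ((f ^^ N) x) + real L) \<le> D * (visits f B n x + real L)"
        using D by (intro mult_left_mono) auto
      ultimately show ?thesis by simp
    qed
    finally show ?thesis .
  qed
qed

lemma (in ergodic_system) visits_measurable [measurable]:
  assumes "B \<in> sets M"
  shows "visits f B n \<in> borel_measurable M"
  unfolding visits_def
  by (intro borel_measurable_sum measurable_compose[OF measurable_iterate] borel_measurable_indicator assms)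

section \<open>Submultiplicative cocycles over an ergodic map\<close>

locale submultiplicative_cocycle = ergodic_system M f for M :: "'a measure" and f +
  fixes p :: "nat \<Rightarrow> 'a \<Rightarrow> real" and C :: real
  assumes p_measurable [measurable]: "\<And>n. p n \<in> borel_measurable M"
    and p_nonneg: "\<And>n x. 0 \<le> p n x"
    and p_submult: "\<And>n m x. p (n + m) x \<le> p n x * p m ((f ^^ n) x)"
    and p_bound: "\<And>n x. p n x \<le> exp (real n * C)"
begin

definition bad :: "real \<Rightarrow> nat \<Rightarrow> 'a set" where
  "bad \<gamma> L = {x. \<forall>N\<in>{1..L}. exp (real N * \<gamma>) < p N x}"

lemma bad_sets [measurable]: "bad \<gamma> L \<in> sets M"
proof -
  have "{x \<in> space M. \<forall>N\<in>{1..L}. exp (real N * \<gamma>) < p N x} \<in> sets M" by measurable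
  then show ?thesis by (simp add: bad_def space_UNIV)
qed

lemma cover_bound:
  "p n x \<le> exp (real n * \<gamma> + max 0 (C - \<gamma>) * (visits f (bad \<gamma> L) n x + real L))"
  by (rule submultiplicative_cover_bound[where C = C])
    (use p_nonneg p_submult p_bound in \<open>auto simp: bad_def not_less\<close>)

lemma prob_bad_tendsto_0:
  assumes "AE x in M. \<exists>n\<ge>1. p n x \<le> exp (real n * \<gamma>)"
  shows "(\<lambda>L. prob (bad \<gamma> L)) \<longlonglongrightarrow> 0"
proof -
  have "decseq (bad \<gamma>)" by (rule decseq_SucI) (auto simp: bad_def)
  then have "(\<lambda>L. prob (bad \<gamma> L)) \<longlonglongrightarrow> prob (\<Inter>L. bad \<gamma> L)"
    by (intro finite_Lim_measure_decseq) auto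
  moreover have "AE x in M. x \<notin> (\<Inter>L. bad \<gamma> L)"
    using assms
  proof eventually_elim
    case (elim x)
    then obtain n where "n \<ge> 1" "p n x \<le> exp (real n * \<gamma>)" by blast
    then have "x \<notin> bad \<gamma> n" by (auto simp: bad_def not_less)
    then show ?case by blast
  qed
  then have "prob (\<Inter>L. bad \<gamma> L) = 0"
    using prob_eq_0[of "\<Inter>L. bad \<gamma> L"] by auto
  ultimately show ?thesis by simp
qed

lemma integral_visits:
  assumes B [measurable]: "B \<in> sets M"
  shows "integrable M (visits f B n)" "(LINT x|M. visits f B n x) = real n * prob B"
proof -
  have i: "integrable M (\<lambda>x. indicator B ((f ^^ i) x) :: real)" for i
    by (rule integrable_const_bound[of _ 1]) auto
  have "(LINT x|M. indicator B ((f ^^ i) x) :: real) = prob B" for i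
  proof -
    have "(LINT x|M. indicator B ((f ^^ i) x) :: real) = (LINT x|M. indicator ((f ^^ i) -` B) x)"
      by (simp add: indicator_def)
    also have "\<dots> = prob ((f ^^ i) -` B)"
      using sets_vimage_iterate[OF B, of i] by (simp add: space_UNIV)
    finally show ?thesis by (simp add: prob_vimage_iterate[OF B])
  qed
  with i show "integrable M (visits f B n)" "(LINT x|M. visits f B n x) = real n * prob B"
    unfolding visits_def by auto
qed

text \<open>Integrating \<open>cover_bound\<close> and dividing by \<open>n\<close> leaves the
  errors \<open>?D * prob (bad \<gamma> L)\<close> and \<open>?D * L / n\<close>. The second
  vanishes as \<open>n\<close> grows with \<open>L\<close> fixed, the first as \<open>L\<close>
  grows afterwards. The function \<open>h\<close> stands for truncated logarithms in
  \<open>kingman\<close> and for negative visit counts in \<open>AE_visits_less\<close>.\<close>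

lemma le_of_integral_bound:
  assumes ae: "AE x in M. \<exists>n\<ge>1. p n x \<le> exp (real n * \<gamma>)"
    and h: "\<And>n. n \<ge> 1 \<Longrightarrow> integrable M (h n)" "\<And>n. n \<ge> 1 \<Longrightarrow> real n * \<beta> \<le> (LINT x|M. h n x)"
    and le: "\<And>n x. n \<ge> 1 \<Longrightarrow> h n x \<le> ln (max (p n x) (exp (real n * \<gamma>)))"
  shows "\<beta> \<le> \<gamma>"
proof -
  let ?D = "max 0 (C - \<gamma>)"
  have *: "\<beta> \<le> \<gamma> + ?D * prob (bad \<gamma> L)" for L
  proof -
    have "\<beta> \<le> \<gamma> + ?D * prob (bad \<gamma> L) + ?D * real L / real n" if n: "n \<ge> 1" for n
    proof -
      let ?g = "\<lambda>x. real n * \<gamma> + ?D * (visits f (bad \<gamma> L) n x + real L)"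
      have "h n x \<le> ?g x" for x
      proof -
        have "max (p n x) (exp (real n * \<gamma>)) \<le> exp (?g x)"
          using cover_bound[of n x \<gamma> L] visits_nonneg[of f "bad \<gamma> L" n x] by simp
        then have "ln (max (p n x) (exp (real n * \<gamma>))) \<le> ?g x"
          by (metis exp_gt_zero less_max_iff_disj ln_exp ln_le_cancel_iff)
        then show ?thesis using le[OF n, of x] by simp
      qed
      moreover have "integrable M ?g"
        by (intro Bochner_Integration.integrable_add integrable_mult_right integrable_const
            integral_visits(1) bad_sets)
      ultimately have "(LINT x|M. h n x) \<le> (LINT x|M. ?g x)"
        by (intro integral_mono h(1)[OF n])
      also have "\<dots> = real n * \<gamma> + ?D * (real n * prob (bad \<gamma> L) + real L)"
        using integral_visits[of "bad \<gamma> L" n] by (simp add: prob_space)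
      finally have "(LINT x|M. h n x) \<le> real n * \<gamma> + ?D * (real n * prob (bad \<gamma> L) + real L)" .
      then have "real n * \<beta> \<le> real n * (\<gamma> + ?D * prob (bad \<gamma> L) + ?D * real L / real n)"
      proof -
        assume "(LINT x|M. h n x) \<le> real n * \<gamma> + ?D * (real n * prob (bad \<gamma> L) + real L)"
        moreover have "real n * (\<gamma> + ?D * prob (bad \<gamma> L) + ?D * real L / real n) =
            real n * \<gamma> + ?D * (real n * prob (bad \<gamma> L) + real L)"
          using n by (simp add: algebra_simps)
        ultimately show ?thesis using h(2)[OF n] by simp
      qed
      then show ?thesis using n by (simp only: mult_le_cancel_left_pos of_nat_0_less_iff)
    qed
    then have "eventually (\<lambda>n. \<beta> \<le> \<gamma> + ?D * prob (bad \<gamma> L) + ?D * real L / real n) sequentially"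
      by (auto simp: eventually_sequentially)
    moreover have "(\<lambda>n. \<gamma> + ?D * prob (bad \<gamma> L) + ?D * real L / real n) \<longlonglongrightarrow> \<gamma> + ?D * prob (bad \<gamma> L) + 0"
      by (intro tendsto_add tendsto_const lim_const_over_n)
    ultimately have "\<beta> \<le> \<gamma> + ?D * prob (bad \<gamma> L) + 0" by (intro tendsto_lowerbound) auto
    then show ?thesis by simp
  qed
  have "(\<lambda>L. \<gamma> + ?D * prob (bad \<gamma> L)) \<longlonglongrightarrow> \<gamma> + ?D * 0"
    by (intro tendsto_intros prob_bad_tendsto_0 ae)
  then show ?thesis using * by (intro tendsto_lowerbound[of _ \<gamma>]) auto
qed

definition lower_rate :: "'a \<Rightarrow> ereal" where
  "lower_rate x = liminf (\<lambda>n. rate n (p n x))"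

lemma lower_rate_measurable [measurable]: "lower_rate \<in> borel_measurable M"
  unfolding lower_rate_def[abs_def] by measurable

text \<open>One step changes \<open>p\<close> by the factor \<open>p 1 x \<le> exp C\<close>, which
  is negligible at exponential scale. The reverse inequality may fail where \<open>p 1 x\<close>
  vanishes.\<close>

lemma lower_rate_increasing: "lower_rate x \<le> lower_rate (f x)"
  unfolding lower_rate_def le_Liminf_iff
proof (intro allI impI)
  fix y assume "y < liminf (\<lambda>n. rate n (p n x))"
  then obtain r2 where r2: "y < ereal r2" "ereal r2 < liminf (\<lambda>n. rate n (p n x))"
    using ereal_dense2 by blast
  then obtain r1 where r1: "y < ereal r1" "r1 < r2"
    using ereal_dense2[OF r2(1)] by auto
  from less_LiminfD[OF r2(2)] obtain n0 where n0: "\<And>n. n \<ge> n0 \<Longrightarrow> ereal r2 < rate n (p n x)"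
    by (auto simp: eventually_sequentially)
  \<comment> \<open>From time \<open>n1\<close> on, the gap \<open>r2 - r1\<close> pays for the loss
    of the factor \<open>exp C\<close>.\<close>
  obtain n1 where n1: "C - r2 < real n1 * (r2 - r1)"
    using reals_Archimedean3[of "r2 - r1"] r1(2) by auto
  show "eventually (\<lambda>n. y < rate n (p n (f x))) sequentially"
    unfolding eventually_sequentially
  proof (intro exI allI impI)
    fix n assume n: "Suc (max n0 n1) \<le> n"
    have "exp (real (1 + n) * r2) < p (1 + n) x"
      using n0[of "1 + n"] n p_nonneg by (subst less_rate_iff[symmetric]) auto
    also have "\<dots> \<le> p 1 x * p n (f x)" using p_submult[of 1 n x] by simp
    also have "\<dots> \<le> exp C * p n (f x)"
      using p_bound[of 1 x] p_nonneg by (intro mult_right_mono) auto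
    finally have "exp (real (1 + n) * r2 - C) < p n (f x)"
      by (simp add: exp_diff divide_less_eq mult.commute)
    moreover have "real n * r1 \<le> real (1 + n) * r2 - C"
    proof -
      have "real n1 * (r2 - r1) \<le> real n * (r2 - r1)" using n r1(2) by (intro mult_right_mono) auto
      with n1 show ?thesis by (simp add: algebra_simps)
    qed
    ultimately have "exp (real n * r1) < p n (f x)"
      by (meson exp_le_cancel_iff le_less_trans)
    then have "ereal r1 < rate n (p n (f x))" using n p_nonneg by (subst less_rate_iff) auto
    then show "y < rate n (p n (f x))" using r1(1) by order
  qed
qed

lemma exists_small_of_lower_rate:
  assumes "lower_rate x < ereal \<gamma>"
  shows "\<exists>n\<ge>1. p n x \<le> exp (real n * \<gamma>)"
proof (rule ccontr)
  assume "\<not> ?thesis"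
  then have "exp (real n * \<gamma>) < p n x" if "n \<ge> 1" for n using that not_le by blast
  then have "ereal \<gamma> \<le> rate n (p n x)" if "n \<ge> 1" for n
    using that p_nonneg[of n x] less_rate_iff[of n "p n x" \<gamma>] by (simp add: less_imp_le)
  then have "ereal \<gamma> \<le> lower_rate x"
    unfolding lower_rate_def by (intro Liminf_bounded) (auto simp: eventually_sequentially)
  with assms show False by simp
qed

lemma lower_rate_le: "lower_rate x \<le> ereal C"
  unfolding lower_rate_def
  by (intro Liminf_le) (auto simp: eventually_sequentially rate_le_iff p_nonneg p_bound intro!: exI[of _ 1])

end

context ergodic_system
begin

text \<open>An upper half of Birkhoff's theorem. The function \<open>exp (- visits)\<close> is a
  cocycle with trivial rate \<open>0\<close>, so its lower rate has an almost sure value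
  \<open>c\<close>; as the mean of \<open>- visits\<close> is \<open>- n * prob B\<close>,
  \<open>le_of_integral_bound\<close> excludes \<open>c < - prob B\<close>.\<close>

lemma AE_visits_less:
  assumes B [measurable]: "B \<in> sets M" and \<delta>: "prob B < \<delta>"
  shows "AE x in M. eventually (\<lambda>n. visits f B n x < real n * \<delta>) sequentially"
proof -
  let ?p = "\<lambda>n x. exp (- visits f B n x)"
  interpret V: submultiplicative_cocycle M f ?p 0
    by unfold_locales (auto simp: visits_add visits_nonneg exp_add[symmetric])
  obtain c where c: "AE x in M. V.lower_rate x = c"
    using AE_constant_of_increasing[OF V.lower_rate_measurable V.lower_rate_increasing] by blast
  have "ereal (- prob B) \<le> c"
  proof (rule ccontr)
    assume "\<not> ?thesis"
    then obtain \<gamma> where \<gamma>: "c < ereal \<gamma>" "\<gamma> < - prob B" using ereal_dense2[of c "ereal (- prob B)"] by (auto simp: not_le)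
    have "- prob B \<le> \<gamma>"
    proof (rule V.le_of_integral_bound[where h = "\<lambda>n x. - visits f B n x"])
      show "AE x in M. \<exists>n\<ge>1. ?p n x \<le> exp (real n * \<gamma>)"
        using c by eventually_elim (rule V.exists_small_of_lower_rate, use \<gamma>(1) in simp)
      show "- visits f B n x \<le> ln (max (?p n x) (exp (real n * \<gamma>)))" for n x
        by (subst ln_exp[symmetric], subst ln_le_cancel_iff) (auto simp: less_max_iff_disj)
    qed (use V.integral_visits[OF B] in auto)
    with \<gamma>(2) show False by simp
  qed
  then have lt: "ereal (- \<delta>) < c" using \<delta> by (metis ereal_less_eq(3) less_ereal.simps(1) less_le_trans neg_less_iff_less)
  show ?thesis
    using c
  proof eventually_elim
    case (elim x)
    then have "eventually (\<lambda>n. ereal (- \<delta>) < rate n (?p n x)) sequentially"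
      using lt unfolding V.lower_rate_def by (intro less_LiminfD) simp
    then show ?case
      using eventually_ge_at_top[of 1]
      by eventually_elim (auto simp: less_rate_iff)
  qed
qed

end

context submultiplicative_cocycle
begin

text \<open>Let \<open>c\<close> be the almost sure value of the lower rate. For \<gamma> above
  \<open>c\<close>, almost every point starts a block of rate at most \<gamma>, so
  \<open>bad \<gamma> L\<close> is small for large \<open>L\<close>, orbits visit it rarely, and
  \<open>cover_bound\<close> keeps the upper rate near \<gamma>. The last clause is the lower half
  of \<open>c = lim (1/n) \<integral> log p\<^sub>n\<close>, with truncations in place of logarithms
  that may be -\<infinity>.\<close>

theorem kingman:
  obtains c where "c < \<infinity>" "AE x in M. (\<lambda>n. rate n (p n x)) \<longlonglongrightarrow> c"
    "\<And>\<beta>. (\<And>n T. n \<ge> 1 \<Longrightarrow> real n * \<beta> \<le> (LINT x|M. ln (max (p n x) (exp T)))) \<Longrightarrow> ereal \<beta> \<le> c"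
proof -
  obtain c where c: "AE x in M. lower_rate x = c"
    using AE_constant_of_increasing[OF lower_rate_measurable lower_rate_increasing] by blast
  have "\<exists>x. lower_rate x = c"
    using eventually_happens[OF c] ae_filter_bot by auto
  then have c_le: "c \<le> ereal C" using lower_rate_le by metis
  have small: "AE x in M. \<exists>n\<ge>1. p n x \<le> exp (real n * \<gamma>)" if "c < ereal \<gamma>" for \<gamma>
    using c by eventually_elim (rule exists_small_of_lower_rate, use that in simp)
  have "AE x in M. limsup (\<lambda>n. rate n (p n x)) \<le> ereal \<gamma>'" if \<gamma>': "c < ereal \<gamma>'" for \<gamma>'
  proof -
    obtain \<gamma> where \<gamma>: "c < ereal \<gamma>" "\<gamma> < \<gamma>'" using ereal_dense2[OF \<gamma>'] by auto
    let ?D = "max 0 (C - \<gamma>)"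
    \<comment> \<open>Visits at frequency \<delta> cost at most half of the gap
      \<open>\<gamma>' - \<gamma>\<close>; the other half pays for the incomplete last block. The
      summand \<open>1\<close> avoids division by zero.\<close>
    define \<delta> where "\<delta> = (\<gamma>' - \<gamma>) / (2 * (?D + 1))"
    have D: "?D * \<delta> \<le> (\<gamma>' - \<gamma>) / 2" and \<delta>: "\<delta> > 0"
      using \<gamma>(2) by (auto simp: \<delta>_def field_simps max_def)
    obtain L where L: "prob (bad \<gamma> L) < \<delta>"
      using order_tendstoD(2)[OF prob_bad_tendsto_0[OF small[OF \<gamma>(1)]] \<delta>]
      by (auto simp: eventually_sequentially)
    have ev: "eventually (\<lambda>n. ?D * real L / real n < (\<gamma>' - \<gamma>) / 2) sequentially"
      using \<gamma>(2) by (intro order_tendstoD(2)[OF lim_const_over_n]) simp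
    show ?thesis
      using AE_visits_less[OF bad_sets L]
    proof eventually_elim
      case (elim x)
      from elim ev eventually_ge_at_top[of 1]
      have "eventually (\<lambda>n. rate n (p n x) \<le> ereal \<gamma>') sequentially"
      proof eventually_elim
        case (elim n)
        have "?D * (visits f (bad \<gamma> L) n x + real L) \<le> ?D * (real n * \<delta>) + ?D * real L"
          using elim(1) by (simp add: distrib_left mult_left_mono)
        also have "\<dots> \<le> real n * ((\<gamma>' - \<gamma>) / 2) + real n * ((\<gamma>' - \<gamma>) / 2)"
        proof (rule add_mono)
          show "?D * (real n * \<delta>) \<le> real n * ((\<gamma>' - \<gamma>) / 2)"
            using mult_left_mono[OF D, of "real n"] by (simp add: mult.left_commute)
          show "?D * real L \<le> real n * ((\<gamma>' - \<gamma>) / 2)"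
            using elim(2,3) by (simp add: divide_less_eq mult.commute)
        qed
        finally have "real n * \<gamma> + ?D * (visits f (bad \<gamma> L) n x + real L) \<le> real n * \<gamma>'"
          by (simp add: field_simps)
        then have "p n x \<le> exp (real n * \<gamma>')"
          using cover_bound[of n x \<gamma> L] by (meson exp_le_cancel_iff order_trans)
        then show ?case using elim(3) p_nonneg by (subst rate_le_iff) auto
      qed
      then show ?case by (rule Limsup_bounded)
    qed
  qed
  then have "AE x in M. \<forall>q::rat. c < ereal (of_rat q) \<longrightarrow> limsup (\<lambda>n. rate n (p n x)) \<le> ereal (of_rat q)"
    by (simp add: AE_all_countable)
  with c have lim: "AE x in M. (\<lambda>n. rate n (p n x)) \<longlonglongrightarrow> c"
  proof eventually_elim
    case (elim x)
    have "limsup (\<lambda>n. rate n (p n x)) \<le> c"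
    proof (rule ccontr)
      assume "\<not> ?thesis"
      then obtain q where "c < ereal (real_of_rat q)" "ereal (real_of_rat q) < limsup (\<lambda>n. rate n (p n x))"
        using ereal_dense3[of c] by (auto simp: not_le)
      then show False using elim(2) by (meson not_le)
    qed
    moreover have "liminf (\<lambda>n. rate n (p n x)) = c" using elim(1) by (simp add: lower_rate_def)
    moreover have "liminf (\<lambda>n. rate n (p n x)) \<le> limsup (\<lambda>n. rate n (p n x))"
      by (rule Liminf_le_Limsup) simp
    ultimately show ?case
      by (subst tendsto_iff_Liminf_eq_Limsup) auto
  qed
  have "ereal \<beta> \<le> c" if \<beta>: "\<And>n T. n \<ge> 1 \<Longrightarrow> real n * \<beta> \<le> (LINT x|M. ln (max (p n x) (exp T)))" for \<beta>
  proof (rule ccontr)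
    assume "\<not> ?thesis"
    then obtain \<gamma> where \<gamma>: "c < ereal \<gamma>" "\<gamma> < \<beta>" using ereal_dense2[of c "ereal \<beta>"] by (auto simp: not_le)
    \<comment> \<open>The hypothesis holds at every truncation level, so the level may depend on
      \<open>n\<close>; at \<open>n * \<gamma>\<close> the truncated logarithm still obeys the upper
      bound from \<open>cover_bound\<close>.\<close>
    have "\<beta> \<le> \<gamma>"
    proof (rule le_of_integral_bound[OF small[OF \<gamma>(1)], where h = "\<lambda>n x. ln (max (p n x) (exp (real n * \<gamma>)))"])
      show "integrable M (\<lambda>x. ln (max (p n x) (exp (real n * \<gamma>))))" for n
      proof (rule integrable_const_bound[of _ "\<bar>real n * \<gamma>\<bar> + \<bar>real n * C\<bar>"])
        show "AE x in M. norm (ln (max (p n x) (exp (real n * \<gamma>)))) \<le> \<bar>real n * \<gamma>\<bar> + \<bar>real n * C\<bar>"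
        proof (rule AE_I2)
          fix x
          have "real n * \<gamma> \<le> ln (max (p n x) (exp (real n * \<gamma>)))"
            by (subst ln_exp[symmetric], subst ln_le_cancel_iff) (auto simp: less_max_iff_disj)
          moreover have "max (p n x) (exp (real n * \<gamma>)) \<le> exp (max (real n * C) (real n * \<gamma>))"
            using p_bound[of n x] by (auto simp: max_def intro: order_trans)
          then have "ln (max (p n x) (exp (real n * \<gamma>))) \<le> ln (exp (max (real n * C) (real n * \<gamma>)))"
            by (subst ln_le_cancel_iff) (auto simp: less_max_iff_disj)
          ultimately show "norm (ln (max (p n x) (exp (real n * \<gamma>)))) \<le> \<bar>real n * \<gamma>\<bar> + \<bar>real n * C\<bar>"
            by simp
        qed
      qed measurable
    qed (use \<beta> in auto)
    with \<gamma>(2) show False by simp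
  qed
  then show thesis using c_le lim by (intro that[of c]) auto
qed

end

section \<open>The Riesz representation theorem\<close>

lemma continuous_separation:
  fixes U :: "'m::t2_space set"
  assumes comp: "compact (UNIV :: 'm set)" and U: "open U" "x \<in> U"
  obtains \<psi> :: "'m \<Rightarrow> real" where "continuous_on UNIV \<psi>" "\<And>y. 0 \<le> \<psi> y" "\<psi> x > 0" "\<And>y. y \<notin> U \<Longrightarrow> \<psi> y = 0"
proof -
  have "Hausdorff_space (euclidean :: 'm topology)"
    unfolding Hausdorff_space_def by (simp add: disjnt_def) (metis hausdorff)
  moreover have "compact_space (euclidean :: 'm topology)"
    using comp by (simp add: compact_space_def)
  ultimately have n: "normal_space (euclidean :: 'm topology)"
    using compact_Hausdorff_or_regular_imp_normal_space by blast
  obtain \<psi> where "continuous_map (euclidean :: 'm topology) euclideanreal \<psi>" "\<psi> ` {x} \<subseteq> {1}" "\<psi> ` (- U) \<subseteq> {0::real}"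
    by (rule Urysohn_lemma_alt[OF n, of "{x}" "- U" 1 0]) (use U in \<open>auto simp: disjnt_def\<close>)
  then show thesis
    by (intro that[of "\<lambda>y. \<bar>\<psi> y\<bar>"]) (auto simp: continuous_map_iff_continuous2 intro!: continuous_intros)
qed

lemma continuous_bounded:
  fixes \<phi> :: "'m::topological_space \<Rightarrow> real"
  assumes "compact (UNIV :: 'm set)" "continuous_on UNIV \<phi>"
  obtains B where "\<And>x. \<bar>\<phi> x\<bar> \<le> B"
proof -
  have "bounded (\<phi> ` UNIV)"
    using assms by (intro compact_imp_bounded compact_continuous_image)
  then show thesis using that by (auto simp: bounded_real)
qed

text \<open>These open sets come with continuous functions \<open>min 1 (k \<psi>)\<close> that
  increase to their indicators, which links measures of sets to values on continuous
  functions.\<close>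

definition cozero_sets :: "'m::topological_space set set" where
  "cozero_sets = {{x. \<psi> x > (0::real)} | \<psi>. continuous_on UNIV \<psi> \<and> (\<forall>x. 0 \<le> \<psi> x)}"

lemma cozero_sets_open: "U \<in> cozero_sets \<Longrightarrow> open U"
  by (auto simp: cozero_sets_def intro!: open_Collect_less continuous_on_const)

text \<open>Urysohn functions write an open set as a union of cozero sets, and the Lindeloef
  property makes the union countable.\<close>

lemma borel_eq_sigma_cozero:
  assumes "compact (UNIV :: 'm::{t2_space, second_countable_topology} set)"
  shows "sets (borel :: 'm measure) = sigma_sets UNIV cozero_sets"
  unfolding sets_borel
proof (rule sigma_sets_eqI)
  fix U :: "'m set" assume "U \<in> {S. open S}"
  then have U: "open U" by simp
  define F where "F = {V \<in> cozero_sets. V \<subseteq> U}"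
  have "\<Union>F = U"
  proof
    show "U \<subseteq> \<Union>F"
    proof
      fix x assume "x \<in> U"
      with continuous_separation[OF assms U] obtain \<psi> :: "'m \<Rightarrow> real" where
        \<psi>: "continuous_on UNIV \<psi>" "\<And>y. 0 \<le> \<psi> y" "\<psi> x > 0" "\<And>y. y \<notin> U \<Longrightarrow> \<psi> y = 0"
        by blast
      then have "{y. \<psi> y > 0} \<in> cozero_sets" by (auto simp: cozero_sets_def)
      moreover have "{y. \<psi> y > 0} \<subseteq> U" using \<psi>(4) by force
      ultimately show "x \<in> \<Union>F" using \<psi>(3) by (auto simp: F_def)
    qed
  qed (auto simp: F_def)
  moreover obtain F' where F': "F' \<subseteq> F" "countable F'" "\<Union>F' = \<Union>F"
    using Lindelof[of F] cozero_sets_open by (auto simp: F_def)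
  moreover have "\<Union>F' \<in> sigma_sets UNIV cozero_sets"
    using F' by (intro sigma_sets_UNION) (auto simp: F_def)
  ultimately show "U \<in> sigma_sets UNIV cozero_sets" by simp
qed (auto dest: cozero_sets_open)

text \<open>Cozero sets are stable under intersection and generate the Borel sets; dominated
  convergence along \<open>min 1 (k \<psi>)\<close> recovers their measures from integrals.\<close>

lemma measure_eq_of_integral_continuous:
  fixes M N :: "'m::{t2_space, second_countable_topology} measure"
  assumes comp: "compact (UNIV :: 'm set)" and M: "prob_space M" "sets M = sets borel"
    and N: "prob_space N" "sets N = sets borel"
    and eq: "\<And>\<phi> :: 'm \<Rightarrow> real. continuous_on UNIV \<phi> \<Longrightarrow> (LINT x|M. \<phi> x) = (LINT x|N. \<phi> x)"
  shows "M = N"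
proof (rule measure_eqI_generator_eq[where E = "cozero_sets :: 'm set set" and \<Omega> = UNIV and A = "\<lambda>_. UNIV"])
  interpret M: prob_space M by fact
  interpret N: prob_space N by fact
  show "Int_stable (cozero_sets :: 'm set set)"
  proof (rule Int_stableI)
    fix a b :: "'m set" assume "a \<in> cozero_sets" "b \<in> cozero_sets"
    then obtain \<phi> \<psi> :: "'m \<Rightarrow> real" where *: "a = {x. \<phi> x > 0}" "b = {x. \<psi> x > 0}" "continuous_on UNIV \<phi>"
      "continuous_on UNIV \<psi>" "\<forall>x. 0 \<le> \<phi> x" "\<forall>x. 0 \<le> \<psi> x"
      by (auto simp: cozero_sets_def)
    then have "a \<inter> b = {x. min (\<phi> x) (\<psi> x) > 0}" by auto
    moreover have "continuous_on UNIV (\<lambda>x. min (\<phi> x) (\<psi> x))" "\<forall>x. 0 \<le> min (\<phi> x) (\<psi> x)"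
      using * by (auto intro: continuous_on_min)
    ultimately show "a \<inter> b \<in> cozero_sets"
      unfolding cozero_sets_def mem_Collect_eq by (intro exI[of _ "\<lambda>x. min (\<phi> x) (\<psi> x)"] conjI)
  qed
  show "emeasure M X = emeasure N X" if X: "X \<in> cozero_sets" for X
  proof -
    obtain \<psi> :: "'m \<Rightarrow> real" where \<psi>: "X = {x. \<psi> x > 0}" "continuous_on UNIV \<psi>" "\<And>x. 0 \<le> \<psi> x"
      using X by (auto simp: cozero_sets_def)
    have [measurable]: "X \<in> sets borel" using cozero_sets_open[OF X] by simp
    define h where "h k x = min 1 (real k * \<psi> x)" for k x
    have h: "continuous_on UNIV (h k)" "0 \<le> h k x" "h k x \<le> 1" for k x
      using \<psi> by (auto simp: h_def intro!: continuous_intros)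
    have [measurable]: "h k \<in> borel_measurable borel" for k
      using h(1) by (rule borel_measurable_continuous_onI)
    have lim: "(\<lambda>k. h k x) \<longlonglongrightarrow> indicator X x" for x
    proof (cases "x \<in> X")
      case True
      then obtain k0 where k0: "1 < real k0 * \<psi> x"
        using reals_Archimedean3[of "\<psi> x"] \<psi>(1) by auto
      have "h k x = 1" if "k \<ge> k0" for k
      proof -
        have "real k0 * \<psi> x \<le> real k * \<psi> x" using that \<psi>(3) by (intro mult_right_mono) auto
        then show ?thesis using k0 by (simp add: h_def)
      qed
      then show ?thesis using True by (intro tendsto_eventually) (auto simp: eventually_sequentially)
    next
      case False
      then have "\<psi> x = 0" using \<psi>(1) \<psi>(3)[of x] by (auto intro: order_antisym simp: not_less)
      then show ?thesis using False by (simp add: h_def)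
    qed
    have "(\<lambda>k. LINT x|P. h k x) \<longlonglongrightarrow> (LINT x|P. indicator X x)"
      if P: "prob_space P" "sets P = sets borel" for P
    proof -
      interpret prob_space P by fact
      have [measurable_cong]: "sets P = sets borel" by fact
      show ?thesis
        by (rule integral_dominated_convergence[where w = "\<lambda>_. 1"]) (use lim h in auto)
    qed
    from this[OF M] this[OF N] have "(LINT x|M. indicator X x :: real) = (LINT x|N. indicator X x)"
      using eq[OF h(1)] by (auto intro: LIMSEQ_unique)
    then have "measure M X = measure N X" using M N by simp
    then show ?thesis by (simp add: M.emeasure_eq_measure N.emeasure_eq_measure)
  qed
  show "sets M = sigma_sets UNIV cozero_sets" "sets N = sigma_sets UNIV cozero_sets"
    using M N borel_eq_sigma_cozero[OF comp] by auto
  show "range (\<lambda>_::nat. UNIV :: 'm set) \<subseteq> cozero_sets"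
    by (auto simp: cozero_sets_def intro!: exI[of _ "\<lambda>_. 1"])
  show "emeasure M UNIV \<noteq> \<infinity>" by (simp add: M.emeasure_eq_measure)
qed auto

lemma suminf_half_ennreal: "(\<Sum>i. ennreal ((1/2) ^ Suc i)) = 1"
proof -
  have "(\<Sum>i. ennreal ((1/2) ^ Suc i)) = ennreal 1"
    by (rule suminf_ennreal_eq[OF _ power_half_series]) simp
  then show ?thesis by (simp only: ennreal_1)
qed

section \<open>The outer measure of a positive functional\<close>

locale positive_functional =
  fixes \<Lambda> :: "('m::{t2_space, second_countable_topology} \<Rightarrow> real) \<Rightarrow> real"
  assumes comp: "compact (UNIV :: 'm set)"
    and add: "\<And>\<phi> \<psi>. continuous_on UNIV \<phi> \<Longrightarrow> continuous_on UNIV \<psi> \<Longrightarrow> \<Lambda> (\<lambda>x. \<phi> x + \<psi> x) = \<Lambda> \<phi> + \<Lambda> \<psi>"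
    and scale: "\<And>c \<phi>. continuous_on UNIV \<phi> \<Longrightarrow> \<Lambda> (\<lambda>x. c * \<phi> x) = c * \<Lambda> \<phi>"
    and nonneg: "\<And>\<phi>. continuous_on UNIV \<phi> \<Longrightarrow> (\<And>x. 0 \<le> \<phi> x) \<Longrightarrow> 0 \<le> \<Lambda> \<phi>"
    and one: "\<Lambda> (\<lambda>_. 1) = 1"
begin

lemma const: "\<Lambda> (\<lambda>_. c) = c"
  using scale[of "\<lambda>_. 1" c] one by simp

lemma diff:
  assumes "continuous_on UNIV \<phi>" "continuous_on UNIV \<psi>"
  shows "\<Lambda> (\<lambda>x. \<phi> x - \<psi> x) = \<Lambda> \<phi> - \<Lambda> \<psi>"
  using add[OF assms(1), of "\<lambda>x. - 1 * \<psi> x"] scale[OF assms(2), of "-1"] assms(2)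
  by (simp add: continuous_on_minus)

lemma mono:
  assumes "continuous_on UNIV \<phi>" "continuous_on UNIV \<psi>" "\<And>x. \<phi> x \<le> \<psi> x"
  shows "\<Lambda> \<phi> \<le> \<Lambda> \<psi>"
  using nonneg[of "\<lambda>x. \<psi> x - \<phi> x"] diff[OF assms(2,1)] assms by (simp add: continuous_on_diff)

lemma sum:
  assumes "\<And>i. i \<in> I \<Longrightarrow> continuous_on UNIV (\<phi> i)"
  shows "\<Lambda> (\<lambda>x. \<Sum>i\<in>I. \<phi> i x) = (\<Sum>i\<in>I. \<Lambda> (\<phi> i))"
  using assms
proof (induction I rule: infinite_finite_induct)
  case (insert i I)
  then show ?case using add[of "\<phi> i" "\<lambda>x. \<Sum>i\<in>I. \<phi> i x"] by (simp add: continuous_on_sum)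
qed (simp_all add: const)

text \<open>Daniell's construction: a set is covered by countably many nonnegative continuous
  functions instead of open sets. The sums are taken in \<open>ennreal\<close> since they may
  diverge.\<close>

definition covers :: "'m set \<Rightarrow> (nat \<Rightarrow> 'm \<Rightarrow> real) \<Rightarrow> bool" where
  "covers A \<phi> \<longleftrightarrow> (\<forall>n. continuous_on UNIV (\<phi> n)) \<and> (\<forall>n x. 0 \<le> \<phi> n x) \<and> (\<forall>x\<in>A. 1 \<le> (\<Sum>n. ennreal (\<phi> n x)))"

definition outer :: "'m set \<Rightarrow> ennreal" where
  "outer A = (INF \<phi>\<in>{\<phi>. covers A \<phi>}. \<Sum>n. ennreal (\<Lambda> (\<phi> n)))"

lemma outer_le: "covers A \<phi> \<Longrightarrow> outer A \<le> (\<Sum>n. ennreal (\<Lambda> (\<phi> n)))"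
  unfolding outer_def by (rule INF_lower) simp

lemma outer_mono: "A \<subseteq> B \<Longrightarrow> outer A \<le> outer B"
  unfolding outer_def by (rule INF_superset_mono) (auto simp: covers_def subset_iff)

lemma outer_le_single:
  assumes \<phi>: "continuous_on UNIV \<phi>" "\<And>x. 0 \<le> \<phi> x" and A: "\<And>x. x \<in> A \<Longrightarrow> 1 \<le> \<phi> x"
  shows "outer A \<le> ennreal (\<Lambda> \<phi>)"
proof -
  let ?\<phi> = "\<lambda>n::nat. if n = 0 then \<phi> else (\<lambda>_. 0)"
  have s: "(\<Sum>n. ennreal (?\<phi> n x)) = ennreal (\<phi> x)" for x
    by (subst suminf_finite[of "{0}"]) auto
  have "covers A ?\<phi>"
    unfolding covers_def s using \<phi> A by (auto intro!: ennreal_leI[of 1, simplified])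
  from outer_le[OF this] have "outer A \<le> (\<Sum>n. ennreal (\<Lambda> (?\<phi> n)))" .
  also have "\<dots> = ennreal (\<Lambda> \<phi>)"
    by (subst suminf_finite[of "{0}"]) (auto simp: const)
  finally show ?thesis .
qed

lemma outer_empty: "outer {} = 0"
  using outer_le_single[of "\<lambda>_. 0" "{}"] by (simp add: const)

text \<open>Flattening by a pairing function allows doubly indexed covers, as they arise from
  countable unions and from splitting every function of a cover into a telescoping series.\<close>

lemma covers_double:
  assumes "\<And>i n. continuous_on UNIV (\<phi> i n)" "\<And>i n x. 0 \<le> \<phi> i n x"
    and "\<And>x. x \<in> A \<Longrightarrow> 1 \<le> (\<Sum>i. \<Sum>n. ennreal (\<phi> i n x))"
  shows "outer A \<le> (\<Sum>i. \<Sum>n. ennreal (\<Lambda> (\<phi> i n)))"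
proof -
  let ?\<psi> = "\<lambda>k. case prod_decode k of (i, n) \<Rightarrow> \<phi> i n"
  have s: "(\<Sum>k. F (prod_decode k)) = (\<Sum>i. \<Sum>n. F (i, n))" for F :: "nat \<times> nat \<Rightarrow> ennreal"
    by (rule suminf_ennreal_2dimen) simp
  have 1: "(\<Sum>k. ennreal (?\<psi> k x)) = (\<Sum>i. \<Sum>n. ennreal (\<phi> i n x))" for x
    using s[of "\<lambda>(i, n). ennreal (\<phi> i n x)"] by (simp add: case_prod_unfold)
  have 2: "(\<Sum>k. ennreal (\<Lambda> (?\<psi> k))) = (\<Sum>i. \<Sum>n. ennreal (\<Lambda> (\<phi> i n)))"
    using s[of "\<lambda>(i, n). ennreal (\<Lambda> (\<phi> i n))"] by (simp add: case_prod_unfold)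
  have "covers A ?\<psi>"
    unfolding covers_def 1 using assms by (auto simp: case_prod_unfold)
  from outer_le[OF this] show ?thesis unfolding 2 .
qed

lemma exists_cover:
  assumes "outer A < top" "0 < \<epsilon>"
  obtains \<phi> where "covers A \<phi>" "(\<Sum>n. ennreal (\<Lambda> (\<phi> n))) \<le> outer A + ennreal \<epsilon>"
proof -
  have "outer A < outer A + ennreal \<epsilon>" using assms
    by (cases "outer A") (auto simp: ennreal_plus[symmetric] ennreal_less_iff simp del: ennreal_plus)
  then obtain \<phi> where "covers A \<phi>" "(\<Sum>n. ennreal (\<Lambda> (\<phi> n))) < outer A + ennreal \<epsilon>"
    unfolding outer_def[of A] by (subst (asm) INF_less_iff) auto
  then show thesis by (intro that[of \<phi>]) auto
qed

lemma outer_le_1: "outer A \<le> 1"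
  using outer_le_single[of "\<lambda>_. 1" A] by (simp add: const)

lemma outer_countable_subadditive: "outer (\<Union>i. A i) \<le> (\<Sum>i. outer (A i))"
proof (rule ennreal_le_epsilon)
  fix \<epsilon> :: real assume \<epsilon>: "0 < \<epsilon>"
  have "outer (A i) < top" for i using outer_le_1[of "A i"] by (simp add: le_less_trans)
  then have "\<forall>i. \<exists>\<phi>. covers (A i) \<phi> \<and> (\<Sum>n. ennreal (\<Lambda> (\<phi> n))) \<le> outer (A i) + ennreal (\<epsilon> * (1/2) ^ Suc i)"
    using exists_cover \<epsilon> by (metis mult_pos_pos zero_less_power half_gt_zero zero_less_one)
  then obtain \<phi> where \<phi>: "\<And>i. covers (A i) (\<phi> i)"
    "\<And>i. (\<Sum>n. ennreal (\<Lambda> (\<phi> i n))) \<le> outer (A i) + ennreal (\<epsilon> * (1/2) ^ Suc i)"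
    by metis
  have "outer (\<Union>i. A i) \<le> (\<Sum>i. \<Sum>n. ennreal (\<Lambda> (\<phi> i n)))"
  proof (rule covers_double)
    fix x assume "x \<in> (\<Union>i. A i)"
    then obtain i where "x \<in> A i" by auto
    then have "1 \<le> (\<Sum>n. ennreal (\<phi> i n x))" using \<phi>(1) by (auto simp: covers_def)
    also have "\<dots> \<le> (\<Sum>i. \<Sum>n. ennreal (\<phi> i n x))"
      using sum_le_suminf[of "\<lambda>i. \<Sum>n. ennreal (\<phi> i n x)" "{i}"] by simp
    finally show "1 \<le> (\<Sum>i. \<Sum>n. ennreal (\<phi> i n x))" .
  qed (use \<phi>(1) in \<open>auto simp: covers_def\<close>)
  also have "\<dots> \<le> (\<Sum>i. outer (A i) + ennreal (\<epsilon> * (1/2) ^ Suc i))"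
    by (intro suminf_le \<phi>(2)) auto
  also have "\<dots> = (\<Sum>i. outer (A i)) + (\<Sum>i. ennreal (\<epsilon> * (1/2) ^ Suc i))"
    by (rule suminf_add[symmetric]) simp_all
  also have "(\<lambda>i. ennreal (\<epsilon> * (1/2) ^ Suc i)) = (\<lambda>i. ennreal \<epsilon> * ennreal ((1/2) ^ Suc i))"
    using \<epsilon> by (intro ext ennreal_mult) auto
  also have "(\<Sum>i. ennreal \<epsilon> * ennreal ((1/2) ^ Suc i)) = ennreal \<epsilon>"
    by (simp only: ennreal_suminf_cmult suminf_half_ennreal mult_1_right)
  finally show "outer (\<Union>i. A i) \<le> (\<Sum>i. outer (A i)) + ennreal \<epsilon>" .
qed

text \<open>The open sets on which the partial sums of a cover exceed \<open>1 - \<epsilon>\<close>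
  exhaust the space. By compactness one partial sum exceeds \<open>1 - \<epsilon>\<close>
  everywhere, and positivity carries this over to \<Lambda>.\<close>

lemma outer_UNIV: "outer UNIV = 1"
proof (rule antisym[OF outer_le_1])
  show "1 \<le> outer UNIV"
    unfolding outer_def
  proof (rule INF_greatest, simp)
    fix \<phi> assume \<phi>: "covers UNIV \<phi>"
    note \<phi>' = \<phi>[unfolded covers_def, THEN conjunct1, rule_format]
      \<phi>[unfolded covers_def, THEN conjunct2, THEN conjunct1, rule_format]
    show "1 \<le> (\<Sum>n. ennreal (\<Lambda> (\<phi> n)))"
    proof (rule ennreal_le_epsilon)
      fix \<epsilon> :: real assume \<epsilon>: "0 < \<epsilon>"
      define V where "V N = {x. 1 - \<epsilon> < (\<Sum>n<N. \<phi> n x)}" for N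
      have V: "open (V N)" for N
        unfolding V_def using \<phi>' by (intro open_Collect_less continuous_intros) auto
      have "UNIV \<subseteq> (\<Union>N. V N)"
      proof
        fix x
        have "ennreal (1 - \<epsilon>) < 1" using \<epsilon> by (simp add: ennreal_less_one_iff)
        also have "1 \<le> (\<Sum>n. ennreal (\<phi> n x))" using \<phi> by (auto simp: covers_def)
        finally have "ennreal (1 - \<epsilon>) < (SUP N. \<Sum>n<N. ennreal (\<phi> n x))" by (simp add: suminf_eq_SUP)
        then obtain N where "ennreal (1 - \<epsilon>) < (\<Sum>n<N. ennreal (\<phi> n x))" by (auto simp: less_SUP_iff)
        then have "1 - \<epsilon> < (\<Sum>n<N. \<phi> n x)"
          using \<phi>'(2) by (subst (asm) sum_ennreal) (auto simp: ennreal_less_iff sum_nonneg not_le[symmetric] intro: ennreal_leI)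
        then show "x \<in> (\<Union>N. V N)" by (auto simp: V_def)
      qed
      then obtain I where I: "finite I" "UNIV \<subseteq> (\<Union>N\<in>I. V N)"
        using compactE_image[OF comp, of UNIV V] V by auto
      define N where "N = Max (insert 0 I)"
      have "1 - \<epsilon> \<le> (\<Sum>n<N. \<phi> n x)" for x
      proof -
        obtain k where k: "k \<in> I" "x \<in> V k" using I by auto
        then have "k \<le> N" using I(1) by (simp add: N_def)
        then have "(\<Sum>n<k. \<phi> n x) \<le> (\<Sum>n<N. \<phi> n x)" using \<phi>'(2) by (intro sum_mono2) auto
        with k(2) show ?thesis by (simp add: V_def)
      qed
      then have "\<Lambda> (\<lambda>_. 1 - \<epsilon>) \<le> \<Lambda> (\<lambda>x. \<Sum>n<N. \<phi> n x)"
        using \<phi>' by (intro mono continuous_intros) auto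
      then have "1 - \<epsilon> \<le> (\<Sum>n<N. \<Lambda> (\<phi> n))" using \<phi>' by (simp add: const sum)
      then have "ennreal 1 \<le> ennreal ((\<Sum>n<N. \<Lambda> (\<phi> n)) + \<epsilon>)" by (intro ennreal_leI) simp
      also have "\<dots> = (\<Sum>n<N. ennreal (\<Lambda> (\<phi> n))) + ennreal \<epsilon>"
        using \<phi>' nonneg \<epsilon> by (simp add: ennreal_plus sum_nonneg sum_ennreal)
      also have "\<dots> \<le> (\<Sum>n. ennreal (\<Lambda> (\<phi> n))) + ennreal \<epsilon>"
        by (intro add_right_mono sum_le_suminf) auto
      finally show "1 \<le> (\<Sum>n. ennreal (\<Lambda> (\<phi> n))) + ennreal \<epsilon>" by simp
    qed
  qed
qed

text \<open>The functions \<open>min 1 (K \<psi>)\<close> increase to the indicator of \<open>U\<close>: a cover of \<open>T\<close> splits into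
  the telescoped pieces, which cover \<open>T \<inter> U\<close>, and remainders, which cover \<open>T - U\<close>.\<close>

lemma outer_split_cozero:
  fixes \<psi> :: "'m \<Rightarrow> real"
  assumes \<psi>: "continuous_on UNIV \<psi>" "\<And>x. 0 \<le> \<psi> x" and U: "U = {x. \<psi> x > 0}"
  shows "outer (U \<inter> T) + outer ((UNIV - U) \<inter> T) \<le> outer T"
proof (rule ennreal_le_epsilon)
  fix \<epsilon>' :: real assume \<epsilon>': "0 < \<epsilon>'"
  \<comment> \<open>One half is spent on the choice of the cover, the other on cutting off the
    telescoping series.\<close>
  define \<epsilon> where "\<epsilon> = \<epsilon>' / 2"
  have \<epsilon>: "0 < \<epsilon>" using \<epsilon>' by (simp add: \<epsilon>_def)
  have "outer T < top" using outer_le_1[of T] by (simp add: le_less_trans)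
  then obtain \<phi> where \<phi>: "covers T \<phi>" "(\<Sum>n. ennreal (\<Lambda> (\<phi> n))) \<le> outer T + ennreal \<epsilon>"
    using exists_cover \<epsilon> by blast
  note \<phi>' = \<phi>(1)[unfolded covers_def, THEN conjunct1, rule_format]
    \<phi>(1)[unfolded covers_def, THEN conjunct2, THEN conjunct1, rule_format]
  define h where "h K x = min 1 (real K * \<psi> x)" for K x
  have h: "continuous_on UNIV (h K)" "0 \<le> h K x" "h K x \<le> 1" "h K x \<le> h (Suc K) x" "h 0 x = 0" for K x
    using \<psi> mult_right_mono[of "real K" "real (Suc K)" "\<psi> x"]
    by (auto simp: h_def intro!: continuous_intros)
  have cont: "continuous_on UNIV (\<lambda>x. \<phi> n x * h K x)" for n K
    using \<phi>' h by (intro continuous_intros) auto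
  define a where "a n K = \<Lambda> (\<lambda>x. \<phi> n x * h K x)" for n K
  have a: "0 \<le> a n K" "a n K \<le> \<Lambda> (\<phi> n)" for n K
    unfolding a_def using \<phi>' h
    by (auto intro!: nonneg mono cont mult_left_le)
  \<comment> \<open>The values \<open>a n\<close> are bounded, so some \<open>K\<close> comes within
    the allotted error of their supremum. Continuity of \<Lambda> along increasing sequences is not
    at hand yet, and this choice takes its place.\<close>
  have "\<exists>K. \<forall>K'. a n K' \<le> a n K + \<epsilon> * (1/2) ^ Suc n" for n
  proof -
    have bdd: "bdd_above (range (a n))" using a(2) by (intro bdd_aboveI[of _ "\<Lambda> (\<phi> n)"]) auto
    have "Sup (range (a n)) - \<epsilon> * (1/2) ^ Suc n < Sup (range (a n))" using \<epsilon> by simp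
    then obtain K where "Sup (range (a n)) - \<epsilon> * (1/2) ^ Suc n < a n K"
      using less_cSup_iff[OF _ bdd] by blast
    moreover have "a n K' \<le> Sup (range (a n))" for K' using bdd by (intro cSup_upper) auto
    ultimately show ?thesis by (intro exI[of _ K] allI) (smt (verit))
  qed
  then obtain K where K: "\<And>n K'. a n K' \<le> a n (K n) + \<epsilon> * (1/2) ^ Suc n" by metis
  have in_le: "outer (U \<inter> T) \<le> (\<Sum>n. ennreal (a n (K n) + \<epsilon> * (1/2) ^ Suc n))"
  proof -
    \<comment> \<open>On \<open>U\<close> the increments of \<open>\<phi> n * h k\<close> in
      \<open>k\<close> sum to \<open>\<phi> n\<close>, because \<open>h 0\<close> vanishes and
      \<open>h k x\<close> is eventually \<open>1\<close>.\<close>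
    define \<eta> where "\<eta> n k = (\<lambda>x. \<phi> n x * h (Suc k) x - \<phi> n x * h k x)" for n k
    have \<eta>: "continuous_on UNIV (\<eta> n k)" "0 \<le> \<eta> n k x" for n k x
      unfolding \<eta>_def using \<phi>' h cont by (auto intro!: continuous_intros mult_left_mono)
    have \<Lambda>\<eta>: "\<Lambda> (\<eta> n k) = a n (Suc k) - a n k" for n k
      unfolding \<eta>_def a_def by (rule diff[OF cont cont])
    have "outer (U \<inter> T) \<le> (\<Sum>n. \<Sum>k. ennreal (\<Lambda> (\<eta> n k)))"
    proof (rule covers_double[OF \<eta>])
      fix x assume x: "x \<in> U \<inter> T"
      have "(\<Sum>k. ennreal (\<eta> n k x)) = ennreal (\<phi> n x)" for n
      proof (rule suminf_ennreal_eq[OF \<eta>(2)])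
        obtain k0 where k0: "1 < real k0 * \<psi> x" using reals_Archimedean3[of "\<psi> x"] x U by auto
        have "h k x = 1" if "k \<ge> k0" for k
        proof -
          have "real k0 * \<psi> x \<le> real k * \<psi> x" using that \<psi>(2) by (intro mult_right_mono) auto
          then show ?thesis using k0 by (simp add: h_def)
        qed
        then have "(\<lambda>k. \<phi> n x * h k x) \<longlonglongrightarrow> \<phi> n x"
          by (intro tendsto_eventually) (auto simp: eventually_sequentially)
        from telescope_sums[OF this] show "(\<lambda>k. \<eta> n k x) sums \<phi> n x" by (simp add: \<eta>_def h(5))
      qed
      then show "1 \<le> (\<Sum>n. \<Sum>k. ennreal (\<eta> n k x))" using \<phi>(1) x by (simp add: covers_def)
    qed
    also have "\<dots> \<le> (\<Sum>n. ennreal (a n (K n) + \<epsilon> * (1/2) ^ Suc n))"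
    proof (intro suminf_le suminf_le_const)
      fix n m
      have "(\<Sum>k<m. ennreal (\<Lambda> (\<eta> n k))) = ennreal (\<Sum>k<m. \<Lambda> (\<eta> n k))"
        using nonneg[OF \<eta>] by (intro sum_ennreal) auto
      also have "(\<Sum>k<m. \<Lambda> (\<eta> n k)) = a n m - a n 0"
        unfolding \<Lambda>\<eta> by (rule sum_lessThan_telescope)
      also have "\<dots> \<le> a n (K n) + \<epsilon> * (1/2) ^ Suc n" using K[of n m] a(1)[of n 0] by simp
      finally show "(\<Sum>k<m. ennreal (\<Lambda> (\<eta> n k))) \<le> ennreal (a n (K n) + \<epsilon> * (1/2) ^ Suc n)"
        by (simp add: ennreal_leI)
    qed auto
    finally show ?thesis .
  qed
  have out_le: "outer ((UNIV - U) \<inter> T) \<le> (\<Sum>n. ennreal (\<Lambda> (\<phi> n) - a n (K n)))"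
  proof -
    let ?\<phi> = "\<lambda>n x. \<phi> n x - \<phi> n x * h (K n) x"
    have "covers ((UNIV - U) \<inter> T) ?\<phi>"
      unfolding covers_def
    proof (intro conjI allI ballI)
      fix x assume x: "x \<in> (UNIV - U) \<inter> T"
      then have "\<psi> x = 0" using U \<psi>(2)[of x] by (auto simp: not_less intro: order_antisym)
      then have "?\<phi> n x = \<phi> n x" for n by (simp add: h_def)
      then have "(\<Sum>n. ennreal (?\<phi> n x)) = (\<Sum>n. ennreal (\<phi> n x))" by (simp only:)
      then show "1 \<le> (\<Sum>n. ennreal (?\<phi> n x))" using x \<phi>(1) by (simp only: covers_def) blast
    qed (use \<phi>' cont h in \<open>auto intro!: continuous_intros mult_left_le\<close>)
    from outer_le[OF this] show ?thesis unfolding a_def diff[OF \<phi>'(1) cont] .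
  qed
  have "outer (U \<inter> T) + outer ((UNIV - U) \<inter> T) \<le>
      (\<Sum>n. ennreal (a n (K n) + \<epsilon> * (1/2) ^ Suc n)) + (\<Sum>n. ennreal (\<Lambda> (\<phi> n) - a n (K n)))"
    by (rule add_mono[OF in_le out_le])
  also have "\<dots> = (\<Sum>n. ennreal (\<Lambda> (\<phi> n)) + ennreal \<epsilon> * ennreal ((1/2) ^ Suc n))"
  proof (subst suminf_add, simp, simp, rule arg_cong[where f = suminf], rule ext)
    fix n
    show "ennreal (a n (K n) + \<epsilon> * (1/2) ^ Suc n) + ennreal (\<Lambda> (\<phi> n) - a n (K n)) =
        ennreal (\<Lambda> (\<phi> n)) + ennreal \<epsilon> * ennreal ((1/2) ^ Suc n)"
    proof -
      have "ennreal (a n (K n) + \<epsilon> * (1/2) ^ Suc n) + ennreal (\<Lambda> (\<phi> n) - a n (K n)) =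
          ennreal ((a n (K n) + \<epsilon> * (1/2) ^ Suc n) + (\<Lambda> (\<phi> n) - a n (K n)))"
        using a[of n "K n"] \<epsilon> by (intro ennreal_plus[symmetric]) auto
      also have "\<dots> = ennreal (\<Lambda> (\<phi> n) + \<epsilon> * (1/2) ^ Suc n)" by (simp add: add.commute)
      also have "\<dots> = ennreal (\<Lambda> (\<phi> n)) + ennreal (\<epsilon> * (1/2) ^ Suc n)"
        using \<epsilon> nonneg[OF \<phi>'] by (intro ennreal_plus) auto
      also have "ennreal (\<epsilon> * (1/2) ^ Suc n) = ennreal \<epsilon> * ennreal ((1/2) ^ Suc n)"
        using \<epsilon> by (intro ennreal_mult) auto
      finally show ?thesis .
    qed
  qed
  also have "\<dots> = (\<Sum>n. ennreal (\<Lambda> (\<phi> n))) + (\<Sum>n. ennreal \<epsilon> * ennreal ((1/2) ^ Suc n))"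
    by (subst suminf_add) auto
  also have "(\<Sum>n. ennreal \<epsilon> * ennreal ((1/2) ^ Suc n)) = ennreal \<epsilon>"
    by (simp only: ennreal_suminf_cmult suminf_half_ennreal mult_1_right)
  also have "(\<Sum>n. ennreal (\<Lambda> (\<phi> n))) + ennreal \<epsilon> \<le> (outer T + ennreal \<epsilon>) + ennreal \<epsilon>"
    by (intro add_right_mono \<phi>(2))
  also have "\<dots> = outer T + ennreal \<epsilon>'"
    using \<epsilon> by (simp add: add.assoc ennreal_plus[symmetric] \<epsilon>_def del: ennreal_plus)
  finally show "outer (U \<inter> T) + outer ((UNIV - U) \<inter> T) \<le> outer T + ennreal \<epsilon>'" .
qed

text \<open>Caratheodory's theorem: \<open>outer\<close> is a measure on the sets that split every
  set additively. By \<open>outer_split_cozero\<close> these include the cozero sets, hence all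
  Borel sets.\<close>

lemma measure_space_outer: "measure_space UNIV (sets (borel :: 'm measure)) outer"
proof -
  interpret P: sigma_algebra UNIV "Pow (UNIV :: 'm set)" by (rule sigma_algebra_Pow)
  have om: "outer_measure_space (Pow UNIV) outer"
    unfolding outer_measure_space_def positive_def increasing_def countably_subadditive_def
    using outer_empty outer_mono outer_countable_subadditive by auto
  define L where "L = lambda_system (UNIV :: 'm set) (Pow UNIV) outer"
  have L: "measure_space UNIV L outer"
    unfolding L_def by (rule P.caratheodory_lemma[OF om])
  then have sL: "sigma_algebra UNIV L" by (simp add: measure_space_def)
  have "cozero_sets \<subseteq> L"
  proof
    fix U :: "'m set" assume "U \<in> cozero_sets"
    then obtain \<psi> :: "'m \<Rightarrow> real" where \<psi>: "U = {x. \<psi> x > 0}" "continuous_on UNIV \<psi>" "\<And>x. 0 \<le> \<psi> x"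
      by (auto simp: cozero_sets_def)
    have "outer T \<le> outer (U \<inter> T) + outer ((UNIV - U) \<inter> T)" for T
    proof -
      have sub: "subadditive (Pow UNIV) outer"
        using om by (intro P.countably_subadditive_subadditive) (auto simp: outer_measure_space_def)
      have "outer ((U \<inter> T) \<union> ((UNIV - U) \<inter> T)) \<le> outer (U \<inter> T) + outer ((UNIV - U) \<inter> T)"
        by (rule subadditiveD[OF sub]) auto
      moreover have "(U \<inter> T) \<union> ((UNIV - U) \<inter> T) = T" by auto
      ultimately show ?thesis by simp
    qed
    with outer_split_cozero[OF \<psi>(2,3,1)] show "U \<in> L"
      by (auto simp: L_def lambda_system_def intro!: antisym)
  qed
  then have "sets (borel :: 'm measure) \<subseteq> L"
    unfolding borel_eq_sigma_cozero[OF comp] by (rule sigma_algebra.sigma_sets_subset[OF sL])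
  moreover have "sigma_algebra UNIV (sets (borel :: 'm measure))"
    using sets.sigma_algebra_axioms[of "borel :: 'm measure"] by simp
  ultimately show ?thesis
    using L by (auto simp: measure_space_def countably_additive_def positive_def)
qed

section \<open>The representing measure\<close>

definition representing :: "'m measure" where
  "representing = measure_of UNIV (sets borel) outer"

lemma sets_representing [measurable_cong]: "sets representing = sets borel"
  using sets.sigma_sets_eq[of "borel :: 'm measure"] by (simp add: representing_def sets.space_closed)

lemma emeasure_representing: "A \<in> sets borel \<Longrightarrow> emeasure representing A = outer A"
  using measure_space_outer unfolding representing_def
  by (intro emeasure_measure_of_sigma) (auto simp: measure_space_def)

lemma prob_space_representing: "prob_space representing"
proof
  have "space representing = UNIV" using sets_eq_imp_space_eq[OF sets_representing] by simp
  then show "emeasure representing (space representing) = 1"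
    by (simp add: emeasure_representing outer_UNIV)
qed

lemma measure_representing_le:
  assumes "A \<in> sets borel" "continuous_on UNIV \<phi>" "\<And>x. 0 \<le> \<phi> x" "\<And>x. x \<in> A \<Longrightarrow> 1 \<le> \<phi> x"
  shows "measure representing A \<le> \<Lambda> \<phi>"
proof -
  have "emeasure representing A \<le> ennreal (\<Lambda> \<phi>)"
    using outer_le_single[OF assms(2-4)] emeasure_representing[OF assms(1)] by simp
  then show ?thesis
    unfolding measure_def using nonneg[OF assms(2,3)] by (rule enn2real_leI[rotated])
qed

lemma integrable_representing:
  assumes "continuous_on UNIV (\<phi> :: 'm \<Rightarrow> real)"
  shows "integrable representing \<phi>"
proof -
  interpret prob_space representing by (rule prob_space_representing)
  obtain B where B: "\<And>x. \<bar>\<phi> x\<bar> \<le> B"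
    using continuous_bounded[OF comp assms] by blast
  have [measurable]: "\<phi> \<in> borel_measurable borel" using assms by (rule borel_measurable_continuous_onI)
  show ?thesis by (rule integrable_const_bound[of _ B]) (use B in auto)
qed

text \<open>Slice \<open>N * \<phi>\<close> into layers \<open>s j\<close> of height one. The layer
  \<open>j + 1\<close> lives where \<open>N * \<phi> \<ge> j + 1\<close>, and there the layer
  \<open>j\<close> equals \<open>1\<close>, so its integral is at most
  \<open>\<Lambda> (s j)\<close>. The shift by one layer leaves the bottom one, with integral at
  most \<open>1\<close>; this error disappears after division by \<open>N\<close>.\<close>

lemma integral_representing_le:
  assumes \<phi>: "continuous_on UNIV \<phi>" "\<And>x. 0 \<le> \<phi> x"
  shows "(LINT x|representing. \<phi> x) \<le> \<Lambda> \<phi>"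
proof -
  interpret prob_space representing by (rule prob_space_representing)
  obtain B where B: "\<And>x. \<bar>\<phi> x\<bar> \<le> B"
    using continuous_bounded[OF comp \<phi>(1)] by blast
  have *: "real N * (LINT x|representing. \<phi> x) \<le> 1 + real N * \<Lambda> \<phi>" for N
  proof -
    define s where "s j x = min 1 (max 0 (real N * \<phi> x - real j))" for j x
    have s: "continuous_on UNIV (s j)" "0 \<le> s j x" "s j x \<le> 1" for j x
      using \<phi> by (auto simp: s_def intro!: continuous_intros)
    obtain J where J: "real N * B \<le> real J" using real_arch_simple by blast
    have "(\<Sum>j<J. s j x) = min (real N * \<phi> x) (real J)" for J x
    proof (induction J)
      case (Suc J)
      then show ?case by (auto simp: s_def)
    qed (use \<phi>(2) in simp)
    moreover have "real N * \<phi> x \<le> real J" for x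
      using J order_trans[OF mult_left_mono[of "\<phi> x" B "real N"] J] B[of x] by (simp add: abs_le_iff)
    ultimately have sum_s: "(\<Sum>j<J. s j x) = real N * \<phi> x" for x by simp
    have step: "(LINT x|representing. s (Suc j) x) \<le> \<Lambda> (s j)" for j
    proof -
      define A where "A = {x. real (Suc j) \<le> real N * \<phi> x}"
      have "closed A" unfolding A_def using \<phi> by (intro closed_Collect_le continuous_intros)
      then have [measurable]: "A \<in> sets borel" by simp
      have "(LINT x|representing. s (Suc j) x) \<le> (LINT x|representing. indicator A x)"
      proof (rule integral_mono[OF integrable_representing[OF s(1)]])
        show "integrable representing (indicator A :: 'm \<Rightarrow> real)"
          by (rule integrable_const_bound[of _ 1]) auto
      qed (auto simp: s_def indicator_def A_def)
      also have "\<dots> = measure representing A"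
        using sets_eq_imp_space_eq[OF sets_representing] by simp
      also have "\<dots> \<le> \<Lambda> (s j)"
      proof (rule measure_representing_le[OF _ s(1,2)])
        show "1 \<le> s j x" if "x \<in> A" for x using that by (simp add: s_def A_def)
      qed measurable
      finally show ?thesis .
    qed
    have "real N * (LINT x|representing. \<phi> x) = (LINT x|representing. (\<Sum>j<J. s j x))"
      by (simp add: sum_s)
    also have "\<dots> = (\<Sum>j<J. LINT x|representing. s j x)"
      by (intro Bochner_Integration.integral_sum integrable_representing s)
    also have "\<dots> \<le> 1 + (\<Sum>j<J. \<Lambda> (s j))"
    proof (cases J)
      case (Suc J')
      have "(LINT x|representing. s 0 x) \<le> (LINT x|representing. 1)"
        by (intro integral_mono integrable_representing s) (auto simp: s)
      then have "(LINT x|representing. s 0 x) \<le> 1" by (simp add: prob_space)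
      moreover have "(\<Sum>j<J'. LINT x|representing. s (Suc j) x) \<le> (\<Sum>j<J'. \<Lambda> (s j))"
        by (intro sum_mono step)
      moreover have "0 \<le> \<Lambda> (s J')" by (intro nonneg s)
      ultimately show ?thesis
        unfolding Suc sum.lessThan_Suc_shift[of "\<lambda>j. LINT x|representing. s j x"] by simp
    qed simp
    also have "(\<Sum>j<J. \<Lambda> (s j)) = \<Lambda> (\<lambda>x. \<Sum>j<J. s j x)" by (rule sum[symmetric]) (rule s)
    also have "\<dots> = real N * \<Lambda> \<phi>" by (simp add: sum_s scale[OF \<phi>(1)])
    finally show ?thesis .
  qed
  show ?thesis
  proof (rule ccontr)
    assume "\<not> ?thesis"
    then have "0 < (LINT x|representing. \<phi> x) - \<Lambda> \<phi>" by simp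
    then obtain N where "1 < real N * ((LINT x|representing. \<phi> x) - \<Lambda> \<phi>)"
      using reals_Archimedean3 by blast
    with *[of N] show False by (simp add: algebra_simps)
  qed
qed

text \<open>The one-sided estimate is applied to the nonnegative functions \<open>B - \<phi>\<close>
  and \<open>\<phi> + B\<close>.\<close>

theorem integral_representing:
  assumes \<phi>: "continuous_on UNIV \<phi>"
  shows "(LINT x|representing. \<phi> x) = \<Lambda> \<phi>"
proof -
  interpret prob_space representing by (rule prob_space_representing)
  obtain B where B: "\<And>x. \<bar>\<phi> x\<bar> \<le> B"
    using continuous_bounded[OF comp \<phi>(1)] by blast
  note i = integrable_representing[OF \<phi>]
  have "(LINT x|representing. B - \<phi> x) \<le> \<Lambda> (\<lambda>x. B - \<phi> x)"
    using B \<phi> by (intro integral_representing_le continuous_intros) (auto simp: abs_le_iff)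
  moreover have "(LINT x|representing. \<phi> x - (- B)) \<le> \<Lambda> (\<lambda>x. \<phi> x - (- B))"
    using B \<phi> by (intro integral_representing_le continuous_intros) (smt (verit))+
  ultimately show ?thesis
    using i by (simp add: diff[OF _ \<phi>] diff[OF \<phi>, of "\<lambda>_. - B", simplified] const prob_space)
qed

end

section \<open>Ergodic measures as extreme states\<close>

text \<open>Functionals are total on all real functions and vanish off the continuous ones. This
  places them in a product space, where compactness is Tychonoff's theorem, and makes two states
  equal as soon as they agree on continuous functions.\<close>

definition states :: "('m::topological_space \<Rightarrow> 'm) \<Rightarrow> (('m \<Rightarrow> real) \<Rightarrow> real) set" where
  "states f = {\<Lambda>.
     (\<forall>\<phi> \<psi>. continuous_on UNIV \<phi> \<and> continuous_on UNIV \<psi> \<longrightarrow> \<Lambda> (\<lambda>x. \<phi> x + \<psi> x) = \<Lambda> \<phi> + \<Lambda> \<psi>) \<and>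
     (\<forall>\<phi> c. continuous_on UNIV \<phi> \<longrightarrow> \<Lambda> (\<lambda>x. c * \<phi> x) = c * \<Lambda> \<phi>) \<and>
     (\<forall>\<phi>. continuous_on UNIV \<phi> \<and> (\<forall>x. 0 \<le> \<phi> x) \<longrightarrow> 0 \<le> \<Lambda> \<phi>) \<and>
     \<Lambda> (\<lambda>_. 1) = 1 \<and>
     (\<forall>\<phi>. continuous_on UNIV \<phi> \<longrightarrow> \<Lambda> (\<lambda>x. \<phi> (f x)) = \<Lambda> \<phi>) \<and>
     (\<forall>\<phi>. \<not> continuous_on UNIV \<phi> \<longrightarrow> \<Lambda> \<phi> = 0)}"

lemma continuous_on_eval: "continuous_on S (\<lambda>\<Lambda>::'a \<Rightarrow> real. \<Lambda> \<phi>)"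
  by (rule continuous_on_subset[OF continuous_on_product_coordinates]) simp

lemma closed_states: "closed (states f)"
  unfolding states_def
  by (intro closed_Collect_conj closed_Collect_all closed_Collect_imp open_Collect_const
      closed_Collect_eq closed_Collect_le continuous_on_eval continuous_intros)

lemma states_positive_functional:
  fixes f :: "'m::{t2_space, second_countable_topology} \<Rightarrow> 'm"
  assumes "compact (UNIV :: 'm set)" "\<Lambda> \<in> states f"
  shows "positive_functional \<Lambda>"
  using assms by unfold_locales (auto simp: states_def)

lemma compact_box: "compact {\<Lambda> :: 'a \<Rightarrow> real. \<forall>\<phi>. \<Lambda> \<phi> \<in> {- b \<phi>..b \<phi>}}"
proof -
  have "compactin (product_topology (\<lambda>_. euclidean) UNIV) (PiE (UNIV :: 'a set) (\<lambda>\<phi>. {- b \<phi>..b \<phi> :: real}))"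
    by (subst compactin_PiE) auto
  then have "compact (PiE (UNIV :: 'a set) (\<lambda>\<phi>. {- b \<phi>..b \<phi>}))"
    by (simp only: euclidean_product_topology compactin_euclidean_iff)
  moreover have "PiE (UNIV :: 'a set) (\<lambda>\<phi>. {- b \<phi>..b \<phi>}) = {\<Lambda>. \<forall>\<phi>. \<Lambda> \<phi> \<in> {- b \<phi>..b \<phi>}}"
    by (auto simp: PiE_def Pi_def)
  ultimately show ?thesis by simp
qed

text \<open>Some bound of the absolute value, not necessarily the least one. The value
  \<open>0\<close> for discontinuous functions matches the convention for states.\<close>

definition sup_bound :: "('m::topological_space \<Rightarrow> real) \<Rightarrow> real" where
  "sup_bound \<phi> = (if continuous_on UNIV \<phi> then SOME B. \<forall>x. \<bar>\<phi> x\<bar> \<le> B else 0)"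

lemma abs_le_sup_bound:
  assumes "compact (UNIV :: 'm::topological_space set)" "continuous_on UNIV (\<phi> :: 'm \<Rightarrow> real)"
  shows "\<bar>\<phi> x\<bar> \<le> sup_bound \<phi>"
proof -
  obtain B where "\<And>x. \<bar>\<phi> x\<bar> \<le> B" using continuous_bounded[OF assms] by blast
  then have "\<exists>B. \<forall>x. \<bar>\<phi> x\<bar> \<le> B" by blast
  from someI_ex[OF this] show ?thesis using assms(2) by (simp add: sup_bound_def)
qed

lemma compact_states:
  fixes f :: "'m::{t2_space, second_countable_topology} \<Rightarrow> 'm"
  assumes comp: "compact (UNIV :: 'm set)"
  shows "compact (states f)"
proof -
  have "states f \<subseteq> {\<Lambda>. \<forall>\<phi>. \<Lambda> \<phi> \<in> {- sup_bound \<phi>..sup_bound \<phi>}}"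
  proof (intro subsetI CollectI allI)
    fix \<Lambda> :: "('m \<Rightarrow> real) \<Rightarrow> real" and \<phi>
    assume \<Lambda>: "\<Lambda> \<in> states f"
    interpret positive_functional \<Lambda> by (rule states_positive_functional[OF comp \<Lambda>])
    show "\<Lambda> \<phi> \<in> {- sup_bound \<phi>..sup_bound \<phi>}"
    proof (cases "continuous_on UNIV \<phi>")
      case True
      have b: "\<phi> x \<le> sup_bound \<phi>" "- sup_bound \<phi> \<le> \<phi> x" for x
        using abs_le_sup_bound[OF comp True, of x] by auto
      show ?thesis
        using mono[of \<phi> "\<lambda>_. sup_bound \<phi>"] mono[of "\<lambda>_. - sup_bound \<phi>" \<phi>] True b
        by (simp add: const)
    next
      case False
      then show ?thesis using \<Lambda> by (simp add: states_def sup_bound_def)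
    qed
  qed
  then show ?thesis
    using closed_Int_compact[OF closed_states[of f] compact_box[of sup_bound]]
    by (simp add: Int_absorb2)
qed

section \<open>Faces and extreme points\<close>

definition face :: "('a \<Rightarrow> real) set \<Rightarrow> ('a \<Rightarrow> real) set \<Rightarrow> bool" where
  "face S F \<longleftrightarrow> F \<subseteq> S \<and> (\<forall>\<Lambda>\<in>F. \<forall>\<Lambda>1\<in>S. \<forall>\<Lambda>2\<in>S. \<forall>t. 0 < t \<and> t < 1 \<and>
     (\<forall>\<phi>. \<Lambda> \<phi> = t * \<Lambda>1 \<phi> + (1 - t) * \<Lambda>2 \<phi>) \<longrightarrow> \<Lambda>1 \<in> F \<and> \<Lambda>2 \<in> F)"

lemma faceD:
  assumes "face S F" "\<Lambda> \<in> F" "\<Lambda>1 \<in> S" "\<Lambda>2 \<in> S" "0 < t" "t < 1" "\<And>\<phi>. \<Lambda> \<phi> = t * \<Lambda>1 \<phi> + (1 - t) * \<Lambda>2 \<phi>"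
  shows "\<Lambda>1 \<in> F" "\<Lambda>2 \<in> F"
proof -
  have "\<Lambda>1 \<in> F \<and> \<Lambda>2 \<in> F"
    by (rule assms(1)[unfolded face_def, THEN conjunct2, THEN bspec, THEN bspec, THEN bspec, THEN spec, THEN mp,
          OF assms(2-4), of t]) (intro conjI allI assms)
  then show "\<Lambda>1 \<in> F" "\<Lambda>2 \<in> F" by auto
qed

lemma face_subset: "face S F \<Longrightarrow> F \<subseteq> S"
  unfolding face_def by (rule conjunct1)

lemma faceI:
  assumes "F \<subseteq> S"
    and "\<And>\<Lambda> \<Lambda>1 \<Lambda>2 t. \<Lambda> \<in> F \<Longrightarrow> \<Lambda>1 \<in> S \<Longrightarrow> \<Lambda>2 \<in> S \<Longrightarrow> 0 < t \<Longrightarrow> t < 1 \<Longrightarrow>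
      (\<And>\<phi>. \<Lambda> \<phi> = t * \<Lambda>1 \<phi> + (1 - t) * \<Lambda>2 \<phi>) \<Longrightarrow> \<Lambda>1 \<in> F \<and> \<Lambda>2 \<in> F"
  shows "face S F"
  unfolding face_def
proof (rule conjI[OF assms(1)], rule ballI, rule ballI, rule ballI, rule allI, rule impI)
  fix \<Lambda> \<Lambda>1 \<Lambda>2 t
  assume *: "\<Lambda> \<in> F" "\<Lambda>1 \<in> S" "\<Lambda>2 \<in> S"
    and t: "0 < t \<and> t < 1 \<and> (\<forall>\<phi>. \<Lambda> \<phi> = t * \<Lambda>1 \<phi> + (1 - t) * \<Lambda>2 \<phi>)"
  show "\<Lambda>1 \<in> F \<and> \<Lambda>2 \<in> F"
    by (rule assms(2)[OF * t[THEN conjunct1] t[THEN conjunct2, THEN conjunct1]])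
      (rule t[THEN conjunct2, THEN conjunct2, rule_format])
qed

text \<open>A proper convex combination of two numbers bounded by \<open>s\<close> equals
  \<open>s\<close> only if both do.\<close>

lemma face_maximizers:
  assumes F: "face S F" and s: "\<And>\<Lambda>. \<Lambda> \<in> F \<Longrightarrow> \<Lambda> \<phi> \<le> s"
  shows "face S {\<Lambda> \<in> F. \<Lambda> \<phi> = s}"
proof (rule faceI)
  show "{\<Lambda> \<in> F. \<Lambda> \<phi> = s} \<subseteq> S" using face_subset[OF F] by auto
  fix \<Lambda> \<Lambda>1 \<Lambda>2 t
  assume \<Lambda>: "\<Lambda> \<in> {\<Lambda> \<in> F. \<Lambda> \<phi> = s}" and S: "\<Lambda>1 \<in> S" "\<Lambda>2 \<in> S" and t: "0 < t" "t < 1"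
    and eq: "\<And>\<phi>. \<Lambda> \<phi> = t * \<Lambda>1 \<phi> + (1 - t) * \<Lambda>2 \<phi>"
  have \<Lambda>F: "\<Lambda> \<in> F" "\<Lambda> \<phi> = s" using \<Lambda> by auto
  note in_F = faceD[OF F \<Lambda>F(1) S t eq]
  have "t * (s - \<Lambda>1 \<phi>) + (1 - t) * (s - \<Lambda>2 \<phi>) = 0"
    using eq[of \<phi>] \<Lambda>F(2) by (simp add: algebra_simps)
  moreover have "0 \<le> t * (s - \<Lambda>1 \<phi>)" "0 \<le> (1 - t) * (s - \<Lambda>2 \<phi>)"
    using s[OF in_F(1)] s[OF in_F(2)] t by auto
  ultimately have "t * (s - \<Lambda>1 \<phi>) = 0" "(1 - t) * (s - \<Lambda>2 \<phi>) = 0" by linarith+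
  then have "\<Lambda>1 \<phi> = s" "\<Lambda>2 \<phi> = s" using t by simp_all
  then show "\<Lambda>1 \<in> {\<Lambda> \<in> F. \<Lambda> \<phi> = s} \<and> \<Lambda>2 \<in> {\<Lambda> \<in> F. \<Lambda> \<phi> = s}" using in_F by simp
qed

text \<open>The Krein-Milman argument; \<open>face S {\<Lambda>}\<close> says that \<Lambda> is an
  extreme point of \<open>S\<close>. In a minimal nonempty closed face the maximizers of any
  evaluation form a closed face again. Hence every evaluation is constant on it, and the face is a
  single point.\<close>

lemma exists_extreme_point_of_face:
  fixes S E :: "('a \<Rightarrow> real) set"
  assumes S: "compact S" and E: "closed E" "E \<noteq> {}" "face S E"
  obtains \<Lambda> where "\<Lambda> \<in> E" "face S {\<Lambda>}"
proof -
  \<comment> \<open>Zorn's lemma yields maximal elements, so faces are replaced by their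
    complements.\<close>
  define \<A> where "\<A> = {- F | F. closed F \<and> F \<noteq> {} \<and> F \<subseteq> E \<and> face S F}"
  have "\<exists>M\<in>\<A>. \<forall>X\<in>\<A>. M \<subseteq> X \<longrightarrow> X = M"
  proof (rule subset_Zorn_nonempty)
    show "\<A> \<noteq> {}" using E by (auto simp: \<A>_def)
    fix \<C> assume \<C>: "\<C> \<noteq> {}" "subset.chain \<A> \<C>"
    define \<F> where "\<F> = uminus ` \<C>"
    have \<F>: "closed F" "F \<noteq> {}" "F \<subseteq> E" "face S F" if "F \<in> \<F>" for F
      using that \<C>(2) by (auto simp: \<F>_def \<A>_def subset.chain_def)
    have chain: "F \<subseteq> G \<or> G \<subseteq> F" if "F \<in> \<F>" "G \<in> \<F>" for F G
      using that \<C>(2) by (auto simp: \<F>_def subset.chain_def)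
    have ne: "\<F> \<noteq> {}" using \<C>(1) by (simp add: \<F>_def)
    have eq: "\<Union>\<C> = - \<Inter>\<F>" by (auto simp: \<F>_def)
    \<comment> \<open>The finite intersection property: a finite subfamily of a chain has a least
      member, and this is nonempty.\<close>
    have "S \<inter> \<Inter>\<F> \<noteq> {}"
    proof (rule compact_imp_fip[OF S])
      fix F' assume F': "finite F'" "F' \<subseteq> \<F>"
      show "S \<inter> \<Inter>F' \<noteq> {}"
      proof (cases "F' = {}")
        case True
        then show ?thesis using E(2) face_subset[OF E(3)] by auto
      next
        case False
        have "\<exists>F\<in>F'. \<forall>G\<in>F'. F \<subseteq> G"
          using F'(1) False F'(2)
        proof (induction F' rule: finite_ne_induct)
          case (insert G F')
          then obtain F where F: "F \<in> F'" "\<forall>H\<in>F'. F \<subseteq> H" by auto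
          have "F \<subseteq> G \<or> G \<subseteq> F" using chain insert.prems F by auto
          then show ?case using F by (elim disjE) (blast, blast)
        qed auto
        then obtain F where F: "F \<in> F'" "F \<subseteq> \<Inter>F'" by blast
        then have "F \<noteq> {}" "F \<subseteq> S" using \<F>(2)[of F] face_subset[OF \<F>(4)[of F]] F'(2) by auto
        then show ?thesis using F(2) by blast
      qed
    qed (use \<F> in auto)
    moreover have "face S (\<Inter>\<F>)"
    proof (rule faceI)
      show "\<Inter>\<F> \<subseteq> S" using ne face_subset[OF \<F>(4)] by auto
      fix \<Lambda> \<Lambda>1 \<Lambda>2 t
      assume *: "\<Lambda> \<in> \<Inter>\<F>" "\<Lambda>1 \<in> S" "\<Lambda>2 \<in> S" "0 < t" "t < 1" "\<And>\<phi>. \<Lambda> \<phi> = t * \<Lambda>1 \<phi> + (1 - t) * \<Lambda>2 \<phi>"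
      have "\<Lambda>1 \<in> F \<and> \<Lambda>2 \<in> F" if "F \<in> \<F>" for F
      proof -
        have "\<Lambda> \<in> F" using *(1) that by simp
        from faceD[OF \<F>(4)[OF that] this *(2-6)] show ?thesis by simp
      qed
      then show "\<Lambda>1 \<in> \<Inter>\<F> \<and> \<Lambda>2 \<in> \<Inter>\<F>" by simp
    qed
    moreover have "closed (\<Inter>\<F>)" using \<F>(1) by (intro closed_Inter) auto
    moreover have "\<Inter>\<F> \<subseteq> E" using ne \<F>(3) by blast
    ultimately show "\<Union>\<C> \<in> \<A>"
      unfolding \<A>_def eq by blast
  qed
  then obtain M where M: "M \<in> \<A>" "\<And>X. X \<in> \<A> \<Longrightarrow> M \<subseteq> X \<Longrightarrow> X = M" by blast
  obtain F where MF: "M = - F" and F: "closed F" "F \<noteq> {}" "F \<subseteq> E" "face S F"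
    using M(1) unfolding \<A>_def by blast
  have min: "G = F" if "closed G" "G \<noteq> {}" "G \<subseteq> E" "face S G" "G \<subseteq> F" for G
  proof -
    have "- G \<in> \<A>" using that unfolding \<A>_def by blast
    from M(2)[OF this] have "- G = - F" using that(5) unfolding MF by (simp add: Compl_subset_Compl_iff)
    then show ?thesis by (simp only: compl_eq_compl_iff)
  qed
  obtain \<Lambda> where \<Lambda>: "\<Lambda> \<in> F" using F(2) by auto
  have "\<Lambda>' = \<Lambda>" if \<Lambda>': "\<Lambda>' \<in> F" for \<Lambda>'
  proof
    fix \<phi>
    have "compact F"
    proof -
      have "F = F \<inter> S" using face_subset[OF F(4)] by auto
      then show ?thesis using closed_Int_compact[OF F(1) S] by simp
    qed
    then obtain \<Lambda>m where \<Lambda>m: "\<Lambda>m \<in> F" "\<forall>\<Lambda>\<in>F. \<Lambda> \<phi> \<le> \<Lambda>m \<phi>"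
      using continuous_attains_sup[OF _ F(2) continuous_on_eval[of F \<phi>]] by blast
    define G where "G = {\<Lambda> \<in> F. \<Lambda> \<phi> = \<Lambda>m \<phi>}"
    have "face S G" unfolding G_def by (rule face_maximizers[OF F(4)]) (use \<Lambda>m in auto)
    moreover have "closed G"
    proof -
      have "G = F \<inter> {\<Lambda>. \<Lambda> \<phi> = \<Lambda>m \<phi>}" by (auto simp: G_def)
      then show ?thesis using F(1) by (auto intro!: closed_Int closed_Collect_eq continuous_on_eval)
    qed
    moreover have "G \<noteq> {}" "G \<subseteq> F" using \<Lambda>m by (auto simp: G_def)
    ultimately have "G = F" using F(3) by (intro min) auto
    then have "\<Lambda> \<in> G" "\<Lambda>' \<in> G" using \<Lambda> \<Lambda>' by simp_all
    then show "\<Lambda>' \<phi> = \<Lambda> \<phi>" by (simp add: G_def)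
  qed
  then have "F = {\<Lambda>}" using \<Lambda> by blast
  then show thesis using that[of \<Lambda>] F(3,4) by simp
qed

section \<open>From extreme states to ergodic measures\<close>

lemma state_of_invariant_measure:
  fixes f :: "'m::{t2_space, second_countable_topology} \<Rightarrow> 'm"
  assumes comp: "compact (UNIV :: 'm set)" and f: "continuous_on UNIV f"
    and N: "prob_space N" "sets N = sets borel" "distr N N f = N"
  shows "(\<lambda>\<phi>. if continuous_on UNIV \<phi> then LINT x|N. \<phi> x else 0) \<in> states f"
proof -
  interpret prob_space N by fact
  have [measurable_cong]: "sets N = sets borel" by fact
  have [measurable]: "\<phi> \<in> borel_measurable borel" if "continuous_on UNIV \<phi>" for \<phi> :: "'m \<Rightarrow> real"
    using that by (rule borel_measurable_continuous_onI)
  have [measurable]: "f \<in> measurable borel borel" using f by (rule borel_measurable_continuous_onI)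
  have int: "integrable N \<phi>" if \<phi>: "continuous_on UNIV \<phi>" for \<phi> :: "'m \<Rightarrow> real"
  proof -
    obtain B where "\<And>x. \<bar>\<phi> x\<bar> \<le> B" using continuous_bounded[OF comp \<phi>] by blast
    then show ?thesis using \<phi> by (intro integrable_const_bound[of _ B]) auto
  qed
  have inv: "(LINT x|N. \<phi> (f x)) = (LINT x|N. \<phi> x)" if \<phi>: "continuous_on UNIV \<phi>" for \<phi> :: "'m \<Rightarrow> real"
  proof -
    have "(LINT x|N. \<phi> x) = (LINT x|distr N N f. \<phi> x)" using N(3) by simp
    also have "\<dots> = (LINT x|N. \<phi> (f x))" using \<phi> by (intro integral_distr) auto
    finally show ?thesis by simp
  qed
  have comp_f: "continuous_on UNIV (\<lambda>x. \<phi> (f x))" if "continuous_on UNIV \<phi>" for \<phi> :: "'m \<Rightarrow> real"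
    using continuous_on_compose2[OF that f] by simp
  show ?thesis
    unfolding states_def
    by (auto simp: int inv comp_f continuous_on_add continuous_on_mult_left prob_space)
qed

text \<open>If an invariant set \<open>B\<close> had probability strictly between 0 and 1, the
  measure would be a mixture of its conditional measures on \<open>B\<close> and on the complement,
  both invariant. Extremality makes the first of them equal to the whole measure, although it gives
  the complement mass zero.\<close>

lemma extreme_state_ergodic:
  fixes f :: "'m::{t2_space, second_countable_topology} \<Rightarrow> 'm"
  assumes comp: "compact (UNIV :: 'm set)" and f: "continuous_on UNIV f"
    and ext: "face (states f) {\<Lambda>}"
  obtains M where "ergodic_invariant f M" "\<And>\<phi>. continuous_on UNIV \<phi> \<Longrightarrow> (LINT x|M. \<phi> x) = \<Lambda> \<phi>"
proof -
  have \<Lambda>: "\<Lambda> \<in> states f" using face_subset[OF ext] by simp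
  interpret positive_functional \<Lambda> by (rule states_positive_functional[OF comp \<Lambda>])
  define M where "M = representing"
  have int_M: "(LINT x|M. \<phi> x) = \<Lambda> \<phi>" if "continuous_on UNIV \<phi>" for \<phi>
    using integral_representing[OF that] by (simp add: M_def)
  have sM [measurable_cong]: "sets M = sets borel" by (simp add: M_def sets_representing)
  have spM: "space M = UNIV" using sets_eq_imp_space_eq[OF sM] by simp
  interpret prob_space M unfolding M_def by (rule prob_space_representing)
  have pM: "prob_space M" by unfold_locales
  have fb: "f \<in> measurable borel borel" using f by (rule borel_measurable_continuous_onI)
  then have fM: "f \<in> measurable M M" by measurable
  have inv: "distr M M f = M"
  proof (rule measure_eq_of_integral_continuous[OF comp])
    fix \<phi> :: "'m \<Rightarrow> real" assume \<phi>: "continuous_on UNIV \<phi>"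
    then have [measurable]: "\<phi> \<in> borel_measurable borel" by (rule borel_measurable_continuous_onI)
    have "(LINT x|distr M M f. \<phi> x) = (LINT x|M. \<phi> (f x))"
      using fM by (intro integral_distr) auto
    also have "\<dots> = \<Lambda> (\<lambda>x. \<phi> (f x))"
      using continuous_on_compose2[OF \<phi> f] by (intro int_M) simp
    also have "\<dots> = \<Lambda> \<phi>" using \<Lambda> \<phi> by (simp add: states_def)
    finally show "(LINT x|distr M M f. \<phi> x) = (LINT x|M. \<phi> x)" by (simp add: int_M[OF \<phi>])
  qed (use prob_space_distr[OF fM] sM pM in auto)
  have "prob B = 0 \<or> prob B = 1" if B: "B \<in> sets M" "f -` B = B" for B
  proof (rule ccontr)
    assume "\<not> ?thesis"
    then have b: "0 < prob B" "prob B < 1" using measure_nonneg[of M B] prob_le_1[of B] by (auto simp: less_le)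
    \<comment> \<open>The conditional measure on \<open>A\<close>.\<close>
    define N where "N A = density M (\<lambda>x. ennreal (indicator A x / prob A))" for A
    have N: "prob_space (N A)" "sets (N A) = sets borel" "distr (N A) (N A) f = N A"
        "\<And>D. D \<in> sets borel \<Longrightarrow> emeasure (N A) D = ennreal (prob (A \<inter> D) / prob A)"
        "\<And>\<phi>. continuous_on UNIV \<phi> \<Longrightarrow> prob A * (LINT x|N A. \<phi> x) = (LINT x|M. indicator A x * \<phi> x)"
      if A: "A \<in> sets M" "f -` A = A" "0 < prob A" for A
    proof -
      have [measurable]: "A \<in> sets borel" using A sM by simp
      show s: "sets (N A) = sets borel" by (simp add: N_def sM)
      show e: "emeasure (N A) D = ennreal (prob (A \<inter> D) / prob A)" if "D \<in> sets borel" for D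
      proof -
        have [measurable]: "D \<in> sets borel" by fact
        have "emeasure (N A) D = (\<integral>\<^sup>+x. ennreal (indicator A x / prob A) * indicator D x \<partial>M)"
          unfolding N_def by (rule emeasure_density) measurable
        also have "\<dots> = (\<integral>\<^sup>+x. ennreal (1 / prob A) * indicator (A \<inter> D) x \<partial>M)"
          by (intro nn_integral_cong) (auto simp: indicator_def)
        also have "\<dots> = ennreal (1 / prob A) * emeasure M (A \<inter> D)"
          by (rule nn_integral_cmult_indicator) simp
        also have "\<dots> = ennreal (prob (A \<inter> D) / prob A)"
          using A(3) by (simp add: emeasure_eq_measure ennreal_mult'[symmetric])
        finally show ?thesis .
      qed
      have sp: "space (N A) = UNIV" using sets_eq_imp_space_eq[OF s] by simp
      show "prob_space (N A)"
        by (rule prob_spaceI) (use e[of UNIV] A(3) sp in auto)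
      show "distr (N A) (N A) f = N A"
      proof (rule measure_eqI)
        fix D assume "D \<in> sets (distr (N A) (N A) f)"
        then have D: "D \<in> sets borel" using s by simp
        have fD: "f -` D \<in> sets borel" using measurable_sets[OF fb D] by simp
        have "emeasure (distr (N A) (N A) f) D = emeasure (N A) (f -` D)"
          using D s fb sp by (subst emeasure_distr) (auto cong: measurable_cong_sets)
        also have "\<dots> = ennreal (prob (A \<inter> f -` D) / prob A)" by (rule e[OF fD])
        \<comment> \<open>Invariance of \<open>A\<close> enters here: conditioning on
          \<open>A\<close> commutes with taking preimages.\<close>
        also have "A \<inter> f -` D = f -` (A \<inter> D) \<inter> space M" using A(2) spM by auto
        also have "prob \<dots> = measure (distr M M f) (A \<inter> D)"
          using fM D by (intro measure_distr[symmetric]) auto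
        also have "\<dots> = prob (A \<inter> D)" by (simp add: inv)
        finally show "emeasure (distr (N A) (N A) f) D = emeasure (N A) D" by (simp add: e[OF D])
      qed simp
      show "prob A * (LINT x|N A. \<phi> x) = (LINT x|M. indicator A x * \<phi> x)" if \<phi>: "continuous_on UNIV \<phi>" for \<phi> :: "'m \<Rightarrow> real"
      proof -
        have [measurable]: "\<phi> \<in> borel_measurable borel" using \<phi> by (rule borel_measurable_continuous_onI)
        have "(LINT x|N A. \<phi> x) = (LINT x|M. (indicator A x / prob A) *\<^sub>R \<phi> x)"
          unfolding N_def by (rule integral_density) auto
        also have "\<dots> = (LINT x|M. indicator A x * \<phi> x) / prob A" by simp
        finally show ?thesis using A(3) by simp
      qed
    qed
    let ?B' = "- B"
    have B': "?B' \<in> sets M" "f -` ?B' = ?B'" "prob ?B' = 1 - prob B"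
      using B prob_compl[OF B(1)] spM by (auto simp: Compl_eq_Diff_UNIV vimage_Diff)
    have pB': "0 < prob ?B'" using B'(3) b by simp
    define S where "S A = (\<lambda>\<phi> :: 'm \<Rightarrow> real. if continuous_on UNIV \<phi> then LINT x|N A. \<phi> x else 0)" for A
    have S: "S A \<in> states f" if "A \<in> sets M" "f -` A = A" "0 < prob A" for A
      unfolding S_def by (rule state_of_invariant_measure[OF comp f N(1-3)[OF that]])
    have "\<Lambda> \<phi> = prob B * S B \<phi> + (1 - prob B) * S ?B' \<phi>" for \<phi>
    proof (cases "continuous_on UNIV \<phi>")
      case True
      have [measurable]: "B \<in> sets borel" "\<phi> \<in> borel_measurable borel"
        using B sM True by (auto intro: borel_measurable_continuous_onI)
      obtain K where K: "\<And>x. \<bar>\<phi> x\<bar> \<le> K" using continuous_bounded[OF comp True] by blast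
      have i: "integrable M (\<lambda>x. indicator A x * \<phi> x)" if "A \<in> sets borel" for A
      proof -
        have [measurable]: "A \<in> sets borel" by fact
        show ?thesis by (rule integrable_const_bound[of _ K])
            (use K order_trans[OF abs_ge_zero K] in \<open>auto simp: indicator_def\<close>)
      qed
      have "prob B * S B \<phi> + (1 - prob B) * S ?B' \<phi> = (LINT x|M. indicator B x * \<phi> x) + (LINT x|M. indicator ?B' x * \<phi> x)"
        using N(5)[OF B b(1) True] N(5)[OF B'(1,2) pB' True] True by (simp add: S_def B'(3))
      also have "\<dots> = (LINT x|M. indicator B x * \<phi> x + indicator ?B' x * \<phi> x)"
        by (rule Bochner_Integration.integral_add[symmetric]) (auto intro!: i)
      also have "\<dots> = (LINT x|M. \<phi> x)"
        by (intro Bochner_Integration.integral_cong) (auto simp: indicator_def)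
      finally show ?thesis by (simp add: int_M[OF True])
    next
      case False
      then show ?thesis using \<Lambda> by (simp add: S_def states_def)
    qed
    from faceD(1)[OF ext _ S[OF B b(1)] S[OF B'(1,2) pB'] b this]
    have eq: "S B = \<Lambda>" by simp
    have "N B = M"
    proof (rule measure_eq_of_integral_continuous[OF comp N(1,2)[OF B b(1)] pM sM])
      fix \<phi> :: "'m \<Rightarrow> real" assume \<phi>: "continuous_on UNIV \<phi>"
      then show "(LINT x|N B. \<phi> x) = (LINT x|M. \<phi> x)"
        using fun_cong[OF eq, of \<phi>] by (simp add: S_def int_M)
    qed
    moreover have "emeasure (N B) ?B' = 0"
      using N(4)[OF B b(1), of ?B'] B sM by simp
    ultimately show False using pB' B'(1) by (simp add: emeasure_eq_measure)
  qed
  then have "ergodic_invariant f M"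
    unfolding ergodic_invariant_def using pM sM fM inv by auto
  then show thesis using int_M by (rule that)
qed

section \<open>Invariant states of maximal growth\<close>

lemma states_invariant:
  "\<Lambda> \<in> states f \<Longrightarrow> continuous_on UNIV \<phi> \<Longrightarrow> \<Lambda> (\<lambda>x. \<phi> (f x)) = \<Lambda> \<phi>"
  by (auto simp: states_def)

lemma continuous_on_iterate:
  fixes f :: "'m::topological_space \<Rightarrow> 'm"
  assumes "continuous_on UNIV f"
  shows "continuous_on UNIV (f ^^ n)"
proof (induction n)
  case (Suc n)
  then show ?case using continuous_on_compose2[OF assms, of UNIV "f ^^ n"] by (simp add: o_def)
qed (simp add: continuous_on_id)

section \<open>Truncated logarithms of a continuous cocycle\<close>

locale continuous_cocycle =
  fixes f :: "'m::{t2_space, second_countable_topology} \<Rightarrow> 'm" and p :: "nat \<Rightarrow> 'm \<Rightarrow> real" and C :: real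
  assumes comp: "compact (UNIV :: 'm set)" and f_cont: "continuous_on UNIV f"
    and p_cont: "\<And>n. continuous_on UNIV (p n)"
    and p_nonneg: "\<And>n x. 0 \<le> p n x"
    and p_submult: "\<And>n m x. p (n + m) x \<le> p n x * p m ((f ^^ n) x)"
    and p_bound: "\<And>n x. p n x \<le> exp (real n * C)"
    and C_nonneg: "0 \<le> C"
begin

text \<open>States are evaluated on continuous functions, and log \<open>p\<^sub>n\<close> is none
  where \<open>p\<^sub>n\<close> vanishes. The logarithm is recovered as \<open>T\<close> tends to
  -\<infinity>.\<close>

definition trunc :: "nat \<Rightarrow> real \<Rightarrow> 'm \<Rightarrow> real" where
  "trunc n T x = ln (max (p n x) (exp T))"

lemma exp_trunc: "exp (trunc n T x) = max (p n x) (exp T)"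
  unfolding trunc_def by (rule exp_ln) (simp add: less_max_iff_disj)

lemma trunc_cont: "continuous_on UNIV (trunc n T)"
  unfolding trunc_def[abs_def] using p_cont
  by (intro continuous_on_ln continuous_on_max continuous_on_const) (auto simp: less_max_iff_disj max_def dest: less_imp_neq)

lemma trunc_ge: "T \<le> trunc n T x"
  using exp_trunc[of n T x] by (metis exp_le_cancel_iff max.cobounded2)

lemma p_le_exp_trunc: "p n x \<le> exp (trunc n T x)"
  by (simp add: exp_trunc)

text \<open>Each of the \<open>q\<close> blocks contributes at least \<open>T\<close> on the right,
  so the level on the left has to be scaled to \<open>q * T\<close>.\<close>

lemma max_p_mult_le: "max (p (q * n) x) (exp (real q * T)) \<le> exp (\<Sum>i<q. trunc n T ((f ^^ (i * n)) x))"
proof (induction q arbitrary: x)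
  case 0
  then show ?case using p_bound[of 0 x] by simp
next
  case (Suc q)
  let ?s = "\<lambda>x. \<Sum>i<q. trunc n T ((f ^^ (i * n)) x)"
  have e: "exp (\<Sum>i<Suc q. trunc n T ((f ^^ (i * n)) x)) = exp (trunc n T x) * exp (?s ((f ^^ n) x))"
  proof -
    have "(f ^^ (Suc i * n)) x = (f ^^ (i * n)) ((f ^^ n) x)" for i
    proof -
      have "Suc i * n = i * n + n" by simp
      then show ?thesis by (simp only: funpow_add o_apply)
    qed
    then show ?thesis
      unfolding sum.lessThan_Suc_shift exp_add[symmetric] by (simp del: mult_Suc)
  qed
  have "p (Suc q * n) x \<le> p n x * p (q * n) ((f ^^ n) x)" using p_submult[of n "q * n" x] by simp
  also have "\<dots> \<le> exp (trunc n T x) * exp (?s ((f ^^ n) x))"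
    using Suc[of "(f ^^ n) x"] p_nonneg by (intro mult_mono p_le_exp_trunc) auto
  finally have 1: "p (Suc q * n) x \<le> exp (trunc n T x) * exp (?s ((f ^^ n) x))" .
  have "exp (real (Suc q) * T) = exp T * exp (real q * T)" by (simp add: exp_add[symmetric] algebra_simps)
  also have "\<dots> \<le> exp (trunc n T x) * exp (?s ((f ^^ n) x))"
    using Suc[of "(f ^^ n) x"] trunc_ge[of T n x] by (intro mult_mono) auto
  finally show ?case using 1 unfolding e by simp
qed

lemma trunc_mult_le: "trunc (q * n) (real q * T) x \<le> (\<Sum>i<q. trunc n T ((f ^^ (i * n)) x))"
  using max_p_mult_le[where q = q and n = n and x = x and T = T] by (simp only: exp_trunc[symmetric] exp_le_cancel_iff)

lemma state_iterate:
  assumes "\<Lambda> \<in> states f" "continuous_on UNIV \<phi>"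
  shows "\<Lambda> (\<lambda>x. \<phi> ((f ^^ n) x)) = \<Lambda> \<phi>"
proof (induction n)
  case (Suc n)
  have "continuous_on UNIV (\<lambda>x. \<phi> ((f ^^ n) x))"
    using continuous_on_compose2[OF assms(2) continuous_on_iterate[OF f_cont]] by simp
  from states_invariant[OF assms(1) this] show ?case using Suc by (simp add: funpow_swap1)
qed simp

lemma state_trunc_mult_le:
  assumes \<Lambda>: "\<Lambda> \<in> states f"
  shows "\<Lambda> (trunc (q * n) (real q * T)) \<le> real q * \<Lambda> (trunc n T)"
proof -
  interpret positive_functional \<Lambda> by (rule states_positive_functional[OF comp \<Lambda>])
  have cont: "continuous_on UNIV (\<lambda>x. trunc n T ((f ^^ (i * n)) x))" for i
    using continuous_on_compose2[OF trunc_cont continuous_on_iterate[OF f_cont]] by simp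
  have "\<Lambda> (trunc (q * n) (real q * T)) \<le> \<Lambda> (\<lambda>x. \<Sum>i<q. trunc n T ((f ^^ (i * n)) x))"
    by (intro mono trunc_cont continuous_on_sum cont trunc_mult_le)
  also have "\<dots> = (\<Sum>i<q. \<Lambda> (\<lambda>x. trunc n T ((f ^^ (i * n)) x)))"
    by (rule sum) (rule cont)
  also have "\<dots> = real q * \<Lambda> (trunc n T)" by (simp add: state_iterate[OF \<Lambda> trunc_cont])
  finally show ?thesis .
qed

lemma state_trunc_le:
  assumes \<Lambda>: "\<Lambda> \<in> states f" and "\<And>x. p n x \<le> exp s" "T \<le> s"
  shows "\<Lambda> (trunc n T) \<le> s"
proof -
  interpret positive_functional \<Lambda> by (rule states_positive_functional[OF comp \<Lambda>])
  have "exp (trunc n T x) \<le> exp s" for x using assms(2)[of x] assms(3) by (simp add: exp_trunc)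
  then have "\<Lambda> (trunc n T) \<le> \<Lambda> (\<lambda>_. s)" by (intro mono trunc_cont) auto
  then show ?thesis by (simp add: const)
qed

lemma state_trunc_ge: "\<Lambda> \<in> states f \<Longrightarrow> T \<le> \<Lambda> (trunc n T)"
proof -
  assume \<Lambda>: "\<Lambda> \<in> states f"
  interpret positive_functional \<Lambda> by (rule states_positive_functional[OF comp \<Lambda>])
  have "\<Lambda> (\<lambda>_. T) \<le> \<Lambda> (trunc n T)" by (intro mono trunc_cont trunc_ge) auto
  then show ?thesis by (simp add: const)
qed

text \<open>If one of two invariant states had growth rate below \<open>\<beta>\<close>, iterating would pull the
  rate of the convex combination below \<open>\<beta>\<close>, as no state has a rate above \<open>\<beta>\<close>.\<close>

lemma rate_of_convex_component:
  assumes \<Lambda>: "\<Lambda>1 \<in> states f" "\<Lambda>2 \<in> states f" and t: "0 < t" "t < 1"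
    and upper: "\<And>\<epsilon>. \<epsilon> > 0 \<Longrightarrow> eventually (\<lambda>n. \<forall>x. p n x \<le> exp (real n * (\<beta> + \<epsilon>))) sequentially"
    and conv: "\<And>n T. n \<ge> 1 \<Longrightarrow> real n * \<beta> \<le> t * \<Lambda>1 (trunc n T) + (1 - t) * \<Lambda>2 (trunc n T)"
    and n: "n \<ge> 1"
  shows "real n * \<beta> \<le> \<Lambda>1 (trunc n T)"
proof (rule ccontr)
  assume "\<not> ?thesis"
  then have less: "\<Lambda>1 (trunc n T) < real n * \<beta>" by simp
  define \<delta> where "\<delta> = real n * \<beta> - \<Lambda>1 (trunc n T)"
  have \<delta>: "\<delta> > 0" using less by (simp add: \<delta>_def)
  have T: "T < real n * \<beta>" using less state_trunc_ge[OF \<Lambda>(1), of T n] by simp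
  \<comment> \<open>Per block, \<Lambda>1 loses \<open>t * \<delta>\<close>, while \<Lambda>2 can
    gain at most \<open>(1 - t) * n * \<epsilon>\<close>, which is at most half of that.\<close>
  define \<epsilon> where "\<epsilon> = t * \<delta> / (2 * real n)"
  have \<epsilon>: "\<epsilon> > 0" using t \<delta> n by (simp add: \<epsilon>_def)
  obtain n0 where n0: "\<And>m x. m \<ge> n0 \<Longrightarrow> p m x \<le> exp (real m * (\<beta> + \<epsilon>))"
    using upper[OF \<epsilon>] by (auto simp: eventually_sequentially)
  \<comment> \<open>Large enough that the uniform upper bound is valid at time
    \<open>q * n\<close>.\<close>
  define q where "q = Suc n0"
  have qn: "q * n \<ge> n0" "q * n \<ge> 1" using n by (auto simp: q_def intro: order_trans[of n0 "n0 * n"])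
  have q: "real q > 0" by (simp add: q_def)
  have 1: "\<Lambda>1 (trunc (q * n) (real q * T)) \<le> real q * (real n * \<beta> - \<delta>)"
    using state_trunc_mult_le[OF \<Lambda>(1), of q n T] by (simp add: \<delta>_def)
  have 2: "\<Lambda>2 (trunc (q * n) (real q * T)) \<le> real q * (real n * (\<beta> + \<epsilon>))"
  proof (rule state_trunc_le[OF \<Lambda>(2)])
    show "p (q * n) x \<le> exp (real q * (real n * (\<beta> + \<epsilon>)))" for x
      using n0[OF qn(1), of x] by (simp add: mult.assoc)
    have "T \<le> real n * (\<beta> + \<epsilon>)" using T \<epsilon> n by (simp add: distrib_left add_nonneg_pos less_imp_le add_increasing2)
    then show "real q * T \<le> real q * (real n * (\<beta> + \<epsilon>))" by (intro mult_left_mono) auto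
  qed
  have "real (q * n) * \<beta> \<le> t * \<Lambda>1 (trunc (q * n) (real q * T)) + (1 - t) * \<Lambda>2 (trunc (q * n) (real q * T))"
    by (rule conv[OF qn(2)])
  also have "\<dots> \<le> t * (real q * (real n * \<beta> - \<delta>)) + (1 - t) * (real q * (real n * (\<beta> + \<epsilon>)))"
    using 1 2 t by (intro add_mono mult_left_mono) auto
  also have "\<dots> = real q * (real n * \<beta> - t * \<delta> + (1 - t) * real n * \<epsilon>)" by (simp add: algebra_simps)
  also have "\<dots> < real q * (real n * \<beta>)"
  proof -
    have "(1 - t) * (real n * \<epsilon>) \<le> 1 * (real n * \<epsilon>)" using t \<epsilon> by (intro mult_right_mono) auto
    moreover have "real n * \<epsilon> = t * \<delta> / 2" using n by (simp add: \<epsilon>_def)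
    moreover have "0 < t * \<delta>" using t \<delta> by simp
    ultimately have "real n * \<beta> - t * \<delta> + (1 - t) * real n * \<epsilon> < real n * \<beta>"
      unfolding mult.assoc by linarith
    then show ?thesis using q by (rule mult_strict_left_mono)
  qed
  finally show False by simp
qed

text \<open>The product telescopes along the orbit: increasing \<open>k\<close> by one trades the factor
  \<open>p (k + 1 + m)\<close> for \<open>p m\<close> times the missing factor at \<open>f x\<close>.\<close>

lemma shifted_product_le:
  assumes m: "m \<ge> 1"
  shows "(\<Prod>r<m. p (k + m - r) ((f ^^ r) x)) \<le> exp ((\<Sum>i<k. trunc m T ((f ^^ i) x)) + real m * (real m * C))"
proof (induction k arbitrary: x)
  case 0
  have "(\<Prod>r<m. p (0 + m - r) ((f ^^ r) x)) \<le> (\<Prod>r<m. exp (real m * C))"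
  proof (intro prod_mono conjI p_nonneg)
    fix r assume "r \<in> {..<m}"
    have "real (0 + m - r) * C \<le> real m * C" using C_nonneg by (intro mult_right_mono) auto
    then show "p (0 + m - r) ((f ^^ r) x) \<le> exp (real m * C)"
      using p_bound[of "0 + m - r" "(f ^^ r) x"] by (meson exp_le_cancel_iff order_trans)
  qed
  then show ?case by (simp add: exp_of_nat_mult)
next
  case (Suc k)
  show ?case
  proof -
    obtain m' where m': "m = Suc m'" using m by (cases m) auto
    have s: "(\<Prod>r<m. p (k + m - r) ((f ^^ r) (f x))) =
        (\<Prod>r<m'. p (k + m - r) ((f ^^ r) (f x))) * p (Suc k) ((f ^^ m) x)"
      unfolding m' by (simp add: funpow_swap1)
    have "(\<Prod>r<m. p (Suc k + m - r) ((f ^^ r) x)) =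
        p (Suc k + m) x * (\<Prod>r<m'. p (k + m - r) ((f ^^ r) (f x)))"
      unfolding m' prod.lessThan_Suc_shift by (simp add: funpow_swap1)
    also have "\<dots> \<le> (p m x * p (Suc k) ((f ^^ m) x)) * (\<Prod>r<m'. p (k + m - r) ((f ^^ r) (f x)))"
      using p_submult[of m "Suc k" x] p_nonneg
      by (intro mult_right_mono prod_nonneg) (auto simp: add.commute)
    also have "\<dots> = p m x * (\<Prod>r<m. p (k + m - r) ((f ^^ r) (f x)))"
      unfolding s by (simp add: mult_ac)
    also have "\<dots> \<le> exp (trunc m T x) * exp ((\<Sum>i<k. trunc m T ((f ^^ i) (f x))) + real m * (real m * C))"
      using p_nonneg by (intro mult_mono p_le_exp_trunc Suc.IH prod_nonneg) auto
    also have "\<dots> = exp ((\<Sum>i<Suc k. trunc m T ((f ^^ i) x)) + real m * (real m * C))"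
      unfolding exp_add[symmetric] sum.lessThan_Suc_shift by (simp add: funpow_swap1 add.assoc)
    finally show ?thesis .
  qed
qed

text \<open>For each phase \<open>r < m\<close>, discarding the first \<open>r\<close> steps changes
  \<open>p N x\<close> by at most \<open>exp (m * C)\<close>. Multiplying over all phases and
  applying \<open>shifted_product_le\<close> compares the \<open>m\<close>-th power of
  \<open>p N x\<close> with one block of length \<open>m\<close> at every starting time, that is,
  with a Birkhoff sum.\<close>

lemma trunc_sum_ge:
  assumes m: "m \<ge> 1" and N: "m \<le> N" and big: "exp (real N * \<beta>) \<le> p N x"
  shows "real N * (real m * \<beta>) - (2 * real m * real m * C + \<bar>real m * T\<bar>) \<le> (\<Sum>i<N. trunc m T ((f ^^ i) x))"
proof -
  \<comment> \<open>The error terms: \<open>m * m * C\<close> from the discarded beginnings, again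
    \<open>m * m * C\<close> from \<open>shifted_product_le\<close>, and \<open>m * T\<close> from
    the last \<open>m\<close> summands, each of which is at least \<open>T\<close>.\<close>
  obtain k where k: "N = k + m" using N by (metis add.commute le_Suc_ex)
  have step: "p N x \<le> exp (real m * C) * p (k + m - r) ((f ^^ r) x)" if "r < m" for r
  proof -
    have "p N x \<le> p r x * p (k + m - r) ((f ^^ r) x)" using p_submult[of r "k + m - r" x] that k by simp
    moreover have "p r x \<le> exp (real m * C)"
    proof -
      have "real r * C \<le> real m * C" using C_nonneg that by (intro mult_right_mono) auto
      then show ?thesis using p_bound[of r x] by (meson exp_le_cancel_iff order_trans)
    qed
    ultimately show ?thesis using p_nonneg by (meson mult_right_mono order_trans)
  qed
  have "exp (real m * (real N * \<beta>)) = (\<Prod>r<m. exp (real N * \<beta>))" by (simp add: exp_of_nat_mult)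
  also have "\<dots> \<le> (\<Prod>r<m. exp (real m * C) * p (k + m - r) ((f ^^ r) x))"
    using big step by (intro prod_mono) (auto intro: order_trans)
  also have "\<dots> = exp (real m * (real m * C)) * (\<Prod>r<m. p (k + m - r) ((f ^^ r) x))"
    by (simp add: prod.distrib exp_of_nat_mult)
  also have "\<dots> \<le> exp (real m * (real m * C)) * exp ((\<Sum>i<k. trunc m T ((f ^^ i) x)) + real m * (real m * C))"
    by (intro mult_left_mono shifted_product_le m) auto
  finally have "real m * (real N * \<beta>) \<le> real m * (real m * C) + ((\<Sum>i<k. trunc m T ((f ^^ i) x)) + real m * (real m * C))"
    by (simp only: exp_add[symmetric] exp_le_cancel_iff)
  moreover have "real m * T \<le> (\<Sum>i\<in>{k..<N}. trunc m T ((f ^^ i) x))"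
  proof -
    have "(\<Sum>i\<in>{k..<N}. T) \<le> (\<Sum>i\<in>{k..<N}. trunc m T ((f ^^ i) x))" by (intro sum_mono trunc_ge)
    then show ?thesis using k by simp
  qed
  moreover have "(\<Sum>i<N. trunc m T ((f ^^ i) x)) = (\<Sum>i<k. trunc m T ((f ^^ i) x)) + (\<Sum>i\<in>{k..<N}. trunc m T ((f ^^ i) x))"
  proof -
    have "{..<N} = {..<k} \<union> {k..<N}" using k by auto
    then show ?thesis by (simp add: sum.union_disjoint ivl_disj_int)
  qed
  ultimately show ?thesis by (simp add: algebra_simps)
qed

text \<open>The requirement at all levels \<open>T\<close> expresses that the integral of log
  \<open>p\<^sub>n\<close> is at least \<open>n * \<beta>\<close> by closed conditions on the
  state.\<close>

definition maximizing_states :: "real \<Rightarrow> (('m \<Rightarrow> real) \<Rightarrow> real) set" where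
  "maximizing_states \<beta> = {\<Lambda> \<in> states f. \<forall>n T. n \<ge> 1 \<longrightarrow> real n * \<beta> \<le> \<Lambda> (trunc n T)}"

lemma closed_maximizing_states: "closed (maximizing_states \<beta>)"
proof -
  have cl: "closed {\<Lambda>. \<forall>n T. n \<ge> 1 \<longrightarrow> real n * \<beta> \<le> \<Lambda> (trunc n T)}"
    by (intro closed_Collect_all closed_Collect_imp open_Collect_const closed_Collect_le
        continuous_on_eval continuous_intros)
  have eq: "maximizing_states \<beta> = states f \<inter> {\<Lambda>. \<forall>n T. n \<ge> 1 \<longrightarrow> real n * \<beta> \<le> \<Lambda> (trunc n T)}"
    by (auto simp: maximizing_states_def)
  show ?thesis unfolding eq by (rule closed_Int[OF closed_states cl])
qed

lemma face_maximizing_states: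
  assumes upper: "\<And>\<epsilon>. \<epsilon> > 0 \<Longrightarrow> eventually (\<lambda>n. \<forall>x. p n x \<le> exp (real n * (\<beta> + \<epsilon>))) sequentially"
  shows "face (states f) (maximizing_states \<beta>)"
proof (rule faceI)
  show "maximizing_states \<beta> \<subseteq> states f" by (auto simp: maximizing_states_def)
  fix \<Lambda> \<Lambda>1 \<Lambda>2 and t :: real
  assume \<Lambda>: "\<Lambda> \<in> maximizing_states \<beta>" and s: "\<Lambda>1 \<in> states f" "\<Lambda>2 \<in> states f" and t: "0 < t" "t < 1"
    and eq: "\<And>\<phi>. \<Lambda> \<phi> = t * \<Lambda>1 \<phi> + (1 - t) * \<Lambda>2 \<phi>"
  have conv: "real n * \<beta> \<le> t * \<Lambda>1 (trunc n T) + (1 - t) * \<Lambda>2 (trunc n T)" if "n \<ge> 1" for n T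
    using \<Lambda> that unfolding maximizing_states_def eq[symmetric] by blast
  have conv': "real n * \<beta> \<le> (1 - t) * \<Lambda>2 (trunc n T) + (1 - (1 - t)) * \<Lambda>1 (trunc n T)" if "n \<ge> 1" for n T
    using conv[OF that, of T] by simp
  have "0 < 1 - t" "1 - t < 1" using t by auto
  then show "\<Lambda>1 \<in> maximizing_states \<beta> \<and> \<Lambda>2 \<in> maximizing_states \<beta>"
    unfolding maximizing_states_def
    using rate_of_convex_component[OF s t upper conv] rate_of_convex_component[OF s(2,1) _ _ upper conv'] s
    by simp
qed

text \<open>A Krylov-Bogolyubov construction in which the starting point \<open>x N\<close> changes
  with the length \<open>N\<close> of the orbit segment. The averages \<open>E N\<close> lie in a
  compact box, and closed conditions that they satisfy eventually pass to a cluster point.\<close>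

lemma maximizing_states_nonempty:
  assumes lower: "\<And>n. n \<ge> 1 \<Longrightarrow> \<exists>x. exp (real n * \<beta>) \<le> p n x"
  shows "maximizing_states \<beta> \<noteq> {}"
proof -
  obtain x where x: "\<And>n. n \<ge> 1 \<Longrightarrow> exp (real n * \<beta>) \<le> p n (x n)" using lower by metis
  define E where "E N \<phi> = (if continuous_on UNIV \<phi> then (\<Sum>i<N. \<phi> ((f ^^ i) (x N))) / real N else 0)"
    for N and \<phi> :: "'m \<Rightarrow> real"
  let ?X = "{\<Lambda> :: ('m \<Rightarrow> real) \<Rightarrow> real. \<forall>\<phi>. \<Lambda> \<phi> \<in> {- sup_bound \<phi>..sup_bound \<phi>}}"
  have EX: "E N \<in> ?X" if "N \<ge> 1" for N
  proof (intro CollectI allI)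
    fix \<phi>
    show "E N \<phi> \<in> {- sup_bound \<phi>..sup_bound \<phi>}"
    proof (cases "continuous_on UNIV \<phi>")
      case True
      have "\<bar>\<Sum>i<N. \<phi> ((f ^^ i) (x N))\<bar> \<le> (\<Sum>i<N. \<bar>\<phi> ((f ^^ i) (x N))\<bar>)" by (rule sum_abs)
      also have "\<dots> \<le> (\<Sum>i<N. sup_bound \<phi>)" by (intro sum_mono abs_le_sup_bound[OF comp True])
      finally have "\<bar>E N \<phi>\<bar> \<le> sup_bound \<phi>"
        using that True by (simp add: E_def divide_le_eq mult.commute)
      then show ?thesis by (simp add: abs_le_iff)
    qed (simp add: E_def sup_bound_def)
  qed
  have "filtermap E sequentially \<noteq> bot" by (simp add: filtermap_bot_iff)
  moreover have "eventually (\<lambda>\<Lambda>. \<Lambda> \<in> ?X) (filtermap E sequentially)"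
    unfolding eventually_filtermap using EX by (auto simp: eventually_sequentially intro!: exI[of _ 1])
  \<comment> \<open>A cluster point in terms of filters; the product is indexed by all functions, so
    convergent subsequences cannot be expected.\<close>
  ultimately obtain \<Lambda> where \<Lambda>: "inf (nhds \<Lambda>) (filtermap E sequentially) \<noteq> bot"
    using compact_box[of sup_bound, unfolded compact_filter] by blast
  have lim: "P \<Lambda>" if "closed {\<Lambda>. P \<Lambda>}" "eventually (\<lambda>N. P (E N)) sequentially" for P
  proof (rule ccontr)
    assume "\<not> P \<Lambda>"
    moreover have "open {\<Lambda>. \<not> P \<Lambda>}" using that(1) by (simp add: closed_def Compl_eq)
    ultimately have "eventually (\<lambda>\<Lambda>. \<not> P \<Lambda>) (nhds \<Lambda>)" by (auto simp: eventually_nhds)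
    moreover have "eventually P (filtermap E sequentially)" using that(2) by (simp add: eventually_filtermap)
    ultimately have "eventually (\<lambda>_. False) (inf (nhds \<Lambda>) (filtermap E sequentially))"
      unfolding eventually_inf by (intro exI[of _ "\<lambda>\<Lambda>. \<not> P \<Lambda>"] exI[of _ P]) auto
    then show False using \<Lambda> by (simp add: trivial_limit_def)
  qed
  \<comment> \<open>Averages are invariant up to a telescoping error of order \<open>1 / N\<close>.
    The tolerance \<epsilon> turns this into a closed condition that holds eventually.\<close>
  have inv_approx: "\<bar>\<Lambda> (\<lambda>x. \<phi> (f x)) - \<Lambda> \<phi>\<bar> \<le> \<epsilon>" if \<phi>: "continuous_on UNIV \<phi>" and \<epsilon>: "\<epsilon> > 0"
    for \<phi> :: "'m \<Rightarrow> real" and \<epsilon>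
  proof (rule lim)
    show "closed {\<Lambda>. \<bar>\<Lambda> (\<lambda>x. \<phi> (f x)) - \<Lambda> \<phi>\<bar> \<le> \<epsilon>}"
      by (intro closed_Collect_le continuous_intros continuous_on_eval)
    have \<phi>f: "continuous_on UNIV (\<lambda>x. \<phi> (f x))" using continuous_on_compose2[OF \<phi> f_cont] by simp
    have "(\<lambda>N. (2 * sup_bound \<phi>) / real N) \<longlonglongrightarrow> 0" by (rule lim_const_over_n)
    then have "eventually (\<lambda>N. (2 * sup_bound \<phi>) / real N < \<epsilon>) sequentially"
      using \<epsilon> by (rule order_tendstoD(2))
    then show "eventually (\<lambda>N. \<bar>E N (\<lambda>x. \<phi> (f x)) - E N \<phi>\<bar> \<le> \<epsilon>) sequentially"
      using eventually_ge_at_top[of 1]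
    proof eventually_elim
      case (elim N)
      have "(\<Sum>i<N. \<phi> (f ((f ^^ i) (x N)))) - (\<Sum>i<N. \<phi> ((f ^^ i) (x N))) =
          (\<Sum>i<N. \<phi> ((f ^^ Suc i) (x N)) - \<phi> ((f ^^ i) (x N)))" by (simp add: sum_subtractf)
      also have "\<dots> = \<phi> ((f ^^ N) (x N)) - \<phi> (x N)"
        by (subst sum_lessThan_telescope) simp
      finally have "E N (\<lambda>x. \<phi> (f x)) - E N \<phi> = (\<phi> ((f ^^ N) (x N)) - \<phi> (x N)) / real N"
        using \<phi> \<phi>f by (simp add: E_def diff_divide_distrib[symmetric])
      moreover have "\<bar>\<phi> ((f ^^ N) (x N)) - \<phi> (x N)\<bar> \<le> 2 * sup_bound \<phi>"
        using abs_le_sup_bound[OF comp \<phi>, of "(f ^^ N) (x N)"] abs_le_sup_bound[OF comp \<phi>, of "x N"] by linarith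
      ultimately have "\<bar>E N (\<lambda>x. \<phi> (f x)) - E N \<phi>\<bar> \<le> (2 * sup_bound \<phi>) / real N"
        by (simp add: divide_right_mono)
      with elim(1) show ?case by simp
    qed
  qed
  have "\<Lambda> \<in> states f"
    unfolding states_def
  proof (intro CollectI conjI allI impI)
    fix \<phi> :: "'m \<Rightarrow> real" assume \<phi>: "continuous_on UNIV \<phi>"
    show "\<Lambda> (\<lambda>x. \<phi> (f x)) = \<Lambda> \<phi>"
    proof (rule ccontr)
      assume "\<Lambda> (\<lambda>x. \<phi> (f x)) \<noteq> \<Lambda> \<phi>"
      then show False using inv_approx[OF \<phi>, of "\<bar>\<Lambda> (\<lambda>x. \<phi> (f x)) - \<Lambda> \<phi>\<bar> / 2"] by simp
    qed
    show "\<Lambda> (\<lambda>x. c * \<phi> x) = c * \<Lambda> \<phi>" for c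
      by (rule lim, intro closed_Collect_eq continuous_intros continuous_on_eval)
        (use \<phi> in \<open>simp add: E_def sum_distrib_left continuous_on_mult_left\<close>)
  next
    fix \<phi> \<psi> :: "'m \<Rightarrow> real" assume \<phi>: "continuous_on UNIV \<phi> \<and> continuous_on UNIV \<psi>"
    show "\<Lambda> (\<lambda>x. \<phi> x + \<psi> x) = \<Lambda> \<phi> + \<Lambda> \<psi>"
      by (rule lim, intro closed_Collect_eq continuous_intros continuous_on_eval)
        (use \<phi> in \<open>simp add: E_def sum.distrib continuous_on_add add_divide_distrib\<close>)
  next
    fix \<phi> :: "'m \<Rightarrow> real" assume \<phi>: "continuous_on UNIV \<phi> \<and> (\<forall>x. 0 \<le> \<phi> x)"
    show "0 \<le> \<Lambda> \<phi>"
      by (rule lim, intro closed_Collect_le continuous_intros continuous_on_eval)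
        (use \<phi> in \<open>simp add: E_def sum_nonneg\<close>)
  next
    fix \<phi> :: "'m \<Rightarrow> real" assume \<phi>: "\<not> continuous_on UNIV \<phi>"
    show "\<Lambda> \<phi> = 0"
      by (rule lim, intro closed_Collect_eq continuous_intros continuous_on_eval)
        (use \<phi> in \<open>simp add: E_def\<close>)
  next
    show "\<Lambda> (\<lambda>_. 1) = 1"
      by (rule lim, intro closed_Collect_eq continuous_intros continuous_on_eval)
        (auto simp: E_def eventually_sequentially intro!: exI[of _ 1])
  qed
  moreover have "real m * \<beta> \<le> \<Lambda> (trunc m T)" if m: "m \<ge> 1" for m T
  proof (rule field_le_epsilon)
    fix \<epsilon> :: real assume \<epsilon>: "0 < \<epsilon>"
    let ?K = "2 * real m * real m * C + \<bar>real m * T\<bar>"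
    show "real m * \<beta> \<le> \<Lambda> (trunc m T) + \<epsilon>"
    proof (rule lim)
      show "closed {\<Lambda>. real m * \<beta> \<le> \<Lambda> (trunc m T) + \<epsilon>}"
        by (intro closed_Collect_le continuous_intros continuous_on_eval)
      have "(\<lambda>N. ?K / real N) \<longlonglongrightarrow> 0" by (rule lim_const_over_n)
      then have "eventually (\<lambda>N. ?K / real N < \<epsilon>) sequentially" using \<epsilon> by (rule order_tendstoD(2))
      then show "eventually (\<lambda>N. real m * \<beta> \<le> E N (trunc m T) + \<epsilon>) sequentially"
        using eventually_ge_at_top[of m]
      proof eventually_elim
        case (elim N)
        have N: "N \<ge> 1" using elim(2) m by simp
        have "(real N * (real m * \<beta>) - ?K) / real N \<le> E N (trunc m T)"
          using trunc_sum_ge[OF m elim(2) x[OF N], of T]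
          by (simp only: E_def trunc_cont if_True) (intro divide_right_mono, auto)
        moreover have "(real N * (real m * \<beta>) - ?K) / real N = real m * \<beta> - ?K / real N"
          using N by (simp add: diff_divide_distrib)
        ultimately show ?case using elim(1) by linarith
      qed
    qed
  qed
  ultimately have "\<Lambda> \<in> maximizing_states \<beta>" by (simp add: maximizing_states_def)
  then show ?thesis by auto
qed

theorem exists_ergodic_maximizing:
  assumes upper: "\<And>\<epsilon>. \<epsilon> > 0 \<Longrightarrow> eventually (\<lambda>n. \<forall>x. p n x \<le> exp (real n * (\<beta> + \<epsilon>))) sequentially"
    and lower: "\<And>n. n \<ge> 1 \<Longrightarrow> \<exists>x. exp (real n * \<beta>) \<le> p n x"
  obtains M where "ergodic_invariant f M"
    "\<And>n T. n \<ge> 1 \<Longrightarrow> real n * \<beta> \<le> (LINT x|M. ln (max (p n x) (exp T)))"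
proof -
  obtain \<Lambda> where \<Lambda>: "\<Lambda> \<in> maximizing_states \<beta>" "face (states f) {\<Lambda>}"
    by (rule exists_extreme_point_of_face[OF compact_states[OF comp] closed_maximizing_states
          maximizing_states_nonempty[OF lower] face_maximizing_states[OF upper]])
  obtain M where M: "ergodic_invariant f M" "\<And>\<phi>. continuous_on UNIV \<phi> \<Longrightarrow> (LINT x|M. \<phi> x) = \<Lambda> \<phi>"
    by (rule extreme_state_ergodic[OF comp f_cont \<Lambda>(2)]) blast
  have "real n * \<beta> \<le> (LINT x|M. ln (max (p n x) (exp T)))" if "n \<ge> 1" for n T
    using \<Lambda>(1) that M(2)[OF trunc_cont, of n T] by (simp add: maximizing_states_def trunc_def[abs_def])
  with M(1) show thesis by (rule that)
qed

end

section \<open>Derivatives in charts\<close>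

definition local_rep :: "('m, 'e) chart \<Rightarrow> ('m, 'e) chart \<Rightarrow> ('m \<Rightarrow> 'm) \<Rightarrow> 'e \<Rightarrow> 'e" where
  "local_rep c c' f = coord c' \<circ> f \<circ> chart_inv c"

definition local_deriv :: "('m, 'e::euclidean_space) chart \<Rightarrow> ('m, 'e) chart \<Rightarrow> ('m \<Rightarrow> 'm) \<Rightarrow> 'm \<Rightarrow> 'e \<Rightarrow> 'e" where
  "local_deriv c c' f x = frechet_derivative (local_rep c c' f) (at (coord c x))"

text \<open>In finite dimension, convergence on basis vectors suffices to insert a convergent
  argument into a convergent family of linear maps.\<close>

lemma tendsto_linear_family:
  fixes L :: "'x \<Rightarrow> 'v::euclidean_space \<Rightarrow> 'w::real_normed_vector"
  assumes lin: "eventually (\<lambda>y. linear (L y)) F" "linear A"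
    and L: "\<And>v. ((\<lambda>y. L y v) \<longlongrightarrow> A v) F" and w: "(w \<longlongrightarrow> w0) F"
  shows "((\<lambda>y. L y (w y)) \<longlongrightarrow> A w0) F"
proof -
  have e: "T v = (\<Sum>b\<in>Basis. (v \<bullet> b) *\<^sub>R T b)" if "linear T" for T :: "'v \<Rightarrow> 'w" and v
  proof -
    have "T v = T (\<Sum>b\<in>Basis. (v \<bullet> b) *\<^sub>R b)" by (simp add: euclidean_representation)
    then show ?thesis by (simp add: linear_sum[OF that] linear_scale[OF that])
  qed
  have "((\<lambda>y. \<Sum>b\<in>Basis. (w y \<bullet> b) *\<^sub>R L y b) \<longlongrightarrow> (\<Sum>b\<in>Basis. (w0 \<bullet> b) *\<^sub>R A b)) F"
    by (intro tendsto_intros L w)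
  moreover have "eventually (\<lambda>y. (\<Sum>b\<in>Basis. (w y \<bullet> b) *\<^sub>R L y b) = L y (w y)) F"
    using lin(1) by eventually_elim (rule e[symmetric])
  ultimately show ?thesis
    unfolding e[OF lin(2), of w0, symmetric] by (rule Lim_transform_eventually)
qed

lemma tendsto_form_family:
  fixes B :: "'x \<Rightarrow> 'v::euclidean_space \<Rightarrow> 'v \<Rightarrow> real"
  assumes bil: "eventually (\<lambda>y. sym_form (B y)) F" "sym_form A"
    and B: "\<And>u v. ((\<lambda>y. B y u v) \<longlongrightarrow> A u v) F" and u: "(u \<longlongrightarrow> u0) F" and v: "(v \<longlongrightarrow> v0) F"
  shows "((\<lambda>y. B y (u y) (v y)) \<longlongrightarrow> A u0 v0) F"
proof -
  have "((\<lambda>y. B y (u y) z) \<longlongrightarrow> A u0 z) F" for z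
    by (rule tendsto_linear_family[where L = "\<lambda>y a. B y a z" and A = "\<lambda>a. A a z"])
      (use bil B u in \<open>auto elim!: eventually_mono dest!: sym_formD(11) simp: bilinear_def\<close>)
  then show ?thesis
    by (rule tendsto_linear_family[where L = "\<lambda>y. B y (u y)", rotated 2])
      (use bil v in \<open>auto elim!: eventually_mono dest!: sym_formD(11) simp: bilinear_def\<close>)
qed

section \<open>Smooth maps in charts\<close>

locale C1_manifold =
  fixes \<A> :: "('m::t2_space, 'e::euclidean_space) chart set"
  assumes atlas: "C1_atlas \<A>"
begin

lemma chart:
  assumes "c \<in> \<A>"
  shows "open (chart_dom c)" "open (coord c ` chart_dom c)"
    "homeomorphism (chart_dom c) (coord c ` chart_dom c) (coord c) (chart_inv c)"
  using atlas assms unfolding C1_atlas_def topological_chart_def by blast+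

lemma chart_inv_coord: "c \<in> \<A> \<Longrightarrow> x \<in> chart_dom c \<Longrightarrow> chart_inv c (coord c x) = x"
  using chart(3) unfolding homeomorphism_def by blast

lemma open_coord_image:
  assumes "c \<in> \<A>" "open U" "U \<subseteq> chart_dom c"
  shows "open (coord c ` U)"
proof -
  have "openin (top_of_set (chart_dom c)) U"
    using assms chart(1) by (simp add: openin_open_eq)
  from homeomorphism_imp_open_map[OF chart(3)[OF assms(1)] this] show ?thesis
    by (rule openin_open_trans) (rule chart(2)[OF assms(1)])
qed

lemma isCont_coord: "c \<in> \<A> \<Longrightarrow> x \<in> chart_dom c \<Longrightarrow> isCont (coord c) x"
  using chart(1,3) unfolding homeomorphism_def by (meson continuous_on_eq_continuous_at)

lemma chart_at: "chart_at \<A> x \<in> \<A>" "x \<in> chart_dom (chart_at \<A> x)"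
proof -
  have "\<exists>c. c \<in> \<A> \<and> x \<in> chart_dom c" using atlas unfolding C1_atlas_def by blast
  from someI_ex[OF this] show "chart_at \<A> x \<in> \<A>" "x \<in> chart_dom (chart_at \<A> x)"
    unfolding chart_at_def by auto
qed

text \<open>A form of \<open>C1_map\<close> at the points of the manifold instead of their
  coordinates. Continuity of the derivative is required vector by vector, which is equivalent to
  norm continuity in finite dimension.\<close>

definition smooth_map :: "('m \<Rightarrow> 'm) \<Rightarrow> bool" where
  "smooth_map f \<longleftrightarrow> continuous_on UNIV f \<and>
    (\<forall>c\<in>\<A>. \<forall>c'\<in>\<A>. \<forall>x. x \<in> chart_dom c \<longrightarrow> f x \<in> chart_dom c' \<longrightarrow>
      (local_rep c c' f has_derivative local_deriv c c' f x) (at (coord c x)) \<and>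
      (\<forall>v. isCont (\<lambda>y. local_deriv c c' f y v) x))"

lemma smooth_map_continuous: "smooth_map f \<Longrightarrow> continuous_on UNIV f"
  by (simp add: smooth_map_def)

lemma smooth_mapD:
  assumes "smooth_map f" "c \<in> \<A>" "c' \<in> \<A>" "x \<in> chart_dom c" "f x \<in> chart_dom c'"
  shows "(local_rep c c' f has_derivative local_deriv c c' f x) (at (coord c x))"
    "isCont (\<lambda>y. local_deriv c c' f y v) x"
    "linear (local_deriv c c' f x)"
proof -
  show *: "(local_rep c c' f has_derivative local_deriv c c' f x) (at (coord c x))"
    "isCont (\<lambda>y. local_deriv c c' f y v) x"
    using assms unfolding smooth_map_def by blast+
  show "linear (local_deriv c c' f x)" using *(1) by (rule has_derivative_linear)
qed

lemma open_overlap: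
  assumes "continuous_on UNIV f" "c \<in> \<A>" "c' \<in> \<A>"
  shows "open (chart_dom c \<inter> f -` chart_dom c')"
  using assms chart(1) by (intro open_Int open_vimage) auto

lemma eventually_overlap:
  assumes "continuous_on UNIV f" "c \<in> \<A>" "c' \<in> \<A>" "x \<in> chart_dom c" "f x \<in> chart_dom c'"
  shows "eventually (\<lambda>y. y \<in> chart_dom c \<and> f y \<in> chart_dom c') (nhds x)"
  using open_overlap[OF assms(1-3)] assms(4,5) by (auto simp: eventually_nhds intro!: exI[of _ "chart_dom c \<inter> f -` chart_dom c'"])

text \<open>The coordinate image of the overlap is open, so the derivative within it is a full
  derivative and coincides with \<open>frechet_derivative\<close>.\<close>

lemma smooth_map_of_C1_map:
  assumes f: "C1_map \<A> f"
  shows "smooth_map f"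
  unfolding smooth_map_def
proof (intro conjI ballI allI impI)
  show cf: "continuous_on UNIV f" using f by (simp add: C1_map_def)
  fix c c' x assume c: "c \<in> \<A>" "c' \<in> \<A>" and x: "x \<in> chart_dom c" "f x \<in> chart_dom c'"
  let ?U = "chart_dom c \<inter> f -` chart_dom c'"
  let ?S = "coord c ` ?U"
  have S: "open ?S" by (rule open_coord_image[OF c(1) open_overlap[OF cf c]]) simp
  have "C1_on (local_rep c c' f) ?S" using f c unfolding C1_map_def local_rep_def by blast
  then obtain h' :: "'e \<Rightarrow> 'e \<Rightarrow>\<^sub>L 'e" where
    h': "\<forall>y\<in>?S. (local_rep c c' f has_derivative blinfun_apply (h' y)) (at y within ?S)" "continuous_on ?S h'"
    unfolding C1_on_def by blast
  have der: "(local_rep c c' f has_derivative blinfun_apply (h' (coord c y))) (at (coord c y))" if "y \<in> ?U" for y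
    using h'(1) that at_within_open[OF _ S, of "coord c y"] by (metis imageI)
  have eq: "local_deriv c c' f y = blinfun_apply (h' (coord c y))" if "y \<in> ?U" for y
    unfolding local_deriv_def by (rule frechet_derivative_at[OF der[OF that], symmetric])
  have xU: "x \<in> ?U" using x by simp
  show "(local_rep c c' f has_derivative local_deriv c c' f x) (at (coord c x))"
    unfolding eq[OF xU] by (rule der[OF xU])
  fix v
  have "isCont h' (coord c x)"
    using h'(2) S xU by (simp add: continuous_on_eq_continuous_at)
  then have "isCont (\<lambda>y. h' (coord c y)) x"
    using isCont_o2[OF isCont_coord[OF c(1) x(1)]] by blast
  then have "isCont (\<lambda>y. blinfun_apply (h' (coord c y)) v) x"
    unfolding isCont_def by (intro blinfun.tendsto tendsto_const)
  moreover have "eventually (\<lambda>y. blinfun_apply (h' (coord c y)) v = local_deriv c c' f y v) (nhds x)"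
    using eventually_overlap[OF cf c x] by eventually_elim (use eq in auto)
  ultimately show "isCont (\<lambda>y. local_deriv c c' f y v) x" by (subst (asm) isCont_cong)
qed

text \<open>Coordinate changes are local representatives of the identity; with this lemma, the chain
  rule for smooth maps covers them too.\<close>

lemma smooth_map_id: "smooth_map id"
  by (rule smooth_map_of_C1_map)
    (use atlas in \<open>auto simp: C1_map_def C1_atlas_def continuous_on_id' id_def[symmetric] vimage_id\<close>)

lemma has_derivative_compose_local:
  assumes f: "smooth_map f" and h: "smooth_map h" and c: "c \<in> \<A>" "c' \<in> \<A>" "c'' \<in> \<A>"
    and x: "x \<in> chart_dom c" "h x \<in> chart_dom c'" "f (h x) \<in> chart_dom c''"
  shows "(local_rep c c'' (f \<circ> h) has_derivative local_deriv c' c'' f (h x) \<circ> local_deriv c c' h x) (at (coord c x))"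
proof -
  let ?U = "chart_dom c \<inter> h -` chart_dom c'"
  let ?S = "coord c ` ?U"
  have S: "open ?S" by (rule open_coord_image[OF c(1) open_overlap[OF smooth_map_continuous[OF h] c(1,2)]]) simp
  have xS: "coord c x \<in> ?S" using x by auto
  have "local_rep c c' h (coord c x) = coord c' (h x)" by (simp add: local_rep_def chart_inv_coord c x)
  then have "(local_rep c' c'' f \<circ> local_rep c c' h has_derivative local_deriv c' c'' f (h x) \<circ> local_deriv c c' h x) (at (coord c x))"
    using smooth_mapD(1)[OF h c(1,2) x(1,2)] smooth_mapD(1)[OF f c(2,3) x(2,3)]
    by (intro diff_chain_at) simp_all
  then show ?thesis
    by (rule has_derivative_transform_within_open[OF _ S xS])
      (auto simp: local_rep_def chart_inv_coord c)
qed

lemma local_deriv_compose: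
  assumes "smooth_map f" "smooth_map h" "c \<in> \<A>" "c' \<in> \<A>" "c'' \<in> \<A>"
    and "x \<in> chart_dom c" "h x \<in> chart_dom c'" "f (h x) \<in> chart_dom c''"
  shows "local_deriv c c'' (f \<circ> h) x = local_deriv c' c'' f (h x) \<circ> local_deriv c c' h x"
  using frechet_derivative_at[OF has_derivative_compose_local[OF assms]]
  unfolding local_deriv_def[of c c'' "f \<circ> h"] by simp

lemma smooth_map_compose:
  assumes f: "smooth_map f" and h: "smooth_map h"
  shows "smooth_map (f \<circ> h)"
  unfolding smooth_map_def
proof (intro conjI ballI allI impI)
  note cf = smooth_map_continuous[OF f] and ch = smooth_map_continuous[OF h]
  show "continuous_on UNIV (f \<circ> h)"
    by (rule continuous_on_compose[OF ch continuous_on_subset[OF cf]]) simp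
  fix c c'' x assume c: "c \<in> \<A>" "c'' \<in> \<A>" and x: "x \<in> chart_dom c" "(f \<circ> h) x \<in> chart_dom c''"
  let ?c' = "chart_at \<A> (h x)"
  have x': "f (h x) \<in> chart_dom c''" using x by simp
  show "(local_rep c c'' (f \<circ> h) has_derivative local_deriv c c'' (f \<circ> h) x) (at (coord c x))"
    unfolding local_deriv_compose[OF f h c(1) chart_at(1) c(2) x(1) chart_at(2) x']
    by (rule has_derivative_compose_local[OF f h c(1) chart_at(1) c(2) x(1) chart_at(2) x'])
  fix v
  have ev1: "eventually (\<lambda>y. y \<in> chart_dom c \<and> h y \<in> chart_dom ?c') (nhds x)"
    by (rule eventually_overlap[OF ch c(1) chart_at(1) x(1) chart_at(2)])
  have hx: "isCont h x" using ch by (simp add: continuous_on_eq_continuous_at)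
  have "open (h -` (chart_dom ?c' \<inter> f -` chart_dom c''))"
    by (rule open_vimage[OF open_overlap[OF cf chart_at(1) c(2)] ch])
  then have ev2: "eventually (\<lambda>y. h y \<in> chart_dom ?c' \<and> f (h y) \<in> chart_dom c'') (nhds x)"
    using chart_at(2)[of "h x"] x'
    by (auto simp: eventually_nhds intro!: exI[of _ "h -` (chart_dom ?c' \<inter> f -` chart_dom c'')"])
  have lim: "((\<lambda>y. local_deriv ?c' c'' f (h y) (local_deriv c ?c' h y v)) \<longlongrightarrow>
      local_deriv ?c' c'' f (h x) (local_deriv c ?c' h x v)) (at x)"
  proof (rule tendsto_linear_family[where L = "\<lambda>y. local_deriv ?c' c'' f (h y)"
        and A = "local_deriv ?c' c'' f (h x)"])
    show "eventually (\<lambda>y. linear (local_deriv ?c' c'' f (h y))) (at x)"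
      using filter_leD[OF at_within_le_nhds ev2] by eventually_elim (use smooth_mapD(3)[OF f chart_at(1) c(2)] in auto)
    show "linear (local_deriv ?c' c'' f (h x))"
      by (rule smooth_mapD(3)[OF f chart_at(1) c(2) chart_at(2) x'])
    show "((\<lambda>y. local_deriv ?c' c'' f (h y) v) \<longlongrightarrow> local_deriv ?c' c'' f (h x) v) (at x)" for v
      using isCont_o2[OF hx smooth_mapD(2)[OF f chart_at(1) c(2) chart_at(2) x']] by (simp add: isCont_def)
    show "((\<lambda>y. local_deriv c ?c' h y v) \<longlongrightarrow> local_deriv c ?c' h x v) (at x)"
      using smooth_mapD(2)[OF h c(1) chart_at(1) x(1) chart_at(2)] by (simp add: isCont_def)
  qed
  then have "isCont (\<lambda>y. local_deriv ?c' c'' f (h y) (local_deriv c ?c' h y v)) x"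
    unfolding isCont_def .
  moreover have "eventually (\<lambda>y. local_deriv ?c' c'' f (h y) (local_deriv c ?c' h y v) = local_deriv c c'' (f \<circ> h) y v) (nhds x)"
    using ev1 ev2
    by eventually_elim (use local_deriv_compose[OF f h c(1) chart_at(1) c(2)] in auto)
  ultimately show "isCont (\<lambda>y. local_deriv c c'' (f \<circ> h) y v) x"
    by (subst (asm) isCont_cong)
qed

lemma smooth_map_iterate: "smooth_map f \<Longrightarrow> smooth_map (f ^^ n)"
  by (induction n) (auto intro: smooth_map_compose smooth_map_id simp: id_def[symmetric])

lemma local_deriv_id:
  assumes "c \<in> \<A>" "x \<in> chart_dom c"
  shows "local_deriv c c id x = id"
proof -
  have "(local_rep c c id has_derivative id) (at (coord c x))"
  proof (rule has_derivative_transform_within_open[of id])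
    show "open (coord c ` chart_dom c)" "coord c x \<in> coord c ` chart_dom c" using chart(2) assms by auto
  qed (auto simp: local_rep_def chart_inv_coord assms has_derivative_ident id_def)
  from frechet_derivative_at[OF this] show ?thesis by (simp add: local_deriv_def)
qed

lemma tangent_map_eq: "tangent_map \<A> f x = local_deriv (chart_at \<A> x) (chart_at \<A> (f x)) f x"
  by (simp add: tangent_map_def local_deriv_def local_rep_def)

lemma tangent_map_compose:
  assumes "smooth_map f" "smooth_map h"
  shows "tangent_map \<A> (f \<circ> h) x = tangent_map \<A> f (h x) \<circ> tangent_map \<A> h x"
  unfolding tangent_map_eq o_apply[of f h x]
  by (rule local_deriv_compose[OF assms]) (auto simp: chart_at)

lemma linear_tangent_map: "smooth_map f \<Longrightarrow> linear (tangent_map \<A> f x)"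
  unfolding tangent_map_eq by (rule smooth_mapD(3)) (auto simp: chart_at)

end

section \<open>Expansion of exterior powers on a Riemannian manifold\<close>

locale riemannian_manifold = C1_manifold \<A>
  for \<A> :: "('m::t2_space, 'e::euclidean_space) chart set" +
  fixes g :: "('m, 'e) metric"
  assumes metric: "riemannian_metric \<A> g"
begin

lemma pos_def_metric:
  assumes "c \<in> \<A>" "x \<in> chart_dom c"
  shows "pos_def (g c x)"
proof -
  have "bilinear (g c x) \<and> (\<forall>u v. g c x u v = g c x v u) \<and> (\<forall>u. u \<noteq> 0 \<longrightarrow> g c x u u > 0)"
    using metric assms unfolding riemannian_metric_def by blast
  then show ?thesis by (simp add: pos_def_def sym_form_def)
qed

lemma isCont_metric:
  assumes "c \<in> \<A>" "x \<in> chart_dom c"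
  shows "isCont (\<lambda>x. g c x u v) x"
proof -
  have "continuous_on (chart_dom c) (\<lambda>x. g c x u v)"
    using metric assms unfolding riemannian_metric_def by blast
  then show ?thesis using chart(1)[OF assms(1)] assms(2) by (simp add: continuous_on_eq_continuous_at)
qed

lemma metric_transform:
  assumes "c \<in> \<A>" "c' \<in> \<A>" "x \<in> chart_dom c" "x \<in> chart_dom c'"
  shows "g c x u v = g c' x (local_deriv c c' id x u) (local_deriv c c' id x v)"
proof -
  have "local_deriv c c' id x = frechet_derivative (coord c' \<circ> chart_inv c) (at (coord c x))"
    by (simp add: local_deriv_def local_rep_def)
  moreover have all: "\<forall>c\<in>\<A>. \<forall>c'\<in>\<A>. \<forall>x\<in>chart_dom c \<inter> chart_dom c'.
        let D = frechet_derivative (coord c' \<circ> chart_inv c) (at (coord c x))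
        in \<forall>u v. g c x u v = g c' x (D u) (D v)"
    by (rule metric[unfolded riemannian_metric_def, THEN conjunct2, THEN conjunct2])
  moreover note all[THEN bspec, OF assms(1), THEN bspec, OF assms(2), THEN bspec, OF IntI[OF assms(3,4)], unfolded Let_def,
      THEN spec, THEN spec]
  ultimately show ?thesis by (simp only:)
qed

lemma pos_def_metric_at: "pos_def (metric_at \<A> g x)"
  unfolding metric_at_def by (rule pos_def_metric[OF chart_at])

definition chart_form :: "('m, 'e) chart \<Rightarrow> ('m, 'e) chart \<Rightarrow> ('m \<Rightarrow> 'm) \<Rightarrow> 'm \<Rightarrow> 'e \<Rightarrow> 'e \<Rightarrow> real" where
  "chart_form c c' f x = (\<lambda>u v. g c' (f x) (local_deriv c c' f x u) (local_deriv c c' f x v))"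

lemma pos_semidef_chart_form:
  assumes "smooth_map f" "c \<in> \<A>" "c' \<in> \<A>" "x \<in> chart_dom c" "f x \<in> chart_dom c'"
  shows "pos_semidef (chart_form c c' f x)"
  unfolding chart_form_def
  by (rule pos_semidef_pullback[OF pos_def_imp_pos_semidef[OF pos_def_metric[OF assms(3,5)]] smooth_mapD(3)[OF assms]])

text \<open>The derivatives in the two pairs of charts differ by coordinate changes, and these are
  isometries by the transformation rule of the metric. An inequality is enough, as the roles of the
  charts can be exchanged.\<close>

lemma evprod_chart_le:
  assumes f: "smooth_map f" and k: "k \<le> DIM('e)"
    and c: "c \<in> \<A>" "c' \<in> \<A>" "x \<in> chart_dom c" "f x \<in> chart_dom c'"
    and d: "d \<in> \<A>" "d' \<in> \<A>" "x \<in> chart_dom d" "f x \<in> chart_dom d'"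
  shows "evprod k (g c x) (chart_form c c' f x) \<le> evprod k (g d x) (chart_form d d' f x)"
proof -
  let ?T = "local_deriv c d id x"
  have T: "linear ?T" by (rule smooth_mapD(3)[OF smooth_map_id c(1) d(1) c(3)]) (use d in simp)
  have "local_deriv c c' (f \<circ> id) x = local_deriv d c' f x \<circ> ?T"
    using local_deriv_compose[OF f smooth_map_id c(1) d(1) c(2) c(3)] c d by simp
  moreover have "local_deriv d c' (id \<circ> f) x = local_deriv d' c' id (f x) \<circ> local_deriv d d' f x"
    using local_deriv_compose[OF smooth_map_id f d(1,2) c(2) d(3,4)] c by simp
  ultimately have D: "local_deriv c c' f x u = local_deriv d' c' id (f x) (local_deriv d d' f x (?T u))" for u
    by simp
  have form: "chart_form c c' f x = (\<lambda>u v. chart_form d d' f x (?T u) (?T v))"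
    unfolding chart_form_def D metric_transform[OF d(2) c(2) d(4) c(4)] ..
  have gc: "g c x = (\<lambda>u v. g d x (?T u) (?T v))"
    using metric_transform[OF c(1) d(1) c(3) d(3)] by (intro ext)
  have "evprod k (g c x) (chart_form c c' f x) \<le>
      evprod k (g d x) (chart_form d d' f x) * evprod k (g c x) (\<lambda>u v. g d x (?T u) (?T v))"
    unfolding form
    by (rule evprod_compose_le[OF pos_def_metric[OF c(1,3)] pos_def_metric[OF d(1,3)]
          pos_semidef_chart_form[OF f d] T k k])
  then show ?thesis
    unfolding gc[symmetric] evprod_self[OF pos_def_metric[OF c(1,3)] k] by simp
qed

text \<open>Applied to \<open>f ^^ n\<close>, this is the function \<open>p\<^sub>n\<close> of
  degree \<open>k\<close>.\<close>

definition expansion :: "nat \<Rightarrow> ('m \<Rightarrow> 'm) \<Rightarrow> 'm \<Rightarrow> real" where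
  "expansion k f x = pvol k (metric_at \<A> g x) (metric_at \<A> g (f x)) (tangent_map \<A> f x)"

lemma expansion_eq:
  assumes f: "smooth_map f" and k: "k \<le> DIM('e)"
    and c: "c \<in> \<A>" "c' \<in> \<A>" "x \<in> chart_dom c" "f x \<in> chart_dom c'"
  shows "expansion k f x = sqrt (evprod k (g c x) (chart_form c c' f x))"
  unfolding expansion_def pvol_def metric_at_def tangent_map_eq chart_form_def[symmetric]
  by (intro arg_cong[where f = sqrt] antisym evprod_chart_le[OF f k] chart_at c)

lemma expansion_nonneg: "smooth_map f \<Longrightarrow> k \<le> DIM('e) \<Longrightarrow> 0 \<le> expansion k f x"
  unfolding expansion_def by (intro pvol_nonneg pos_def_metric_at linear_tangent_map)

lemma expansion_compose_le:
  assumes "smooth_map f" "smooth_map h" "k \<le> DIM('e)"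
  shows "expansion k (f \<circ> h) x \<le> expansion k f (h x) * expansion k h x"
  unfolding expansion_def tangent_map_compose[OF assms(1,2)] o_apply[of f h x]
  by (rule pvol_compose_le) (auto intro: pos_def_metric_at linear_tangent_map assms)

lemma expansion_id: "k \<le> DIM('e) \<Longrightarrow> expansion k id x = 1"
  unfolding expansion_def pvol_def tangent_map_eq
  by (simp add: local_deriv_id[OF chart_at] evprod_self[OF pos_def_metric_at])

text \<open>The charts chosen by \<open>chart_at\<close> jump from point to point. Near
  \<open>x\<close> the expansion is therefore computed in the two charts belonging to
  \<open>x\<close> and \<open>f x\<close>, where metric and derivative vary continuously.\<close>

lemma continuous_expansion:
  assumes f: "smooth_map f" and k: "k \<le> DIM('e)"
  shows "continuous_on UNIV (expansion k f)"
proof -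
  have "isCont (expansion k f) x" for x
  proof -
    let ?c = "chart_at \<A> x" and ?c' = "chart_at \<A> (f x)"
    note ch = chart_at(1)[of x] chart_at(1)[of "f x"] and dom = chart_at(2)[of x] chart_at(2)[of "f x"]
    have ev: "eventually (\<lambda>y. y \<in> chart_dom ?c \<and> f y \<in> chart_dom ?c') (nhds x)"
      by (rule eventually_overlap[OF smooth_map_continuous[OF f] ch dom])
    note ev' = filter_leD[OF at_within_le_nhds ev, of UNIV]
    have fx: "isCont f x" using smooth_map_continuous[OF f] by (simp add: continuous_on_eq_continuous_at)
    have "((\<lambda>y. evprod k (g ?c y) (chart_form ?c ?c' f y)) \<longlongrightarrow> evprod k (g ?c x) (chart_form ?c ?c' f x)) (at x)"
    proof (rule evprod_tendsto[OF pos_def_metric[OF ch(1) dom(1)] pos_semidef_chart_form[OF f ch dom] k])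
      show "eventually (\<lambda>y. pos_def (g ?c y)) (at x)"
        using ev' by eventually_elim (use pos_def_metric[OF ch(1)] in auto)
      show "eventually (\<lambda>y. pos_semidef (chart_form ?c ?c' f y)) (at x)"
        using ev' by eventually_elim (use pos_semidef_chart_form[OF f ch] in auto)
      show "((\<lambda>y. g ?c y u v) \<longlongrightarrow> g ?c x u v) (at x)" for u v
        using isCont_metric[OF ch(1) dom(1)] by (simp add: isCont_def)
      show "((\<lambda>y. chart_form ?c ?c' f y u v) \<longlongrightarrow> chart_form ?c ?c' f x u v) (at x)" for u v
        unfolding chart_form_def
      proof (rule tendsto_form_family[where B = "\<lambda>y. g ?c' (f y)" and A = "g ?c' (f x)"])
        show "eventually (\<lambda>y. sym_form (g ?c' (f y))) (at x)"
          using ev' by eventually_elim (use pos_def_imp_sym_form[OF pos_def_metric[OF ch(2)]] in auto)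
        show "sym_form (g ?c' (f x))" by (rule pos_def_imp_sym_form[OF pos_def_metric[OF ch(2) dom(2)]])
        show "((\<lambda>y. g ?c' (f y) a b) \<longlongrightarrow> g ?c' (f x) a b) (at x)" for a b
          using isCont_o2[OF fx isCont_metric[OF ch(2) dom(2)]] by (simp add: isCont_def)
        have lim: "((\<lambda>y. local_deriv ?c ?c' f y w) \<longlongrightarrow> local_deriv ?c ?c' f x w) (at x)" for w
          using smooth_mapD(2)[OF f ch dom] by (simp add: isCont_def)
        show "((\<lambda>y. local_deriv ?c ?c' f y u) \<longlongrightarrow> local_deriv ?c ?c' f x u) (at x)"
          "((\<lambda>y. local_deriv ?c ?c' f y v) \<longlongrightarrow> local_deriv ?c ?c' f x v) (at x)"
          by (rule lim)+
      qed
    qed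
    then have "isCont (\<lambda>y. sqrt (evprod k (g ?c y) (chart_form ?c ?c' f y))) x"
      unfolding isCont_def by (rule tendsto_real_sqrt)
    moreover have "eventually (\<lambda>y. sqrt (evprod k (g ?c y) (chart_form ?c ?c' f y)) = expansion k f y) (nhds x)"
      using ev by eventually_elim (use expansion_eq[OF f k ch] in auto)
    ultimately show ?thesis by (subst (asm) isCont_cong)
  qed
  then show ?thesis by (simp add: continuous_at_imp_continuous_on)
qed

end

section \<open>Growth rates, volumes of cubes and Lyapunov exponents\<close>

lemma rate_mult:
  assumes "n > 0" "a > 0" "b \<ge> 0"
  shows "rate n (a * b) = rate n a + rate n b"
proof (cases "b = 0")
  case False
  then have "b > 0" using assms by simp
  then show ?thesis using assms by (simp add: rate_pos ln_mult add_divide_distrib)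
qed (use assms in \<open>simp add: rate_zero rate_pos\<close>)

lemma tendsto_MInfty_real:
  fixes f :: "'a \<Rightarrow> ereal"
  assumes "\<And>r. eventually (\<lambda>x. f x \<le> ereal r) F"
  shows "(f \<longlongrightarrow> -\<infinity>) F"
  unfolding tendsto_MInfty
proof
  fix r
  show "eventually (\<lambda>x. f x < ereal r) F"
    using assms[of "r - 1"] by eventually_elim (erule le_less_trans, simp)
qed

text \<open>A factor is a quotient of consecutive products, so its rate is the difference of theirs.
  The difference is meaningless once \<open>c j = -\<infinity>\<close>; then the monotonicity of the
  factors forces the rate -\<infinity>.\<close>

lemma rates_of_factors:
  fixes s :: "nat \<Rightarrow> nat \<Rightarrow> real" and c :: "nat \<Rightarrow> ereal"
  assumes s: "\<And>i n. i < d \<Longrightarrow> 0 \<le> s i n" "\<And>i j n. i \<le> j \<Longrightarrow> j < d \<Longrightarrow> s j n \<le> s i n"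
    and c: "\<And>j. j \<le> d \<Longrightarrow> (\<lambda>n. rate n (\<Prod>i<j. s i n)) \<longlonglongrightarrow> c j" "\<And>j. j \<le> d \<Longrightarrow> c j < \<infinity>"
    and j: "j < d"
  shows "(\<lambda>n. rate n (s j n)) \<longlonglongrightarrow> (if c j = -\<infinity> then -\<infinity> else c (Suc j) - c j)"
    and "c j = -\<infinity> \<Longrightarrow> c (Suc j) = -\<infinity>"
proof -
  let ?P = "\<lambda>j n. \<Prod>i<j. s i n"
  have P_nonneg: "0 \<le> ?P i n" if "i \<le> d" for i n using that s(1) by (intro prod_nonneg) auto
  \<comment> \<open>The factor \<open>s j n\<close> is at most the geometric mean of the
    \<open>j\<close> larger factors before it, whose product decays faster than any exponential.
    Here \<open>j > 0\<close>, since the empty product has rate zero.\<close>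
  have small: "eventually (\<lambda>n. s j n \<le> exp (real n * r)) sequentially" if cj: "c j = -\<infinity>" for r
  proof -
    have "c 0 = 0"
    proof (rule LIMSEQ_unique[OF c(1)])
      show "(\<lambda>n. rate n (\<Prod>i<0. s i n)) \<longlonglongrightarrow> 0"
        by (rule tendsto_eventually) (auto simp: eventually_sequentially rate_pos zero_ereal_def intro!: exI[of _ 1])
    qed simp
    then have j0: "j > 0" using cj by (cases j) auto
    have "(\<lambda>n. rate n (?P j n)) \<longlonglongrightarrow> -\<infinity>" using c(1)[of j] j cj by simp
    then have "eventually (\<lambda>n. rate n (?P j n) < ereal (real j * r)) sequentially"
      unfolding tendsto_MInfty by blast
    then show ?thesis
      using eventually_gt_at_top[of 0]
    proof eventually_elim
      case (elim n)
      have "(s j n) ^ j = (\<Prod>i<j. s j n)" by simp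
      also have "\<dots> \<le> ?P j n" using s j by (intro prod_mono) auto
      also have "\<dots> \<le> exp (real n * (real j * r))"
        using elim P_nonneg[of j n] j by (subst rate_le_iff[symmetric]) auto
      also have "\<dots> = exp (real n * r) ^ j" by (simp add: exp_of_nat_mult[symmetric] mult.left_commute)
      finally show ?case using j0 by (simp add: power_mono_iff s(1) j)
    qed
  qed
  show "(\<lambda>n. rate n (s j n)) \<longlonglongrightarrow> (if c j = -\<infinity> then -\<infinity> else c (Suc j) - c j)"
  proof (cases "c j = -\<infinity>")
    case True
    have "(\<lambda>n. rate n (s j n)) \<longlonglongrightarrow> -\<infinity>"
    proof (rule tendsto_MInfty_real)
      fix r
      show "eventually (\<lambda>n. rate n (s j n) \<le> ereal r) sequentially"
        using small[OF True, of r] eventually_gt_at_top[of 0]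
        by eventually_elim (simp add: rate_le_iff s(1) j)
    qed
    with True show ?thesis by simp
  next
    case False
    have "-\<infinity> < c j" using False by simp
    then have "eventually (\<lambda>n. -\<infinity> < rate n (?P j n)) sequentially"
      using c(1)[of j] j by (intro order_tendstoD(1)[of _ "c j"]) auto
    then have "eventually (\<lambda>n. rate n (?P (Suc j) n) - rate n (?P j n) = rate n (s j n)) sequentially"
      using eventually_gt_at_top[of 0]
    proof eventually_elim
      case (elim n)
      have pos: "0 < ?P j n"
      proof (rule ccontr)
        assume "\<not> ?thesis"
        then have z: "?P j n = 0" using P_nonneg[of j n] j by simp
        show False using elim(1) unfolding z rate_zero[OF elim(2)] by simp
      qed
      have "rate n (?P (Suc j) n) = rate n (?P j n) + rate n (s j n)"
        using rate_mult[OF elim(2) pos, of "s j n"] s(1)[OF j] by simp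
      then show ?case using pos elim(2) by (simp add: rate_pos ereal_diff_add_inverse)
    qed
    moreover have "(\<lambda>n. rate n (?P (Suc j) n) - rate n (?P j n)) \<longlonglongrightarrow> c (Suc j) - c j"
      using c(2)[of j] c(2)[of "Suc j"] j False
      by (intro tendsto_diff_ereal_general c(1)) auto
    ultimately show ?thesis using False by (simp add: Lim_transform_eventually)
  qed
  show "c (Suc j) = -\<infinity>" if cj: "c j = -\<infinity>"
  proof (rule LIMSEQ_unique[OF c(1)])
    show "(\<lambda>n. rate n (?P (Suc j) n)) \<longlonglongrightarrow> -\<infinity>"
    proof (rule tendsto_MInfty_real)
      fix r
      have "(\<lambda>n. rate n (?P j n)) \<longlonglongrightarrow> -\<infinity>" using c(1)[of j] j cj by simp
      then have "eventually (\<lambda>n. rate n (?P j n) < ereal r) sequentially"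
        unfolding tendsto_MInfty by blast
      then show "eventually (\<lambda>n. rate n (?P (Suc j) n) \<le> ereal r) sequentially"
        using small[OF cj, of 0] eventually_gt_at_top[of 0]
      proof eventually_elim
        case (elim n)
        have "?P j n \<le> exp (real n * r)"
          using elim P_nonneg[of j n] j by (subst rate_le_iff[symmetric]) auto
        then have "?P j n * s j n \<le> exp (real n * r) * 1"
          using elim(2) s(1)[OF j] by (intro mult_mono) auto
        then show ?case using elim(3) P_nonneg[of "Suc j" n] j by (simp add: rate_le_iff)
      qed
    qed
  qed (use j in simp)
qed

text \<open>A telescoping sum in which -\<infinity> is absorbing: once reached, it is the value of
  all later terms and partial sums.\<close>

lemma sum_of_differences:
  fixes c :: "nat \<Rightarrow> ereal"
  assumes "c 0 = 0" "\<And>j. j \<le> d \<Longrightarrow> c j < \<infinity>" "\<And>j. j < d \<Longrightarrow> c j = -\<infinity> \<Longrightarrow> c (Suc j) = -\<infinity>" "k \<le> d"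
  shows "(\<Sum>j<k. if c j = -\<infinity> then -\<infinity> else c (Suc j) - c j) = c k"
  using assms(4)
proof (induction k)
  case (Suc k)
  show ?case
  proof (cases "c k")
    case (real r)
    then show ?thesis using Suc by (cases "c (Suc k)") auto
  next
    case PInf
    then show ?thesis using assms(2)[of k] Suc.prems by simp
  next
    case MInf
    then show ?thesis using Suc assms(3)[of k] by simp
  qed
qed (simp add: assms(1))

section \<open>Growth rate of a continuous cocycle\<close>

context continuous_cocycle
begin

text \<open>Fekete's argument by division with remainder, uniform in \<open>x\<close>. The remainder
  costs at most the constant \<open>?K\<close>, which \<epsilon> absorbs for large
  \<open>n\<close>.\<close>

lemma upper_rate_of_one_time:
  assumes n0: "n0 \<ge> 1" "\<And>x. p n0 x \<le> exp (real n0 * b)" and \<epsilon>: "\<epsilon> > 0"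
  shows "eventually (\<lambda>n. \<forall>x. p n x \<le> exp (real n * (b + \<epsilon>))) sequentially"
proof -
  have mult: "p (q * n0) x \<le> exp (real q * (real n0 * b))" for q x
  proof (induction q arbitrary: x)
    case 0
    then show ?case using p_bound[of 0 x] by simp
  next
    case (Suc q)
    have "p (Suc q * n0) x \<le> p n0 x * p (q * n0) ((f ^^ n0) x)" using p_submult[of n0 "q * n0" x] by simp
    also have "\<dots> \<le> exp (real n0 * b) * exp (real q * (real n0 * b))"
      using Suc n0(2) p_nonneg by (intro mult_mono) auto
    also have "\<dots> = exp (real (Suc q) * (real n0 * b))" by (simp add: exp_add[symmetric] algebra_simps)
    finally show ?case .
  qed
  let ?K = "real n0 * (\<bar>b\<bar> + C)"
  obtain N where N: "?K < real N * \<epsilon>" using reals_Archimedean3[OF \<epsilon>] by blast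
  show ?thesis
    unfolding eventually_sequentially
  proof (intro exI allI impI)
    fix n x assume n: "N \<le> n"
    let ?q = "n div n0" and ?r = "n mod n0"
    have r: "real ?r \<le> real n0" using n0(1) by (simp add: less_imp_le)
    have nq: "real n = real ?q * real n0 + real ?r"
      by (metis div_mult_mod_eq of_nat_add of_nat_mult)
    have "p n x \<le> p (?q * n0) x * p ?r ((f ^^ (?q * n0)) x)" using p_submult[of "?q * n0" ?r x] by simp
    also have "\<dots> \<le> exp (real ?q * (real n0 * b)) * exp (real ?r * C)"
      using mult p_bound p_nonneg by (intro mult_mono) auto
    also have "\<dots> = exp (real n * b - real ?r * b + real ?r * C)"
      by (simp add: exp_add[symmetric] nq algebra_simps)
    also have "\<dots> \<le> exp (real n * (b + \<epsilon>))"
    proof -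
      have "real ?r * (C - b) \<le> real ?r * (\<bar>b\<bar> + C)" by (intro mult_left_mono) auto
      also have "\<dots> \<le> ?K" using r C_nonneg by (intro mult_right_mono) auto
      also have "\<dots> \<le> real n * \<epsilon>" using N n \<epsilon> by (meson less_imp_le mult_right_mono of_nat_le_iff order_trans)
      finally show ?thesis by (simp add: algebra_simps)
    qed
    finally show "p n x \<le> exp (real n * (b + \<epsilon>))" .
  qed
qed

text \<open>The growth rate is the infimum of all \<open>b\<close> for which \<open>p\<close> stays
  strictly below \<open>exp (n * b)\<close> at some time \<open>n\<close>. Quantifying over the
  minorant \<open>D\<close>, later the dilation, treats a real rate and the rate -\<infinity> in one
  statement about one measure.\<close>

theorem exists_ergodic_of_maximal_growth:
  obtains M where "ergodic_invariant f M"
    "\<And>D :: ereal. (\<And>b. eventually (\<lambda>n. \<forall>x. p n x \<le> exp (real n * b)) sequentially \<Longrightarrow> D \<le> ereal b) \<Longrightarrow>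
      D = -\<infinity> \<or> (\<exists>\<beta>. D \<le> ereal \<beta> \<and> (\<forall>n T. n \<ge> 1 \<longrightarrow> real n * \<beta> \<le> (LINT x|M. ln (max (p n x) (exp T)))))"
proof -
  define P where "P b \<longleftrightarrow> (\<exists>n0\<ge>1. \<forall>x. p n0 x < exp (real n0 * b))" for b
  have P_up: "eventually (\<lambda>n. \<forall>x. p n x \<le> exp (real n * (b + \<epsilon>))) sequentially" if Pb: "P b" and \<epsilon>: "\<epsilon> > 0" for b \<epsilon>
  proof -
    obtain n0 where n0: "n0 \<ge> 1" "\<And>x. p n0 x < exp (real n0 * b)" using Pb by (auto simp: P_def)
    show ?thesis
      by (rule upper_rate_of_one_time[OF n0(1) less_imp_le[OF n0(2)] \<epsilon>])
  qed
  show thesis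
  proof (cases "\<forall>b. P b")
    case True
    \<comment> \<open>The rate is -\<infinity>, so any ergodic measure serves; the constant cocycle
      \<open>1\<close> provides one.\<close>
    interpret T: continuous_cocycle f "\<lambda>_ _. 1" 0
      by unfold_locales (auto simp: comp f_cont)
    obtain M where M: "ergodic_invariant f M"
      by (rule T.exists_ergodic_maximizing[of 0]) (auto simp: eventually_sequentially)
    have "D = -\<infinity>" if D: "\<And>b. eventually (\<lambda>n. \<forall>x. p n x \<le> exp (real n * b)) sequentially \<Longrightarrow> D \<le> ereal b" for D :: ereal
    proof -
      have "D \<le> ereal b" for b
        using D[of b] P_up[of "b - 1" 1] True by simp
      then show ?thesis by (rule ereal_bot)
    qed
    with M show thesis by (intro that[of M]) auto
  next
    case False
    then obtain b0 where b0: "\<not> P b0" by blast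
    have mono: "P b'" if "P b" "b \<le> b'" for b b'
    proof -
      have "exp (real n * b) \<le> exp (real n * b')" for n using that(2) by (simp add: mult_left_mono)
      with that(1) show ?thesis unfolding P_def by (blast intro: less_le_trans)
    qed
    have "p 1 x < exp (real 1 * (C + 1))" for x
      using p_bound[of 1 x] by (rule le_less_trans) simp
    then have ne: "P (C + 1)" unfolding P_def by (intro exI[of _ 1]) simp
    have bdd: "bdd_below {b. P b}"
      by (rule bdd_belowI[of _ b0]) (use b0 mono linear in blast)
    define \<beta> where "\<beta> = Inf {b. P b}"
    have upper: "eventually (\<lambda>n. \<forall>x. p n x \<le> exp (real n * (\<beta> + \<epsilon>))) sequentially" if \<epsilon>: "\<epsilon> > 0" for \<epsilon>
    proof -
      have "Inf {b. P b} < \<beta> + \<epsilon> / 2" using \<epsilon> by (simp add: \<beta>_def)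
      then obtain b where b: "P b" "b < \<beta> + \<epsilon> / 2"
        using cInf_less_iff[OF _ bdd] ne by blast
      have "eventually (\<lambda>n. \<forall>x. p n x \<le> exp (real n * (b + \<epsilon> / 2))) sequentially"
        using P_up[OF b(1), of "\<epsilon> / 2"] \<epsilon> by simp
      then show ?thesis
      proof eventually_elim
        case (elim n)
        have "real n * (b + \<epsilon> / 2) \<le> real n * (\<beta> + \<epsilon>)" using b(2) by (intro mult_left_mono) auto
        then show ?case using elim by (meson exp_le_cancel_iff order_trans)
      qed
    qed
    \<comment> \<open>By compactness \<open>p n\<close> attains its maximum. If it were below
      \<open>exp (n * \<beta>)\<close>, it would be below \<open>exp (n * b)\<close> for some
      \<open>b < \<beta>\<close>, against the choice of \<beta> as an infimum.\<close>
    have lower: "\<exists>x. exp (real n * \<beta>) \<le> p n x" if n: "n \<ge> 1" for n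
    proof (rule ccontr)
      assume "\<not> ?thesis"
      then have less: "p n x < exp (real n * \<beta>)" for x by (simp add: not_le)
      obtain y where y: "\<And>x. p n x \<le> p n y"
        using continuous_attains_sup[OF comp _ p_cont[of n]] by auto
      have "((\<lambda>b. exp (real n * b)) \<longlongrightarrow> exp (real n * \<beta>)) (at_left \<beta>)"
        by (intro tendsto_intros)
      then have "eventually (\<lambda>b. p n y < exp (real n * b)) (at_left \<beta>)"
        using less by (rule order_tendstoD(1))
      moreover have "eventually (\<lambda>b. b < \<beta>) (at_left \<beta>)" by (simp add: eventually_at_filter)
      ultimately have "eventually (\<lambda>b. p n y < exp (real n * b) \<and> b < \<beta>) (at_left \<beta>)"
        by eventually_elim simp
      then obtain b where b: "p n y < exp (real n * b)" "b < \<beta>"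
        using eventually_happens[of _ "at_left \<beta>"] trivial_limit_at_left_real by blast
      have "P b" unfolding P_def using n b(1) y by (intro exI[of _ n]) (auto intro: le_less_trans)
      then have "\<beta> \<le> b" unfolding \<beta>_def using bdd by (intro cInf_lower) auto
      with b(2) show False by simp
    qed
    obtain M where M: "ergodic_invariant f M"
      "\<And>n T. n \<ge> 1 \<Longrightarrow> real n * \<beta> \<le> (LINT x|M. ln (max (p n x) (exp T)))"
      by (rule exists_ergodic_maximizing[OF upper lower]) blast+
    have "D \<le> ereal \<beta>" if D: "\<And>b. eventually (\<lambda>n. \<forall>x. p n x \<le> exp (real n * b)) sequentially \<Longrightarrow> D \<le> ereal b" for D :: ereal
    proof (rule ccontr)
      assume "\<not> ?thesis"
      then obtain r where r: "ereal \<beta> < ereal r" "ereal r < D" using ereal_dense2[of "ereal \<beta>" D] by (auto simp: not_le)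
      have "D \<le> ereal (\<beta> + (r - \<beta>))" by (rule D[OF upper]) (use r(1) in simp)
      with r(2) show False by simp
    qed
    with M show thesis by (intro that[of M]) blast+
  qed
qed

end

context riemannian_manifold
begin

lemma expansion_cocycle:
  assumes comp: "compact (UNIV :: 'm set)" and f: "smooth_map f" and k: "k \<le> DIM('e)"
  obtains C where "0 \<le> C" "\<And>n x. expansion k (f ^^ n) x \<le> exp (real n * C)"
    "\<And>n m x. expansion k (f ^^ (n + m)) x \<le> expansion k (f ^^ n) x * expansion k (f ^^ m) ((f ^^ n) x)"
proof -
  obtain B where B: "\<And>x. \<bar>expansion k f x\<bar> \<le> B"
    using continuous_bounded[OF comp continuous_expansion[OF f k]] by blast
  \<comment> \<open>The maximum with \<open>1\<close> makes \<open>C\<close> nonnegative.\<close>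
  define C where "C = ln (max 1 B)"
  have eC: "exp C = max 1 B" unfolding C_def by simp
  have C0: "0 \<le> C" by (simp add: C_def)
  have sub: "expansion k (f ^^ (n + m)) x \<le> expansion k (f ^^ n) x * expansion k (f ^^ m) ((f ^^ n) x)" for n m x
  proof -
    have "f ^^ (n + m) = f ^^ m \<circ> f ^^ n" by (simp add: funpow_add[symmetric] add.commute)
    then show ?thesis
      using expansion_compose_le[OF smooth_map_iterate[OF f, of m] smooth_map_iterate[OF f, of n] k, of x]
      by (simp only: mult.commute)
  qed
  have f1: "expansion k f x \<le> exp C" for x using B[of x] by (auto simp: eC)
  have "expansion k (f ^^ n) x \<le> exp (real n * C)" for n x
  proof (induction n arbitrary: x)
    case 0
    then show ?case using expansion_id[OF k, of x] by (simp add: id_def)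
  next
    case (Suc n)
    have "expansion k (f ^^ Suc n) x \<le> expansion k f x * expansion k (f ^^ n) (f x)"
      using sub[of 1 n x] by simp
    also have "\<dots> \<le> exp C * exp (real n * C)"
      using f1 Suc expansion_nonneg[OF smooth_map_iterate[OF f] k] by (intro mult_mono) auto
    also have "\<dots> = exp (real (Suc n) * C)" by (simp add: exp_add[symmetric] algebra_simps)
    finally show ?case .
  qed
  with C0 sub show thesis by (intro that[of C]) auto
qed

section \<open>Cubes and their volumes\<close>

definition cube_deriv :: "('m, 'e) chart \<Rightarrow> (real^'k::finite \<Rightarrow> 'm) \<Rightarrow> real^'k \<Rightarrow> real^'k \<Rightarrow> 'e" where
  "cube_deriv c \<sigma> x = frechet_derivative (coord c \<circ> \<sigma>) (at x within unit_cube)"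

lemma cube_nbhd:
  fixes \<sigma> :: "real^'k::finite \<Rightarrow> 'm"
  assumes \<sigma>: "\<sigma> \<in> C1_cubes \<A>" and c: "c \<in> \<A>" and x: "x \<in> unit_cube" "\<sigma> x \<in> chart_dom c"
  obtains O' where "open O'" "x \<in> O'" "O' \<inter> unit_cube = \<sigma> -` chart_dom c \<inter> unit_cube"
proof -
  have "continuous_on unit_cube \<sigma>" using \<sigma> by (simp add: C1_cubes_def)
  then obtain O' where "open O'" "O' \<inter> unit_cube = \<sigma> -` chart_dom c \<inter> unit_cube"
    using chart(1)[OF c] unfolding continuous_on_open_invariant by blast
  then show thesis using x by (intro that[of O']) auto
qed

text \<open>The cube has positive length along every axis, so derivatives within it are unique at
  boundary points as well.\<close>

lemma cube_frechet_derivative_unique: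
  fixes h :: "real^'k::finite \<Rightarrow> 'e"
  assumes "x \<in> unit_cube" "(h has_derivative h') (at x within unit_cube)"
  shows "frechet_derivative h (at x within unit_cube) = h'"
  by (rule frechet_derivative_within_cbox[OF _ assms]) (auto simp: Basis_vec_def inner_axis)

text \<open>The derivative is given within the part of the cube that is mapped into the chart, and
  near \<open>x\<close> this part agrees with the cube.\<close>

lemma cube_has_derivative:
  fixes \<sigma> :: "real^'k::finite \<Rightarrow> 'm"
  assumes \<sigma>: "\<sigma> \<in> C1_cubes \<A>" and c: "c \<in> \<A>" and x: "x \<in> unit_cube" "\<sigma> x \<in> chart_dom c"
  shows "(coord c \<circ> \<sigma> has_derivative cube_deriv c \<sigma> x) (at x within unit_cube)"
proof -
  let ?S = "unit_cube \<inter> \<sigma> -` chart_dom c"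
  have "C1_on (coord c \<circ> \<sigma>) ?S" using \<sigma> c by (simp add: C1_cubes_def)
  then obtain h' :: "real^'k \<Rightarrow> (real^'k) \<Rightarrow>\<^sub>L 'e" where
    "\<forall>x\<in>?S. (coord c \<circ> \<sigma> has_derivative blinfun_apply (h' x)) (at x within ?S)"
    unfolding C1_on_def by blast
  then have d: "(coord c \<circ> \<sigma> has_derivative blinfun_apply (h' x)) (at x within ?S)" using x by blast
  obtain O' where O': "open O'" "x \<in> O'" "O' \<inter> unit_cube = \<sigma> -` chart_dom c \<inter> unit_cube"
    by (rule cube_nbhd[OF \<sigma> c x])
  have "at x within ?S = at x within unit_cube"
    by (rule at_within_nhd[OF O'(2,1)]) (use O'(3) in blast)
  with d have d': "(coord c \<circ> \<sigma> has_derivative blinfun_apply (h' x)) (at x within unit_cube)" by simp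
  show ?thesis
    unfolding cube_deriv_def cube_frechet_derivative_unique[OF x(1) d'] by (rule d')
qed

lemma cube_tangent_map_eq: "cube_tangent_map \<A> \<sigma> x = cube_deriv (chart_at \<A> (\<sigma> x)) \<sigma> x"
  by (simp add: cube_tangent_map_def cube_deriv_def)

lemma linear_cube_tangent_map:
  assumes "\<sigma> \<in> C1_cubes \<A>" "x \<in> unit_cube"
  shows "linear (cube_tangent_map \<A> \<sigma> x)"
  unfolding cube_tangent_map_eq
  by (rule has_derivative_linear[OF cube_has_derivative[OF assms(1) chart_at(1) assms(2) chart_at(2)]])

lemma cube_tangent_map_compose:
  fixes \<sigma> :: "real^'k::finite \<Rightarrow> 'm"
  assumes f: "smooth_map f" and \<sigma>: "\<sigma> \<in> C1_cubes \<A>" and x: "x \<in> unit_cube"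
  shows "cube_tangent_map \<A> (f \<circ> \<sigma>) x = tangent_map \<A> f (\<sigma> x) \<circ> cube_tangent_map \<A> \<sigma> x"
proof -
  let ?c = "chart_at \<A> (\<sigma> x)" and ?c' = "chart_at \<A> (f (\<sigma> x))"
  have d1: "(coord ?c \<circ> \<sigma> has_derivative cube_deriv ?c \<sigma> x) (at x within unit_cube)"
    by (rule cube_has_derivative[OF \<sigma> chart_at(1) x chart_at(2)])
  have "(local_rep ?c ?c' f has_derivative local_deriv ?c ?c' f (\<sigma> x)) (at ((coord ?c \<circ> \<sigma>) x))"
    using smooth_mapD(1)[OF f chart_at(1) chart_at(1) chart_at(2) chart_at(2)] by simp
  from diff_chain_within[OF d1 has_derivative_at_withinI[OF this]]
  have d: "(local_rep ?c ?c' f \<circ> (coord ?c \<circ> \<sigma>) has_derivative local_deriv ?c ?c' f (\<sigma> x) \<circ> cube_deriv ?c \<sigma> x)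
      (at x within unit_cube)" .
  obtain O' where O': "open O'" "x \<in> O'" "O' \<inter> unit_cube = \<sigma> -` chart_dom ?c \<inter> unit_cube"
    by (rule cube_nbhd[OF \<sigma> chart_at(1) x chart_at(2)])
  have eq: "(local_rep ?c ?c' f \<circ> (coord ?c \<circ> \<sigma>)) y = (coord ?c' \<circ> (f \<circ> \<sigma>)) y" if "y \<in> O'" "y \<in> unit_cube" for y
  proof -
    have "\<sigma> y \<in> chart_dom ?c" using O'(3) that by blast
    then show ?thesis by (simp add: local_rep_def chart_inv_coord[OF chart_at(1)])
  qed
  have "(coord ?c' \<circ> (f \<circ> \<sigma>) has_derivative local_deriv ?c ?c' f (\<sigma> x) \<circ> cube_deriv ?c \<sigma> x) (at x within unit_cube)"
  proof (rule has_derivative_transform_eventually[where g = "coord ?c' \<circ> (f \<circ> \<sigma>)", OF d _ eq[OF O'(2) x] x])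
    show "eventually (\<lambda>y. (local_rep ?c ?c' f \<circ> (coord ?c \<circ> \<sigma>)) y = (coord ?c' \<circ> (f \<circ> \<sigma>)) y) (at x within unit_cube)"
      unfolding eventually_at_topological using O'(1,2) eq by blast
  qed
  from cube_frechet_derivative_unique[OF x this] show ?thesis
    by (simp add: cube_tangent_map_eq tangent_map_eq cube_deriv_def)
qed

lemma volume_compose_le:
  fixes \<sigma> :: "real^'k::finite \<Rightarrow> 'm"
  assumes f: "smooth_map f" and \<sigma>: "\<sigma> \<in> C1_cubes \<A>" and k: "CARD('k) \<le> DIM('e)"
    and A: "\<And>x. expansion CARD('k) f x \<le> A" and pos: "0 < volume \<A> g \<sigma>"
  shows "volume \<A> g (f \<circ> \<sigma>) \<le> A * volume \<A> g \<sigma>"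
proof -
  let ?k = "CARD('k)"
  let ?G = "\<lambda>x. ext_opnorm TYPE('k) inner (metric_at \<A> g (\<sigma> x)) (cube_tangent_map \<A> \<sigma> x)"
  let ?F = "\<lambda>x. ext_opnorm TYPE('k) inner (metric_at \<A> g ((f \<circ> \<sigma>) x)) (cube_tangent_map \<A> (f \<circ> \<sigma>) x)"
  have A0: "0 \<le> A" using order_trans[OF expansion_nonneg[OF f k] A] .
  have G: "?G x = pvol ?k inner (metric_at \<A> g (\<sigma> x)) (cube_tangent_map \<A> \<sigma> x)" "0 \<le> ?G x" if "x \<in> unit_cube" for x
  proof -
    show *: "?G x = pvol ?k inner (metric_at \<A> g (\<sigma> x)) (cube_tangent_map \<A> \<sigma> x)"
      by (rule ext_opnorm_eq_pvol[OF pos_def_inner pos_def_metric_at linear_cube_tangent_map[OF \<sigma> that]]) simp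
    show "0 \<le> ?G x" unfolding *
      by (rule pvol_nonneg[OF pos_def_inner pos_def_metric_at linear_cube_tangent_map[OF \<sigma> that]]) simp
  qed
  have FG: "?F x \<le> A * ?G x" if x: "x \<in> unit_cube" for x
  proof -
    have lin: "linear (tangent_map \<A> f (\<sigma> x) \<circ> cube_tangent_map \<A> \<sigma> x)"
      by (intro linear_compose linear_cube_tangent_map[OF \<sigma> x] linear_tangent_map[OF f])
    have "?F x = pvol ?k inner (metric_at \<A> g (f (\<sigma> x))) (tangent_map \<A> f (\<sigma> x) \<circ> cube_tangent_map \<A> \<sigma> x)"
      unfolding cube_tangent_map_compose[OF f \<sigma> x] o_apply[of f \<sigma> x]
      by (rule ext_opnorm_eq_pvol[OF pos_def_inner pos_def_metric_at lin]) simp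
    also have "\<dots> \<le> expansion ?k f (\<sigma> x) * ?G x"
      unfolding expansion_def G(1)[OF x]
      by (rule pvol_compose_le[OF pos_def_inner pos_def_metric_at pos_def_metric_at
            linear_cube_tangent_map[OF \<sigma> x] linear_tangent_map[OF f]]) (use k in auto)
    also have "\<dots> \<le> A * ?G x" by (rule mult_right_mono[OF A G(2)[OF x]])
    finally show ?thesis .
  qed
  have vol: "volume \<A> g \<sigma> = (LINT x|lborel. indicator unit_cube x *\<^sub>R ?G x)"
    "volume \<A> g (f \<circ> \<sigma>) = (LINT x|lborel. indicator unit_cube x *\<^sub>R ?F x)"
    by (simp_all add: volume_def set_lebesgue_integral_def)
  \<comment> \<open>The integral of a function that is not integrable is \<open>0\<close>, so
    positive volume entails integrability.\<close>
  have int: "integrable lborel (\<lambda>x. indicator unit_cube x *\<^sub>R ?G x)"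
    using pos not_integrable_integral_eq[of lborel "\<lambda>x. indicator unit_cube x *\<^sub>R ?G x"] unfolding vol by linarith
  \<comment> \<open>Integrability and nonnegativity of the larger function suffice: if the smaller
    one is not integrable, its integral is \<open>0\<close>.\<close>
  have "volume \<A> g (f \<circ> \<sigma>) \<le> (LINT x|lborel. A * (indicator unit_cube x *\<^sub>R ?G x))"
    unfolding vol(2)
  proof (rule integral_mono')
    show "integrable lborel (\<lambda>x. A * (indicator unit_cube x *\<^sub>R ?G x))" using int by (rule integrable_mult_right)
    show "indicator unit_cube x *\<^sub>R ?F x \<le> A * (indicator unit_cube x *\<^sub>R ?G x)" for x
      using FG[of x] by (cases "x \<in> unit_cube") auto
    show "0 \<le> A * (indicator unit_cube x *\<^sub>R ?G x)" for x
      using G(2)[of x] A0 by (cases "x \<in> unit_cube") auto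
  qed
  then show ?thesis unfolding vol(1) by simp
qed

lemma ln_ereal_le:
  assumes "x \<le> ereal (exp b)"
  shows "ln_ereal x \<le> ereal b"
proof (cases "0 < x")
  case True
  then obtain r where r: "x = ereal r" "0 < r" "r \<le> exp b" using assms by (cases x) auto
  then show ?thesis by (simp add: ln_ereal_def) (metis ln_exp ln_le_cancel_iff exp_gt_zero)
qed (simp add: ln_ereal_def not_less)

lemma dilation_le:
  assumes f: "smooth_map f" and k: "CARD('k::finite) \<le> DIM('e)"
    and ev: "eventually (\<lambda>n. \<forall>x. expansion CARD('k) (f ^^ n) x \<le> exp (real n * b)) sequentially"
  shows "dilation TYPE('k) \<A> g f \<le> ereal b"
  unfolding dilation_def
proof (rule Limsup_bounded)
  show "eventually (\<lambda>n. ereal (1 / real n) * ln_ereal (SUP \<sigma>\<in>{\<sigma> \<in> C1_cubes \<A> :: (real^'k \<Rightarrow> 'm) set. volume \<A> g \<sigma> > 0}.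
      ereal (volume \<A> g ((f ^^ n) \<circ> \<sigma>) / volume \<A> g \<sigma>)) \<le> ereal b) sequentially"
    using ev eventually_gt_at_top[of 0]
  proof eventually_elim
    case (elim n)
    have "(SUP \<sigma>\<in>{\<sigma> \<in> C1_cubes \<A> :: (real^'k \<Rightarrow> 'm) set. volume \<A> g \<sigma> > 0}.
        ereal (volume \<A> g ((f ^^ n) \<circ> \<sigma>) / volume \<A> g \<sigma>)) \<le> ereal (exp (real n * b))"
    proof (rule SUP_least)
      fix \<sigma> :: "real^'k \<Rightarrow> 'm" assume "\<sigma> \<in> {\<sigma> \<in> C1_cubes \<A>. volume \<A> g \<sigma> > 0}"
      then show "ereal (volume \<A> g ((f ^^ n) \<circ> \<sigma>) / volume \<A> g \<sigma>) \<le> ereal (exp (real n * b))"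
        using volume_compose_le[OF smooth_map_iterate[OF f, of n] _ k, of \<sigma>] elim(1) by (simp add: divide_le_eq)
    qed
    then have "ereal (1 / real n) * ln_ereal (SUP \<sigma>\<in>{\<sigma> \<in> C1_cubes \<A> :: (real^'k \<Rightarrow> 'm) set. volume \<A> g \<sigma> > 0}.
        ereal (volume \<A> g ((f ^^ n) \<circ> \<sigma>) / volume \<A> g \<sigma>)) \<le> ereal (1 / real n) * ereal (real n * b)"
      by (intro ereal_mult_left_mono ln_ereal_le) auto
    then show ?case using elim(2) by simp
  qed
qed

lemma expansion_eq_prod_singular:
  assumes "smooth_map f" "j \<le> DIM('e)"
  shows "expansion j f x = (\<Prod>i<j. tangent_singular_value \<A> g f x (Suc i))"
  unfolding expansion_def tangent_singular_value_def
  by (simp add: prod_singular_values[OF pos_def_metric_at pos_def_metric_at linear_tangent_map[OF assms(1)] assms(2), symmetric])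

lemma tangent_singular_value_antimono:
  assumes "smooth_map f" "i \<le> j" "j < DIM('e)"
  shows "tangent_singular_value \<A> g f x (Suc j) \<le> tangent_singular_value \<A> g f x (Suc i)"
    and "0 \<le> tangent_singular_value \<A> g f x (Suc j)"
  unfolding tangent_singular_value_def
  using singular_values_antimono[OF pos_def_metric_at pos_def_metric_at linear_tangent_map[OF assms(1)] assms(2,3)]
  by auto

end

section \<open>Lyapunov exponents of an ergodic measure\<close>

lemma ergodic_invariant_imp_ergodic_system:
  assumes "ergodic_invariant f M"
  shows "ergodic_system M f"
proof -
  have s: "sets M = sets borel" using assms by (simp add: ergodic_invariant_def)
  interpret prob_space M using assms by (simp add: ergodic_invariant_def)
  show ?thesis
    using assms sets_eq_imp_space_eq[OF s] by unfold_locales (auto simp: ergodic_invariant_def)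
qed

lemma exists_lyapunov_exponents:
  fixes \<A> :: "('m::{t2_space, second_countable_topology}, 'e::euclidean_space) chart set"
    and g :: "('m, 'e) metric"
  assumes comp: "compact (UNIV :: 'm set)" and R: "riemannian_manifold \<A> g"
    and f: "C1_manifold.smooth_map \<A> f" and \<nu>: "ergodic_invariant f \<nu>" and k: "k \<le> DIM('e)"
  obtains \<kappa> where "lyapunov_exponents \<A> g f \<nu> \<kappa>"
    "\<And>\<beta>. \<forall>n T. n \<ge> 1 \<longrightarrow> real n * \<beta> \<le>
      (LINT x|\<nu>. ln (max (riemannian_manifold.expansion \<A> g k (f ^^ n) x) (exp T))) \<Longrightarrow>
      ereal \<beta> \<le> (\<Sum>i = 1..k. \<kappa> i)"
proof -
  interpret riemannian_manifold \<A> g by (rule R)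
  interpret E: ergodic_system \<nu> f by (rule ergodic_invariant_imp_ergodic_system[OF \<nu>])
  have s\<nu> [measurable_cong]: "sets \<nu> = sets borel" using \<nu> by (simp add: ergodic_invariant_def)
  let ?d = "DIM('e)"
  have ex: "\<exists>c. c < \<infinity> \<and> (AE x in \<nu>. (\<lambda>n. rate n (expansion j (f ^^ n) x)) \<longlonglongrightarrow> c) \<and>
      (\<forall>\<beta>. (\<forall>n T. n \<ge> 1 \<longrightarrow> real n * \<beta> \<le> (LINT x|\<nu>. ln (max (expansion j (f ^^ n) x) (exp T)))) \<longrightarrow> ereal \<beta> \<le> c)"
    if j: "j \<le> ?d" for j
  proof -
    obtain C where C: "0 \<le> C" "\<And>n x. expansion j (f ^^ n) x \<le> exp (real n * C)"
      "\<And>n m x. expansion j (f ^^ (n + m)) x \<le> expansion j (f ^^ n) x * expansion j (f ^^ m) ((f ^^ n) x)"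
      using expansion_cocycle[OF comp f j] by blast
    interpret K: submultiplicative_cocycle \<nu> f "\<lambda>n. expansion j (f ^^ n)" C
    proof
      show "expansion j (f ^^ n) \<in> borel_measurable \<nu>" for n
        using borel_measurable_continuous_onI[OF continuous_expansion[OF smooth_map_iterate[OF f] j]]
        by measurable
    qed (auto intro: C expansion_nonneg[OF smooth_map_iterate[OF f] j])
    show ?thesis by (rule K.kingman) blast
  qed
  have "\<exists>c. \<forall>j. j \<le> ?d \<longrightarrow> c j < \<infinity> \<and> (AE x in \<nu>. (\<lambda>n. rate n (expansion j (f ^^ n) x)) \<longlonglongrightarrow> c j) \<and>
      (\<forall>\<beta>. (\<forall>n T. n \<ge> 1 \<longrightarrow> real n * \<beta> \<le> (LINT x|\<nu>. ln (max (expansion j (f ^^ n) x) (exp T)))) \<longrightarrow> ereal \<beta> \<le> c j)"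
    by (rule choice) (use ex in blast)
  then obtain c where all: "\<forall>j. j \<le> ?d \<longrightarrow> c j < \<infinity> \<and> (AE x in \<nu>. (\<lambda>n. rate n (expansion j (f ^^ n) x)) \<longlonglongrightarrow> c j) \<and>
      (\<forall>\<beta>. (\<forall>n T. n \<ge> 1 \<longrightarrow> real n * \<beta> \<le> (LINT x|\<nu>. ln (max (expansion j (f ^^ n) x) (exp T)))) \<longrightarrow> ereal \<beta> \<le> c j)"
    by (rule exE)
  note c = all[THEN spec, THEN mp, THEN conjunct1] all[THEN spec, THEN mp, THEN conjunct2, THEN conjunct1]
    all[THEN spec, THEN mp, THEN conjunct2, THEN conjunct2, THEN spec, THEN mp]
  define s where "s x i n = tangent_singular_value \<A> g (f ^^ n) x (Suc i)" for x i n
  have s1: "0 \<le> s x i n" if "i < ?d" for x i n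
    unfolding s_def by (rule tangent_singular_value_antimono(2)[OF smooth_map_iterate[OF f] order_refl that])
  have s2: "s x j n \<le> s x i n" if "i \<le> j" "j < ?d" for x i j n
    unfolding s_def by (rule tangent_singular_value_antimono(1)[OF smooth_map_iterate[OF f] that])
  define \<kappa>' where "\<kappa>' j = (if c j = -\<infinity> then -\<infinity> else c (Suc j) - c j)" for j
  have good: "AE x in \<nu>. \<forall>j\<in>{..?d}. (\<lambda>n. rate n (\<Prod>i<j. s x i n)) \<longlonglongrightarrow> c j"
    using c(2) expansion_eq_prod_singular[OF smooth_map_iterate[OF f]]
    by (subst AE_finite_all) (auto simp: s_def)
  have lim: "(\<lambda>n. rate n (s x j n)) \<longlonglongrightarrow> \<kappa>' j" "c j = -\<infinity> \<Longrightarrow> c (Suc j) = -\<infinity>"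
    if x: "\<forall>j\<in>{..?d}. (\<lambda>n. rate n (\<Prod>i<j. s x i n)) \<longlonglongrightarrow> c j" and j: "j < ?d" for x j
    using rates_of_factors[of ?d "s x" c j, OF s1 s2] x j c(1) unfolding \<kappa>'_def by auto
  \<comment> \<open>The rates are constants, so their algebraic relations and their order can be
    read off at a single typical point.\<close>
  obtain x0 where x0: "\<forall>j\<in>{..?d}. (\<lambda>n. rate n (\<Prod>i<j. s x0 i n)) \<longlonglongrightarrow> c j"
    using eventually_happens[OF good] E.ae_filter_bot by auto
  have c0: "c 0 = 0"
  proof (rule LIMSEQ_unique)
    show "(\<lambda>n. rate n (\<Prod>i<0. s x0 i n)) \<longlonglongrightarrow> c 0" using x0 by blast
    show "(\<lambda>n. rate n (\<Prod>i<0. s x0 i n)) \<longlonglongrightarrow> 0"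
      by (rule tendsto_eventually) (auto simp: eventually_sequentially rate_pos zero_ereal_def intro!: exI[of _ 1])
  qed
  \<comment> \<open>Exponents are numbered from 1, the factors of the products from 0.\<close>
  define \<kappa> where "\<kappa> i = \<kappa>' (i - 1)" for i
  have "lyapunov_exponents \<A> g f \<nu> \<kappa>"
    unfolding lyapunov_exponents_def
  proof (intro conjI ballI)
    fix i assume "i \<in> {1..?d}"
    then have i: "i - 1 < ?d" "Suc (i - 1) \<le> ?d" by auto
    show "\<kappa> i < \<infinity>"
      using c(1)[of "i - 1"] c(1)[OF i(2)] i(1)
      by (cases "c (i - 1)"; cases "c (Suc (i - 1))") (auto simp: \<kappa>_def \<kappa>'_def)
  next
    fix i j assume ij: "i \<in> {1..?d}" "j \<in> {i..?d}"
    then have "i - 1 < ?d" "j - 1 < ?d" "i - 1 \<le> j - 1" by auto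
    then show "\<kappa> j \<le> \<kappa> i"
      unfolding \<kappa>_def
      by (intro LIMSEQ_le[OF lim(1)[OF x0] lim(1)[OF x0]] exI[of _ 0] allI impI rate_mono s2) auto
  next
    show "AE x in \<nu>. \<forall>i\<in>{1..?d}. (\<lambda>n. ereal (1 / real n) * ln_ereal (ereal (tangent_singular_value \<A> g (f ^^ n) x i))) \<longlonglongrightarrow> \<kappa> i"
      using good
    proof eventually_elim
      case (elim x)
      show ?case
      proof
        fix i assume "i \<in> {1..?d}"
        then have "i - 1 < ?d" "Suc (i - 1) = i" by auto
        then show "(\<lambda>n. ereal (1 / real n) * ln_ereal (ereal (tangent_singular_value \<A> g (f ^^ n) x i))) \<longlonglongrightarrow> \<kappa> i"
          using lim(1)[OF elim, of "i - 1"] by (simp add: s_def rate_def \<kappa>_def)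
      qed
    qed
  qed
  moreover have "(\<Sum>i = 1..k. \<kappa> i) = c k"
  proof -
    have "(\<Sum>i = 1..k. \<kappa> i) = (\<Sum>j<k. \<kappa>' j)" by (simp add: sum.atLeast1_atMost_eq \<kappa>_def)
    also have "\<dots> = c k"
      unfolding \<kappa>'_def by (rule sum_of_differences[OF c0 c(1) lim(2)[OF x0] k]) auto
    finally show ?thesis .
  qed
  ultimately show thesis using c(3)[OF k] by (intro that[of \<kappa>]) simp_all
qed

theorem mainTheorem1:
  fixes \<A> :: "('m::{t2_space, second_countable_topology}, real^'d) chart set"
    and g :: "('m, real^'d) metric"
    and f :: "'m \<Rightarrow> 'm"
  assumes "compact (UNIV :: 'm set)"
    and "C1_atlas \<A>"
    and "riemannian_metric \<A> g"
    and "C1_map \<A> f"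
    and "CARD('k::finite) \<le> CARD('d)"
  shows "\<exists>\<nu> \<kappa>. ergodic_invariant f \<nu> \<and> lyapunov_exponents \<A> g f \<nu> \<kappa> \<and>
           (\<Sum>i = 1..CARD('k). \<kappa> i) \<ge> dilation TYPE('k) \<A> g f"
proof -
  interpret riemannian_manifold \<A> g by unfold_locales fact+
  have f: "smooth_map f" by (rule smooth_map_of_C1_map) fact
  have k: "CARD('k) \<le> DIM(real^'d)" using assms(5) by simp
  obtain C where C: "0 \<le> C" "\<And>n x. expansion CARD('k) (f ^^ n) x \<le> exp (real n * C)"
    "\<And>n m x. expansion CARD('k) (f ^^ (n + m)) x \<le>
      expansion CARD('k) (f ^^ n) x * expansion CARD('k) (f ^^ m) ((f ^^ n) x)"
    using expansion_cocycle[OF assms(1) f k] by blast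
  interpret continuous_cocycle f "\<lambda>n. expansion CARD('k) (f ^^ n)" C
    using assms(1) smooth_map_continuous[OF f] continuous_expansion[OF smooth_map_iterate[OF f] k]
      expansion_nonneg[OF smooth_map_iterate[OF f] k] C
    by unfold_locales auto
  show ?thesis
  proof (rule exists_ergodic_of_maximal_growth)
    fix \<nu> assume \<nu>: "ergodic_invariant f \<nu>" and growth: "\<And>D :: ereal.
      (\<And>b. eventually (\<lambda>n. \<forall>x. expansion CARD('k) (f ^^ n) x \<le> exp (real n * b)) sequentially \<Longrightarrow> D \<le> ereal b) \<Longrightarrow>
      D = -\<infinity> \<or> (\<exists>\<beta>. D \<le> ereal \<beta> \<and>
        (\<forall>n T. n \<ge> 1 \<longrightarrow> real n * \<beta> \<le> (LINT x|\<nu>. ln (max (expansion CARD('k) (f ^^ n) x) (exp T)))))"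
    obtain \<kappa> where \<kappa>: "lyapunov_exponents \<A> g f \<nu> \<kappa>"
      "\<And>\<beta>. \<forall>n T. n \<ge> 1 \<longrightarrow> real n * \<beta> \<le> (LINT x|\<nu>. ln (max (expansion CARD('k) (f ^^ n) x) (exp T))) \<Longrightarrow>
        ereal \<beta> \<le> (\<Sum>i = 1..CARD('k). \<kappa> i)"
      by (rule exists_lyapunov_exponents[OF assms(1) riemannian_manifold_axioms f \<nu> k]) (rule that)
    \<comment> \<open>The dilation is an admissible \<open>D\<close>: every exponential bound on the
      expansions that holds uniformly in \<open>x\<close> for large \<open>n\<close> bounds it as
      well.\<close>
    have "dilation TYPE('k) \<A> g f = -\<infinity> \<or> (\<exists>\<beta>. dilation TYPE('k) \<A> g f \<le> ereal \<beta> \<and>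
        (\<forall>n T. n \<ge> 1 \<longrightarrow> real n * \<beta> \<le> (LINT x|\<nu>. ln (max (expansion CARD('k) (f ^^ n) x) (exp T)))))"
      by (rule growth) (rule dilation_le[OF f k])
    then have "dilation TYPE('k) \<A> g f \<le> (\<Sum>i = 1..CARD('k). \<kappa> i)"
    proof (elim disjE exE conjE)
      fix \<beta> assume "dilation TYPE('k) \<A> g f \<le> ereal \<beta>"
        "\<forall>n T. n \<ge> 1 \<longrightarrow> real n * \<beta> \<le> (LINT x|\<nu>. ln (max (expansion CARD('k) (f ^^ n) x) (exp T)))"
      then show ?thesis by (rule order_trans[OF _ \<kappa>(2)])
    qed simp
    with \<nu> \<kappa>(1) show ?thesis by blast
  qed
qed

end
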